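(* Let $\alpha,\beta,\gamma$ be permutations each of length at least $3$, and write $m=|\beta|$, $n=|\gamma|$. The class $\mathrm{Av}(\alpha,\beta,\gamma)$ has polynomial growth if and only if, up to symmetry and permutation of the roles of $\alpha,\beta,\gamma$, one of the following holds: 1. $\alpha=213$, and (a) $3412\preceq\beta\in L_2^R$ and $\gamma=12\cdots k\,n(n-1)\cdots(k+1)$ for some $k$; or (b) $\beta=m(m-1)\cdots(j+2)\,j\,(j+1)\,(j-1)(j-2)\cdots1$ and $\gamma=12\cdots k\,n(n-1)\cdots(k+1)$ for some $j,k$; or (c) $\beta=m(m-1)\cdots 3\,1\,2$ and $\gamma\in W(+1,-1)$. 2. $\alpha$ is increasing, and (a) $3412\preceq\beta\in L_2^R$ and $\gamma\in W(-1,-1)\cap W(-1,-1)^{-1}$; or (b) $\mathrm{Av}(\alpha,\beta)$ has polynomial growth. 3. $\alpha=2\,1\,3\,4\,5\cdots s$ (where $s=|\alpha|$), and (a) $3412\preceq\beta\in L_2^R$ and $\gamma=1\,n(n-1)\cdots 2$; or (b) $\beta=m(m-1)\cdots(j+2)\,j\,(j+1)\,(j-1)(j-2)\cdots1$ and $\gamma=12\cdots k\,n(n-1)\cdots(k+1)$ for some $j,k$; or (c) $\beta=m(m-1)\cdots 3\,1\,2$ and $\gamma\in W(+1,-1)$.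
   Context: $\pi\preceq\sigma$ means $\sigma$ has a subsequence order isomorphic to $\pi$. For a set $\Pi$ of permutations, $\mathrm{Av}(\Pi)$ is the set of permutations avoiding every element of $\Pi$ and $c_n(\Pi)$ is the number of its elements of length $n$; $\mathrm{Av}(\Pi)$ has polynomial growth if $c_n(\Pi)\le An^d$ for all $n$, for some constants $A,d$. "Up to symmetry" means up to applying simultaneously to all three permutations any of the eight symmetries generated by reversal, complement and inverse. For signs $e_1,\dots,e_r\in\{+1,-1\}$, $W(e_1,\dots,e_r)$ is the set of permutations admitting a segmentation $\sigma_1\cdots\sigma_r$ into consecutive, possibly empty, segments with $\sigma_i$ increasing if $e_i=+1$ and decreasing if $e_i=-1$; for a class $C$, $C^{-1}$ is the set of inverses of its elements. $L_2^R$ is the class of permutations consisting of decreasing layers, each a singleton or an increasing doubleton, i.e. $\tau_1\ominus\cdots\ominus\tau_k$ with each $\tau_i\in\{1,12\}$ ($\ominus$ places the second permutation below and to the right of the first). *)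

theory Defs
  imports Complex_Main "HOL-Library.Sublist" "HOL-Combinatorics.Multiset_Permutations"
begin

text \<open>Permutations are lists in one-line notation with entries \<open>1, \<dots>, n\<close>.\<close>

definition is_perm :: "nat list \<Rightarrow> bool" where
  "is_perm p \<longleftrightarrow> p \<in> permutations_of_set {1..length p}"

definition order_iso :: "nat list \<Rightarrow> nat list \<Rightarrow> bool" where
  "order_iso xs ys \<longleftrightarrow> length xs = length ys \<and>
     (\<forall>i<length xs. \<forall>j<length xs. xs ! i < xs ! j \<longleftrightarrow> ys ! i < ys ! j)"

definition contains_pat :: "nat list \<Rightarrow> nat list \<Rightarrow> bool" (infix "\<preceq>" 50) where
  "\<pi> \<preceq> \<sigma> \<longleftrightarrow> (\<exists>\<tau>. subseq \<tau> \<sigma> \<and> order_iso \<pi> \<tau>)"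

definition Av :: "nat list set \<Rightarrow> nat list set" where
  "Av B = {\<sigma>. is_perm \<sigma> \<and> (\<forall>\<pi>\<in>B. \<not> \<pi> \<preceq> \<sigma>)}"

definition class_count :: "nat list set \<Rightarrow> nat \<Rightarrow> nat" where
  "class_count C n = card {\<sigma> \<in> C. length \<sigma> = n}"

text \<open>The bound is required for \<open>n \<ge> 1\<close> only: at \<open>n = 0\<close> the empty permutation
  is counted, while \<open>A * 0 ^ d\<close> vanishes for \<open>d > 0\<close>.\<close>

definition polynomial_growth :: "nat list set \<Rightarrow> bool" where
  "polynomial_growth C \<longleftrightarrow>
     (\<exists>(A::real) (d::nat). \<forall>n\<ge>1. real (class_count C n) \<le> A * real n ^ d)"

definition perm_complement :: "nat list \<Rightarrow> nat list" where
  "perm_complement p = map (\<lambda>v. length p + 1 - v) p"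

text \<open>The entry at position \<open>v\<close> of the inverse is the position (counted from 1) of the
  value \<open>v\<close> in \<open>p\<close>.\<close>

definition perm_inverse :: "nat list \<Rightarrow> nat list" where
  "perm_inverse p =
     map (\<lambda>v. inv_into {..<length p} ((!) p) v + 1) [1..<length p + 1]"

text \<open>As maps on permutations these are exactly the eight symmetries; values on lists that
  are not permutations are irrelevant.\<close>

inductive_set symmetries :: "(nat list \<Rightarrow> nat list) set" where
  identity: "id \<in> symmetries"
| reversal: "f \<in> symmetries \<Longrightarrow> rev \<circ> f \<in> symmetries"
| complement: "f \<in> symmetries \<Longrightarrow> perm_complement \<circ> f \<in> symmetries"
| inverse: "f \<in> symmetries \<Longrightarrow> perm_inverse \<circ> f \<in> symmetries"

definition monotone_seg :: "int \<Rightarrow> nat list \<Rightarrow> bool" where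
  "monotone_seg e xs \<longleftrightarrow>
     (e = 1 \<and> sorted_wrt (<) xs) \<or> (e = -1 \<and> sorted_wrt (>) xs)"

definition W :: "int list \<Rightarrow> nat list set" where
  "W es = {\<sigma>. is_perm \<sigma> \<and>
     (\<exists>segs. concat segs = \<sigma> \<and> list_all2 monotone_seg es segs)}"

definition class_inverse :: "nat list set \<Rightarrow> nat list set" where
  "class_inverse C = perm_inverse ` C"

definition skew_sum :: "nat list \<Rightarrow> nat list \<Rightarrow> nat list" (infixr "\<ominus>" 65) where
  "\<sigma> \<ominus> \<tau> = map (\<lambda>v. v + length \<tau>) \<sigma> @ \<tau>"

definition L2R :: "nat list set" where
  "L2R = {foldr (\<ominus>) \<tau>s [] | \<tau>s. set \<tau>s \<subseteq> {[1], [1, 2]}}"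

end

theory Submission
  imports Defs "HOL-Library.Ramsey"
begin

text \<open>
The class \<open>Av(\<Pi>)\<close> has polynomial growth exactly when \<open>\<Pi>\<close> meets each of ten classes: the four classes
\<open>W(\<plusminus>1,\<plusminus>1)\<close>, their inverses, \<open>L\<^sub>2\<^sup>R\<close> and its reversal. These classes are closed under
patterns and grow exponentially, so none may be contained in \<open>Av(\<Pi>)\<close>.
Conversely, call \<open>i\<close> a break if the entries at \<open>i\<close> and \<open>i + 1\<close> do not differ by one. A permutation
with boundedly many breaks is one of polynomially many. At a break some entry has a value strictly
between the two neighbours; applying Ramsey's theorem to many such triples yields a configuration
containing every short member of one of the ten classes.
It remains to decide which triples meet all ten classes. One permutation must lie in
\<open>L\<^sub>2\<^sup>R\<close> and another in its reversal; each of these is monotone, has exactly one layer of size two, or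
contains \<open>3412\<close> (or its reversal). This leaves few possibilities for the third.
\<close>

section \<open>Permutations, symmetries and occurrences of patterns\<close>

text \<open>The ten classes are the possible outcomes of one homogeneous configuration. Two
  neighbours at a break span a value interval, and in a homogeneous family these intervals overlap
  pairwise, ascend or descend. If they overlap, the lower ends and the upper ends are two monotone
  sequences stacked in value, which gives an inverse class W. If they are disjoint, they are slots
  ordered by value: either the pairs themselves are layers, or the separating entries all lie far to
  one side, which gives a class W, or each stays beside its own pair and forms a layer with one of
  its entries. The signs are the directions of the homogeneous sequences. Among the triples without
  a monotone member the decisive classes are W(+1,-1) and W(-1,+1). Both are invariant under
  reversal, and a permutation in both is monotone. Hence one of the two layered permutations lies in
  one of these classes, and then its only layer of size two sits at an end: up to symmetry it is 2 1
  3 ... s. The case s = 3 is special because 213 also lies in W(-1,-1) and in the inverse of that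
  class, which fails for s > 3.\<close>

lemma is_perm_iff: "is_perm p \<longleftrightarrow> set p = {1..length p} \<and> distinct p"
  by (simp add: is_perm_def permutations_of_set_def)

lemma is_perm_nth_bounds:
  assumes "is_perm p" "i < length p"
  shows "1 \<le> p ! i" "p ! i \<le> length p"
  using assms nth_mem[of i p] by (auto simp: is_perm_iff)

lemma is_perm_nth_eq_iff:
  "is_perm p \<Longrightarrow> i < length p \<Longrightarrow> j < length p \<Longrightarrow> p ! i = p ! j \<longleftrightarrow> i = j"
  by (simp add: is_perm_iff nth_eq_iff_index_eq)

lemma is_perm_obtain_index:
  assumes "is_perm p" "1 \<le> v" "v \<le> length p"
  obtains i where "i < length p" "p ! i = v"
  using assms by (metis is_perm_iff atLeastAtMost_iff in_set_conv_nth)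

text \<open>A pigeonhole argument: n distinct entries drawn from 1, ..., n exhaust this set, so
  surjectivity never has to be checked.\<close>

lemma is_permI:
  assumes "\<And>i. i < length p \<Longrightarrow> 1 \<le> p ! i \<and> p ! i \<le> length p"
    and "\<And>i j. i < j \<Longrightarrow> j < length p \<Longrightarrow> p ! i \<noteq> p ! j"
  shows "is_perm p"
proof -
  have d: "distinct p"
    unfolding distinct_conv_nth using assms(2) by (metis linorder_neqE_nat)
  have "set p \<subseteq> {1..length p}" using assms(1) by (auto simp: in_set_conv_nth)
  moreover have "card (set p) = card {1..length p}" using d by (simp add: distinct_card)
  ultimately show ?thesis using d by (simp add: is_perm_iff card_subset_eq)
qed

section \<open>Reversal, complement and inverse as maps on permutations\<close>

lemma is_perm_rev [simp]: "is_perm (rev p) \<longleftrightarrow> is_perm p"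
  by (simp add: is_perm_iff)

lemma length_perm_complement [simp]: "length (perm_complement p) = length p"
  by (simp add: perm_complement_def)

lemma nth_perm_complement: "i < length p \<Longrightarrow> perm_complement p ! i = length p + 1 - p ! i"
  by (simp add: perm_complement_def)

lemma is_perm_complement:
  assumes "is_perm p" shows "is_perm (perm_complement p)"
proof (rule is_permI)
  fix i assume "i < length (perm_complement p)"
  then show "1 \<le> perm_complement p ! i \<and> perm_complement p ! i \<le> length (perm_complement p)"
    using is_perm_nth_bounds[OF assms, of i] by (simp add: nth_perm_complement; linarith)
next
  fix i j assume "i < j" "j < length (perm_complement p)"
  then show "perm_complement p ! i \<noteq> perm_complement p ! j"
    using is_perm_nth_bounds[OF assms, of i] is_perm_nth_bounds[OF assms, of j]
      is_perm_nth_eq_iff[OF assms, of i j]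
    by (simp add: nth_perm_complement; linarith)
qed

lemma perm_complement_involution:
  assumes "is_perm p" shows "perm_complement (perm_complement p) = p"
proof (rule nth_equalityI)
  fix i assume "i < length (perm_complement (perm_complement p))"
  then show "perm_complement (perm_complement p) ! i = p ! i"
    using is_perm_nth_bounds[OF assms, of i] by (simp add: nth_perm_complement; linarith)
qed simp

lemma length_perm_inverse [simp]: "length (perm_inverse p) = length p"
  by (simp add: perm_inverse_def del: upt_Suc)

lemma perm_inverse_nth:
  assumes "is_perm p" "i < length p"
  shows "perm_inverse p ! (p ! i - 1) = i + 1"
proof -
  have inj: "inj_on ((!) p) {..<length p}"
    using is_perm_nth_eq_iff[OF assms(1)] by (auto simp: inj_on_def)
  have "p ! i - 1 < length p" "1 + (p ! i - 1) = p ! i"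
    using is_perm_nth_bounds[OF assms] by linarith+
  then have "perm_inverse p ! (p ! i - 1) = inv_into {..<length p} ((!) p) (p ! i) + 1"
    by (simp add: perm_inverse_def del: upt_Suc)
  then show ?thesis using inj assms(2) by (simp add: inv_into_f_f)
qed

lemma nth_perm_inverse:
  assumes "is_perm p" "v < length p"
  shows "1 \<le> perm_inverse p ! v" "perm_inverse p ! v \<le> length p"
    "p ! (perm_inverse p ! v - 1) = v + 1"
proof -
  obtain i where "i < length p" "p ! i = v + 1"
    using is_perm_obtain_index[OF assms(1), of "v + 1"] assms(2) by auto
  then show "1 \<le> perm_inverse p ! v" "perm_inverse p ! v \<le> length p"
    "p ! (perm_inverse p ! v - 1) = v + 1"
    using perm_inverse_nth[OF assms(1), of i] by auto
qed

lemma is_perm_inverse: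
  assumes "is_perm p" shows "is_perm (perm_inverse p)"
proof (rule is_permI)
  fix i assume "i < length (perm_inverse p)"
  then show "1 \<le> perm_inverse p ! i \<and> perm_inverse p ! i \<le> length (perm_inverse p)"
    using nth_perm_inverse[OF assms, of i] by simp
next
  fix i j assume "i < j" "j < length (perm_inverse p)"
  then show "perm_inverse p ! i \<noteq> perm_inverse p ! j"
    using nth_perm_inverse(3)[OF assms, of i] nth_perm_inverse(3)[OF assms, of j] by auto
qed

text \<open>Every position of the inverse has the form \<open>p ! i - 1\<close>, so a candidate is
  tested there; inverses are then computed without unfolding \<open>inv_into\<close>.\<close>

lemma perm_inverse_eqI:
  assumes "is_perm p" "length q = length p"
    and "\<And>i. i < length p \<Longrightarrow> q ! (p ! i - 1) = i + 1"
  shows "perm_inverse p = q"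
proof (rule nth_equalityI)
  fix v assume "v < length (perm_inverse p)"
  then obtain i where "i < length p" "p ! i = v + 1"
    using is_perm_obtain_index[OF assms(1), of "v + 1"] by auto
  then show "perm_inverse p ! v = q ! v"
    using perm_inverse_nth[OF assms(1), of i] assms(3)[of i] by simp
qed (simp add: assms(2))

lemma perm_inverse_involution:
  assumes "is_perm p" shows "perm_inverse (perm_inverse p) = p"
proof (rule perm_inverse_eqI[OF is_perm_inverse[OF assms]])
  fix i assume "i < length (perm_inverse p)"
  then show "p ! (perm_inverse p ! i - 1) = i + 1" using nth_perm_inverse(3)[OF assms, of i] by simp
qed simp

text \<open>Inversion reflects the diagram in its diagonal, which exchanges the left-right flip with
  the top-bottom flip.\<close>

lemma perm_inverse_rev:
  assumes "is_perm p" shows "perm_inverse (rev p) = perm_complement (perm_inverse p)"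
proof (rule perm_inverse_eqI)
  fix i assume i: "i < length (rev p)"
  let ?k = "length p - Suc i"
  have "rev p ! i = p ! ?k" using i by (simp add: rev_nth)
  moreover have "?k < length p" using i by simp
  moreover from this have "p ! ?k - 1 < length p"
    using is_perm_nth_bounds[OF assms, of ?k] by linarith
  ultimately show "perm_complement (perm_inverse p) ! (rev p ! i - 1) = i + 1"
    using i perm_inverse_nth[OF assms, of ?k] by (simp add: nth_perm_complement)
qed (use assms in auto)

lemma perm_inverse_complement:
  assumes "is_perm p" shows "perm_inverse (perm_complement p) = rev (perm_inverse p)"
proof -
  have "perm_inverse (rev (perm_inverse p)) = perm_complement p"
    using perm_inverse_rev[OF is_perm_inverse[OF assms]] perm_inverse_involution[OF assms] by simp
  then show ?thesis
    using perm_inverse_involution[of "rev (perm_inverse p)"] is_perm_inverse[OF assms] by simp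
qed

text \<open>The host is an integer-valued sequence instead of a permutation: only comparisons of
  values matter, and integer values can be negated, which reduces descending configurations to
  ascending ones. The witness \<open>h\<close> is the increasing map of positions.\<close>

definition occurs :: "nat list \<Rightarrow> (nat \<Rightarrow> int) \<Rightarrow> nat \<Rightarrow> bool" where
  "occurs \<pi> p n \<longleftrightarrow> (\<exists>h. (\<forall>i<length \<pi>. h i < n) \<and>
     (\<forall>i j. i < j \<longrightarrow> j < length \<pi> \<longrightarrow> h i < (h j :: nat)) \<and>
     (\<forall>i<length \<pi>. \<forall>j<length \<pi>. \<pi> ! i < \<pi> ! j \<longleftrightarrow> p (h i) < p (h j)))"

text \<open>Together with \<open>subseq_obtain_indices\<close> this replaces subsequences by
  strictly increasing lists of positions.\<close>

lemma subseq_map_nth: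
  assumes "sorted_wrt (<) ks" "\<forall>k\<in>set ks. k < length xs"
  shows "subseq (map ((!) xs) ks) xs"
  using assms
proof (induction xs arbitrary: ks)
  case Nil then show ?case by (cases ks) auto
next
  case (Cons x xs)
  \<comment> \<open>Positive indices do not touch the head of the host, so they are lowered by one
    and the induction hypothesis applies to its tail.\<close>
  have shift: "subseq (map ((!) (x # xs)) ls) xs"
    if "sorted_wrt (<) ls" "\<forall>k\<in>set ls. 0 < k \<and> k < length (x # xs)" for ls
  proof -
    have "subseq (map ((!) xs) (map (\<lambda>k. k - 1) ls)) xs"
    proof (rule Cons.IH)
      show "sorted_wrt (<) (map (\<lambda>k. k - 1) ls)"
        unfolding sorted_wrt_map
        by (rule sorted_wrt_mono_rel[OF _ that(1)]) (use that in auto)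
    qed (use that in auto)
    moreover have "map ((!) xs) (map (\<lambda>k. k - 1) ls) = map ((!) (x # xs)) ls"
      using that by (auto simp: nth_Cons')
    ultimately show ?thesis by metis
  qed
  show ?case
  proof (cases ks)
    case (Cons k ls)
    have gt: "\<forall>l\<in>set ls. k < l" using Cons.prems Cons by auto
    show ?thesis
    proof (cases "k = 0")
      case True
      have "subseq (map ((!) (x # xs)) ls) xs"
        by (rule shift) (use Cons.prems Cons gt True in auto)
      then show ?thesis using Cons True by simp
    next
      case False
      have "subseq (map ((!) (x # xs)) ks) xs"
        by (rule shift) (use Cons.prems Cons gt False in auto)
      then show ?thesis by (rule list_emb_Cons)
    qed
  qed simp
qed

lemma subseq_obtain_indices:
  assumes "subseq xs ys"
  obtains ks where "sorted_wrt (<) ks" "\<forall>k\<in>set ks. k < length ys" "xs = map ((!) ys) ks"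
proof -
  have "\<exists>ks. sorted_wrt (<) ks \<and> (\<forall>k\<in>set ks. k < length ys) \<and> xs = map ((!) ys) ks"
    using assms
  proof (induction rule: list_emb.induct)
    case (list_emb_Nil ys) then show ?case by (intro exI[of _ "[]"]) simp
  next
    case (list_emb_Cons xs ys y)
    then obtain ks where "sorted_wrt (<) ks" "\<forall>k\<in>set ks. k < length ys" "xs = map ((!) ys) ks" by blast
    then show ?case by (intro exI[of _ "map Suc ks"]) (auto simp: sorted_wrt_map)
  next
    case (list_emb_Cons2 x y xs ys)
    then obtain ks where "sorted_wrt (<) ks" "\<forall>k\<in>set ks. k < length ys" "xs = map ((!) ys) ks" by blast
    then show ?case using list_emb_Cons2.hyps(1)
      by (intro exI[of _ "0 # map Suc ks"]) (auto simp: sorted_wrt_map)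
  qed
  then show thesis using that by blast
qed

lemma contains_pat_iff_occurs: "\<pi> \<preceq> \<sigma> \<longleftrightarrow> occurs \<pi> (\<lambda>i. int (\<sigma> ! i)) (length \<sigma>)"
proof
  assume "\<pi> \<preceq> \<sigma>"
  then obtain \<tau> where t: "subseq \<tau> \<sigma>" "order_iso \<pi> \<tau>" by (auto simp: contains_pat_def)
  obtain ks where ks: "sorted_wrt (<) ks" "\<forall>k\<in>set ks. k < length \<sigma>" "\<tau> = map ((!) \<sigma>) ks"
    using subseq_obtain_indices[OF t(1)] .
  then show "occurs \<pi> (\<lambda>i. int (\<sigma> ! i)) (length \<sigma>)"
    using t(2) unfolding occurs_def order_iso_def
    by (intro exI[of _ "(!) ks"]) (auto simp: sorted_wrt_iff_nth_less)
next
  assume "occurs \<pi> (\<lambda>i. int (\<sigma> ! i)) (length \<sigma>)"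
  then obtain h where h: "\<forall>i<length \<pi>. h i < length \<sigma>" "\<forall>i j. i < j \<longrightarrow> j < length \<pi> \<longrightarrow> h i < h j"
     "\<forall>i<length \<pi>. \<forall>j<length \<pi>. \<pi> ! i < \<pi> ! j \<longleftrightarrow> \<sigma> ! h i < \<sigma> ! h j"
    by (auto simp: occurs_def)
  let ?ks = "map h [0..<length \<pi>]"
  have "subseq (map ((!) \<sigma>) ?ks) \<sigma>"
    by (rule subseq_map_nth) (use h in \<open>auto simp: sorted_wrt_iff_nth_less\<close>)
  moreover have "order_iso \<pi> (map ((!) \<sigma>) ?ks)"
    using h by (auto simp: order_iso_def)
  ultimately show "\<pi> \<preceq> \<sigma>" unfolding contains_pat_def by blast
qed

text \<open>One implication suffices: distinct entries of a permutation are strictly comparable, so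
  the reversed comparison in the pattern gives the reversed comparison in the host.\<close>

lemma occursI:
  assumes "is_perm \<pi>"
    and "\<And>i. i < length \<pi> \<Longrightarrow> h i < n"
    and "\<And>i j. i < j \<Longrightarrow> j < length \<pi> \<Longrightarrow> h i < (h j :: nat)"
    and mono: "\<And>i j. i < length \<pi> \<Longrightarrow> j < length \<pi> \<Longrightarrow> \<pi> ! i < \<pi> ! j \<Longrightarrow> p (h i) < p (h j)"
  shows "occurs \<pi> p n"
proof -
  have "\<pi> ! i < \<pi> ! j \<longleftrightarrow> p (h i) < p (h j)" if "i < length \<pi>" "j < length \<pi>" for i j
  proof (cases "i = j")
    case False
    then show ?thesis
      using mono[of i j] mono[of j i] that is_perm_nth_eq_iff[OF assms(1) that]
      by (metis linorder_neqE_nat not_less_iff_gr_or_eq)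
  qed simp
  then show ?thesis unfolding occurs_def using assms(2,3) by blast
qed

section \<open>The ten classes governing polynomial growth\<close>

lemma monotone_seg_iff:
  assumes "e \<in> {1, -1}"
  shows "monotone_seg e xs \<longleftrightarrow> (\<forall>i j. i < j \<and> j < length xs \<longrightarrow> e * int (xs ! i) < e * int (xs ! j))"
  using assms by (auto simp: monotone_seg_def sorted_wrt_iff_nth_less)

text \<open>Multiplication by the sign turns both kinds of monotone segment into a strict increase,
  and the segmentation becomes a cut \<open>k\<close>. An empty segment corresponds to
  \<open>k = 0\<close> or \<open>k = length \<sigma>\<close>.\<close>

lemma W_iff:
  assumes "e1 \<in> {1, -1}" "e2 \<in> {1, -1}"
  shows "\<sigma> \<in> W [e1, e2] \<longleftrightarrow> is_perm \<sigma> \<and> (\<exists>k\<le>length \<sigma>.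
     (\<forall>i j. i < j \<and> j < k \<longrightarrow> e1 * int (\<sigma> ! i) < e1 * int (\<sigma> ! j)) \<and>
     (\<forall>i j. k \<le> i \<and> i < j \<and> j < length \<sigma> \<longrightarrow> e2 * int (\<sigma> ! i) < e2 * int (\<sigma> ! j)))"
    (is "_ \<longleftrightarrow> _ \<and> (\<exists>k\<le>_. ?P k)")
proof -
  have "(\<exists>segs. concat segs = \<sigma> \<and> list_all2 monotone_seg [e1, e2] segs) \<longleftrightarrow>
    (\<exists>xs ys. xs @ ys = \<sigma> \<and> monotone_seg e1 xs \<and> monotone_seg e2 ys)"
    (is "?A \<longleftrightarrow> ?B")
  proof
    assume ?B
    then obtain xs ys where "xs @ ys = \<sigma>" "monotone_seg e1 xs" "monotone_seg e2 ys" by blast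
    then show ?A by (intro exI[of _ "[xs, ys]"]) simp
  qed (auto simp: list_all2_Cons1; blast)
  also have "\<dots> \<longleftrightarrow> (\<exists>k\<le>length \<sigma>. monotone_seg e1 (take k \<sigma>) \<and> monotone_seg e2 (drop k \<sigma>))"
    by (metis append_eq_conv_conj append_take_drop_id le_add1 length_append)
  also have "\<dots> \<longleftrightarrow> (\<exists>k\<le>length \<sigma>. ?P k)"
  proof (rule ex_cong1, rule conj_cong[OF refl])
    fix k assume k: "k \<le> length \<sigma>"
    have "monotone_seg e2 (drop k \<sigma>) \<longleftrightarrow>
      (\<forall>i j. k \<le> i \<and> i < j \<and> j < length \<sigma> \<longrightarrow> e2 * int (\<sigma> ! i) < e2 * int (\<sigma> ! j))"
      (is "_ \<longleftrightarrow> ?R")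
    proof
      assume m: "monotone_seg e2 (drop k \<sigma>)"
      show ?R
      proof (intro allI impI)
        fix i j assume ij: "k \<le> i \<and> i < j \<and> j < length \<sigma>"
        then have "i - k < j - k" "j - k < length (drop k \<sigma>)" by auto
        then have "e2 * int (drop k \<sigma> ! (i - k)) < e2 * int (drop k \<sigma> ! (j - k))"
          using m unfolding monotone_seg_iff[OF assms(2)] by blast
        then show "e2 * int (\<sigma> ! i) < e2 * int (\<sigma> ! j)" using ij k by simp
      qed
    qed (use k in \<open>auto simp: monotone_seg_iff[OF assms(2)]\<close>)
    moreover have "monotone_seg e1 (take k \<sigma>) \<longleftrightarrow>
      (\<forall>i j. i < j \<and> j < k \<longrightarrow> e1 * int (\<sigma> ! i) < e1 * int (\<sigma> ! j))"
      using k by (simp add: monotone_seg_iff[OF assms(1)])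
    ultimately show "monotone_seg e1 (take k \<sigma>) \<and> monotone_seg e2 (drop k \<sigma>) \<longleftrightarrow> ?P k" by blast
  qed
  finally show ?thesis by (simp add: W_def)
qed

lemma is_perm_W: "\<sigma> \<in> W es \<Longrightarrow> is_perm \<sigma>"
  by (simp add: W_def)

lemma class_inverse_iff:
  assumes "\<And>\<tau>. \<tau> \<in> C \<Longrightarrow> is_perm \<tau>"
  shows "\<sigma> \<in> class_inverse C \<longleftrightarrow> is_perm \<sigma> \<and> perm_inverse \<sigma> \<in> C"
  unfolding class_inverse_def using assms perm_inverse_involution is_perm_inverse
  by (metis image_iff)

lemmas class_inverse_W_iff = class_inverse_iff[OF is_perm_W]

text \<open>Transposing the diagram turns the cut in positions into a cut in values. A pair is an
  inversion of the inverse exactly when the corresponding pair is an inversion of the permutation,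
  so the signs stay the same.\<close>

lemma inverse_W_iff:
  assumes e: "e1 \<in> {1, -1}" "e2 \<in> {1, -1}"
  shows "\<sigma> \<in> class_inverse (W [e1, e2]) \<longleftrightarrow> is_perm \<sigma> \<and> (\<exists>k\<le>length \<sigma>.
     (\<forall>i j. i < j \<and> j < length \<sigma> \<and> \<sigma> ! i \<le> k \<and> \<sigma> ! j \<le> k \<longrightarrow> e1 * int (\<sigma> ! i) < e1 * int (\<sigma> ! j)) \<and>
     (\<forall>i j. i < j \<and> j < length \<sigma> \<and> k < \<sigma> ! i \<and> k < \<sigma> ! j \<longrightarrow> e2 * int (\<sigma> ! i) < e2 * int (\<sigma> ! j)))"
proof (cases "is_perm \<sigma>")
  case p: True
  let ?\<tau> = "perm_inverse \<sigma>"
  \<comment> \<open>The 0-based positions from \<open>a\<close> to \<open>b - 1\<close> of the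
    inverse are the values from \<open>a + 1\<close> to \<open>b\<close> of the permutation. It is
    applied with the bounds 0, \<open>k\<close> and with \<open>k\<close>,
    \<open>length \<sigma>\<close>.\<close>
  have swap: "(\<forall>u v. a \<le> u \<and> u < v \<and> v < b \<longrightarrow> e * int (?\<tau> ! u) < e * int (?\<tau> ! v)) \<longleftrightarrow>
    (\<forall>i j. i < j \<and> j < length \<sigma> \<and> a < \<sigma> ! i \<and> \<sigma> ! i \<le> b \<and> a < \<sigma> ! j \<and> \<sigma> ! j \<le> b
       \<longrightarrow> e * int (\<sigma> ! i) < e * int (\<sigma> ! j))" (is "?L \<longleftrightarrow> ?R")
    if e: "e \<in> {1, -1}" and b: "b \<le> length \<sigma>" for e :: int and a b
  proof
    assume L: ?L
    show ?R
    proof (intro allI impI)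
      fix i j assume ij: "i < j \<and> j < length \<sigma> \<and> a < \<sigma> ! i \<and> \<sigma> ! i \<le> b \<and> a < \<sigma> ! j \<and> \<sigma> ! j \<le> b"
      then have t: "?\<tau> ! (\<sigma> ! i - 1) = i + 1" "?\<tau> ! (\<sigma> ! j - 1) = j + 1"
        using perm_inverse_nth[OF p] by auto
      consider "\<sigma> ! i < \<sigma> ! j" | "\<sigma> ! j < \<sigma> ! i"
        using is_perm_nth_eq_iff[OF p, of i j] ij by fastforce
      then show "e * int (\<sigma> ! i) < e * int (\<sigma> ! j)"
      proof cases
        case 1
        then have "e * int (?\<tau> ! (\<sigma> ! i - 1)) < e * int (?\<tau> ! (\<sigma> ! j - 1))"
          using L ij by (intro L[rule_format]) linarith
        then show ?thesis unfolding t using 1 ij e by auto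
      next
        case 2
        then have "e * int (?\<tau> ! (\<sigma> ! j - 1)) < e * int (?\<tau> ! (\<sigma> ! i - 1))"
          using L ij by (intro L[rule_format]) linarith
        then show ?thesis unfolding t using 2 ij e by auto
      qed
    qed
  next
    assume R: ?R
    show ?L
    proof (intro allI impI)
      fix u v assume uv: "a \<le> u \<and> u < v \<and> v < b"
      define i where "i = ?\<tau> ! u - 1"
      define j where "j = ?\<tau> ! v - 1"
      have s: "\<sigma> ! i = u + 1" "\<sigma> ! j = v + 1" "?\<tau> ! u = i + 1" "?\<tau> ! v = j + 1"
        "i < length \<sigma>" "j < length \<sigma>"
        using nth_perm_inverse[OF p, of u] nth_perm_inverse[OF p, of v] uv b
        unfolding i_def j_def by auto
      have "i \<noteq> j" using s uv by auto
      then consider "i < j" | "j < i" by linarith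
      then show "e * int (?\<tau> ! u) < e * int (?\<tau> ! v)"
      proof cases
        case 1
        then have "e * int (\<sigma> ! i) < e * int (\<sigma> ! j)" using s uv 1 by (intro R[rule_format]) linarith
        then show ?thesis using 1 uv e unfolding s by auto
      next
        case 2
        then have "e * int (\<sigma> ! j) < e * int (\<sigma> ! i)" using s uv 2 by (intro R[rule_format]) linarith
        then show ?thesis using 2 uv e unfolding s by auto
      qed
    qed
  qed
  have bounds: "0 < \<sigma> ! i" "\<sigma> ! i \<le> length \<sigma>" if "i < length \<sigma>" for i
    using is_perm_nth_bounds[OF p that] by auto
  have "\<sigma> \<in> class_inverse (W [e1, e2]) \<longleftrightarrow> (\<exists>k\<le>length \<sigma>.
     (\<forall>u v. 0 \<le> u \<and> u < v \<and> v < k \<longrightarrow> e1 * int (?\<tau> ! u) < e1 * int (?\<tau> ! v)) \<and>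
     (\<forall>u v. k \<le> u \<and> u < v \<and> v < length \<sigma> \<longrightarrow> e2 * int (?\<tau> ! u) < e2 * int (?\<tau> ! v)))"
    using p is_perm_inverse[OF p] by (simp add: class_inverse_W_iff W_iff[OF e])
  also have "\<dots> \<longleftrightarrow> (\<exists>k\<le>length \<sigma>.
     (\<forall>i j. i < j \<and> j < length \<sigma> \<and> \<sigma> ! i \<le> k \<and> \<sigma> ! j \<le> k \<longrightarrow> e1 * int (\<sigma> ! i) < e1 * int (\<sigma> ! j)) \<and>
     (\<forall>i j. i < j \<and> j < length \<sigma> \<and> k < \<sigma> ! i \<and> k < \<sigma> ! j \<longrightarrow> e2 * int (\<sigma> ! i) < e2 * int (\<sigma> ! j)))"
  proof (rule ex_cong1, rule conj_cong[OF refl])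
    fix k assume k: "k \<le> length \<sigma>"
    show "((\<forall>u v. 0 \<le> u \<and> u < v \<and> v < k \<longrightarrow> e1 * int (?\<tau> ! u) < e1 * int (?\<tau> ! v)) \<and>
     (\<forall>u v. k \<le> u \<and> u < v \<and> v < length \<sigma> \<longrightarrow> e2 * int (?\<tau> ! u) < e2 * int (?\<tau> ! v))) \<longleftrightarrow>
     ((\<forall>i j. i < j \<and> j < length \<sigma> \<and> \<sigma> ! i \<le> k \<and> \<sigma> ! j \<le> k \<longrightarrow> e1 * int (\<sigma> ! i) < e1 * int (\<sigma> ! j)) \<and>
     (\<forall>i j. i < j \<and> j < length \<sigma> \<and> k < \<sigma> ! i \<and> k < \<sigma> ! j \<longrightarrow> e2 * int (\<sigma> ! i) < e2 * int (\<sigma> ! j)))"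
      unfolding swap[OF e(1) k] swap[OF e(2) order_refl] using bounds by (meson dual_order.strict_trans)
  qed
  finally show ?thesis using p by blast
qed (auto simp: class_inverse_W_iff)

section \<open>Layered permutations with layers of size at most two\<close>

lemma skew_sum_single: "[1] \<ominus> \<sigma> = (length \<sigma> + 1) # \<sigma>"
  by (simp add: skew_sum_def)

lemma skew_sum_double: "[1, 2] \<ominus> \<sigma> = [length \<sigma> + 1, length \<sigma> + 2] @ \<sigma>"
  by (simp add: skew_sum_def)

lemma L2R_Nil: "[] \<in> L2R"
  unfolding L2R_def by (rule CollectI, rule exI[of _ "[]"]) simp

lemma L2R_single: "\<sigma> \<in> L2R \<Longrightarrow> (length \<sigma> + 1) # \<sigma> \<in> L2R"
proof -
  assume "\<sigma> \<in> L2R"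
  then obtain ts where "\<sigma> = foldr (\<ominus>) ts []" "set ts \<subseteq> {[1], [1, 2]}" by (auto simp: L2R_def)
  then have "(length \<sigma> + 1) # \<sigma> = foldr (\<ominus>) ([1] # ts) [] \<and> set ([1] # ts) \<subseteq> {[1], [1, 2]}"
    using skew_sum_single[of \<sigma>] by simp
  then show ?thesis unfolding L2R_def by blast
qed

lemma L2R_double: "\<sigma> \<in> L2R \<Longrightarrow> [length \<sigma> + 1, length \<sigma> + 2] @ \<sigma> \<in> L2R"
proof -
  assume "\<sigma> \<in> L2R"
  then obtain ts where "\<sigma> = foldr (\<ominus>) ts []" "set ts \<subseteq> {[1], [1, 2]}" by (auto simp: L2R_def)
  then have "[length \<sigma> + 1, length \<sigma> + 2] @ \<sigma> = foldr (\<ominus>) ([1, 2] # ts) [] \<and>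
      set ([1, 2] # ts) \<subseteq> {[1], [1, 2]}"
    using skew_sum_double[of \<sigma>] by simp
  then show ?thesis unfolding L2R_def by blast
qed

text \<open>Since \<open>foldr\<close> peels layers from the left, each step puts one new layer in
  front of and above everything built so far.\<close>

lemma L2R_induct [consumes 1, case_names Nil single double]:
  assumes "\<sigma> \<in> L2R" and "P []"
    and single: "\<And>\<sigma>. \<sigma> \<in> L2R \<Longrightarrow> P \<sigma> \<Longrightarrow> P ((length \<sigma> + 1) # \<sigma>)"
    and double: "\<And>\<sigma>. \<sigma> \<in> L2R \<Longrightarrow> P \<sigma> \<Longrightarrow> P ([length \<sigma> + 1, length \<sigma> + 2] @ \<sigma>)"
  shows "P \<sigma>"
proof -
  have "P (foldr (\<ominus>) ts [])" if "set ts \<subseteq> {[1], [1, 2]}" for ts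
    using that
  proof (induction ts)
    case (Cons t ts)
    let ?s = "foldr (\<ominus>) ts []"
    have "?s \<in> L2R" using Cons.prems by (auto simp: L2R_def)
    moreover have "t = [1] \<or> t = [1, 2]" "P ?s" using Cons by auto
    ultimately show ?case
      using single[of ?s] double[of ?s] by (auto simp: skew_sum_single skew_sum_double simp del: One_nat_def)
  qed (simp add: assms(2))
  then show ?thesis using assms(1) by (auto simp: L2R_def)
qed

lemma is_perm_Cons_max:
  "is_perm ((length \<sigma> + 1) # \<sigma>) \<longleftrightarrow> is_perm \<sigma>"
proof
  assume "is_perm ((length \<sigma> + 1) # \<sigma>)"
  then have "insert (length \<sigma> + 1) (set \<sigma>) = insert (length \<sigma> + 1) {1..length \<sigma>}"
    and d: "length \<sigma> + 1 \<notin> set \<sigma>" "distinct \<sigma>"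
    by (auto simp: is_perm_iff atLeastAtMostSuc_conv)
  then have "set \<sigma> = {1..length \<sigma>}" by (subst (asm) insert_ident) auto
  then show "is_perm \<sigma>" using d by (simp add: is_perm_iff)
next
  assume "is_perm \<sigma>"
  then show "is_perm ((length \<sigma> + 1) # \<sigma>)" by (auto simp: is_perm_iff)
qed

lemma is_perm_append_top:
  "is_perm ([length \<sigma> + 1, length \<sigma> + 2] @ \<sigma>) \<longleftrightarrow> is_perm \<sigma>"
proof
  assume "is_perm ([length \<sigma> + 1, length \<sigma> + 2] @ \<sigma>)"
  then have "insert (length \<sigma> + 1) (insert (length \<sigma> + 2) (set \<sigma>)) = {1..length \<sigma> + 2}"
    and d: "length \<sigma> + 1 \<notin> set \<sigma>" "length \<sigma> + 2 \<notin> set \<sigma>" "distinct \<sigma>"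
    by (auto simp: is_perm_iff)
  moreover have "{1..length \<sigma> + 2} = insert (length \<sigma> + 1) (insert (length \<sigma> + 2) {1..length \<sigma>})"
    by auto
  ultimately have "set \<sigma> = {1..length \<sigma>}"
    by (metis (no_types, lifting) Suc_n_not_le_n add_2_eq_Suc' add_leD1 atLeastAtMost_iff insert_ident
        Suc_eq_plus1 insert_iff n_not_Suc_n)
  then show "is_perm \<sigma>" using d by (simp add: is_perm_iff)
next
  assume "is_perm \<sigma>"
  then show "is_perm ([length \<sigma> + 1, length \<sigma> + 2] @ \<sigma>)" by (auto simp: is_perm_iff)
qed

lemma is_perm_L2R: "\<sigma> \<in> L2R \<Longrightarrow> is_perm \<sigma>"
proof (induction rule: L2R_induct)
  case Nil then show ?case by (simp add: is_perm_iff)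
qed (simp_all only: is_perm_Cons_max is_perm_append_top)

text \<open>For permutations this characterises \<open>L2R\<close>. A non-inversion at distance two
  or more forms, with an entry between its positions, one of 123, 132 and 213, so the condition says
  that these three patterns are avoided.\<close>

definition noninv_adjacent :: "nat list \<Rightarrow> bool" where
  "noninv_adjacent \<sigma> \<longleftrightarrow> (\<forall>i j. i < j \<and> j < length \<sigma> \<and> \<sigma> ! i < \<sigma> ! j \<longrightarrow> j = i + 1)"

lemma noninv_adjacent_Cons_max:
  assumes "\<forall>x\<in>set \<sigma>. x < a" "noninv_adjacent \<sigma>" shows "noninv_adjacent (a # \<sigma>)"
  unfolding noninv_adjacent_def
proof (intro allI impI, elim conjE)
  fix i j assume ij: "i < j" "j < length (a # \<sigma>)" "(a # \<sigma>) ! i < (a # \<sigma>) ! j"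
  then obtain j' where j: "j = Suc j'" "j' < length \<sigma>" by (cases j) auto
  show "j = i + 1"
  proof (cases i)
    case 0
    then show ?thesis using ij j assms(1) nth_mem[of j' \<sigma>] by fastforce
  next
    case (Suc i') then show ?thesis using ij j assms(2) by (simp add: noninv_adjacent_def)
  qed
qed

lemma L2R_noninv_adjacent: "\<sigma> \<in> L2R \<Longrightarrow> noninv_adjacent \<sigma>"
proof (induction rule: L2R_induct)
  case Nil then show ?case by (simp add: noninv_adjacent_def)
next
  case (single \<sigma>)
  then show ?case using is_perm_L2R[of \<sigma>]
    by (intro noninv_adjacent_Cons_max) (auto simp: is_perm_iff)
next
  case (double \<sigma>)
  let ?n = "length \<sigma>"
  have s: "\<sigma> ! k \<le> ?n" if "k < ?n" for k using is_perm_nth_bounds[OF is_perm_L2R[OF double(1)] that] by simp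
  show ?case
    unfolding noninv_adjacent_def
  proof (intro allI impI, elim conjE)
    fix i j assume ij: "i < j" "j < length ([?n + 1, ?n + 2] @ \<sigma>)"
      "([?n + 1, ?n + 2] @ \<sigma>) ! i < ([?n + 1, ?n + 2] @ \<sigma>) ! j"
    show "j = i + 1"
    proof (cases "j = 1")
      case False
      define l where "l = j - 2"
      have j: "j = Suc (Suc l)" "l < ?n" using ij False by (auto simp: l_def)
      then have i: "i \<ge> 2" using ij s[of l] by (cases i; cases "i - 1") auto
      define k where "k = i - 2"
      have "i = Suc (Suc k)" using i by (simp add: k_def)
      then show ?thesis using ij j double(2) by (simp add: noninv_adjacent_def)
    qed (use ij in auto)
  qed
qed

lemma noninv_adjacent_tl: "noninv_adjacent (a # \<sigma>) \<Longrightarrow> noninv_adjacent \<sigma>"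
  unfolding noninv_adjacent_def
  by (metis Suc_eq_plus1 Suc_less_eq add_left_cancel length_Cons nat.inject nth_Cons_Suc)

text \<open>The first layer is found from the maximum: the first entry, unless it is the maximum
  itself, forms a non-inversion with it, so the maximum stands at position 0 or 1.\<close>

lemma noninv_adjacent_imp_L2R:
  "is_perm \<sigma> \<Longrightarrow> noninv_adjacent \<sigma> \<Longrightarrow> \<sigma> \<in> L2R"
proof (induction "length \<sigma>" arbitrary: \<sigma> rule: less_induct)
  case less
  note p = less.prems(1)
  have adj: "j = i + 1" if "i < j" "j < length \<sigma>" "\<sigma> ! i < \<sigma> ! j" for i j
    using less.prems(2) that by (auto simp: noninv_adjacent_def)
  show ?case
  proof (cases \<sigma>)
    case Nil then show ?thesis by (simp add: L2R_Nil)
  next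
    case (Cons a \<rho>)
    let ?n = "length \<sigma>"
    obtain q where q: "q < ?n" "\<sigma> ! q = ?n" using is_perm_obtain_index[OF p, of ?n] Cons by auto
    show ?thesis
    proof (cases "q = 0")
      case True
      then have a: "\<sigma> = (length \<rho> + 1) # \<rho>" using q Cons by simp
      have "is_perm \<rho>" using p unfolding a is_perm_Cons_max .
      moreover have "noninv_adjacent \<rho>" using less.prems(2) noninv_adjacent_tl Cons by blast
      ultimately have "\<rho> \<in> L2R" using less.hyps Cons by simp
      then show ?thesis unfolding a by (rule L2R_single)
    next
      case False
      then have "\<sigma> ! 0 < \<sigma> ! q"
        using q is_perm_nth_bounds(2)[OF p, of 0] is_perm_nth_eq_iff[OF p, of 0 q] by fastforce
      then have q1: "q = 1" using adj[of 0 q] False q by simp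
      then obtain \<tau> where t: "\<sigma> = [a, ?n] @ \<tau>" using q Cons by (cases \<rho>) auto
      have a_bound: "1 \<le> a" "a \<le> ?n" "a \<noteq> ?n"
        using is_perm_nth_bounds[OF p, of 0] is_perm_nth_eq_iff[OF p, of 0 1] Cons q q1 by auto
      \<comment> \<open>If the first entry were smaller, the value \<open>?n - 1\<close> would also
        form a non-inversion with it and would have to stand at position 1, which the maximum
        already occupies.\<close>
      have "a = ?n - 1"
      proof (rule ccontr)
        assume "a \<noteq> ?n - 1"
        then have "a < ?n - 1" using a_bound by linarith
        then obtain r where r: "r < ?n" "\<sigma> ! r = ?n - 1"
          using is_perm_obtain_index[OF p, of "?n - 1"] a_bound by auto
        then have "\<sigma> ! 0 < \<sigma> ! r" using \<open>a < ?n - 1\<close> Cons by simp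
        moreover have "0 < r" using calculation by (cases r) auto
        ultimately have "r = 1" using adj[of 0 r] r by simp
        then show False using r q q1 a_bound by simp
      qed
      then have t': "\<sigma> = [length \<tau> + 1, length \<tau> + 2] @ \<tau>"
        using t by (metis One_nat_def Suc_eq_plus1 add_2_eq_Suc' diff_Suc_1 length_Cons append_Cons append_Nil)
      have "is_perm \<tau>" using p unfolding t' is_perm_append_top .
      moreover have "noninv_adjacent \<tau>" using less.prems(2) noninv_adjacent_tl t by (metis append_Cons append_Nil)
      moreover have "length \<tau> < ?n" by (subst t') simp
      ultimately have "\<tau> \<in> L2R" using less.hyps by blast
      then show ?thesis using L2R_double t' by metis
    qed
  qed
qed

lemma L2R_iff: "\<sigma> \<in> L2R \<longleftrightarrow> is_perm \<sigma> \<and> noninv_adjacent \<sigma>"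
  using is_perm_L2R L2R_noninv_adjacent noninv_adjacent_imp_L2R by blast

section \<open>The ten classes are permuted by the symmetries\<close>

lemma W_complementI:
  assumes "e1 \<in> {1, -1}" "e2 \<in> {1, -1}" "\<sigma> \<in> W [e1, e2]"
  shows "perm_complement \<sigma> \<in> W [-e1, -e2]"
proof -
  have p: "is_perm \<sigma>" using assms(3) by (rule is_perm_W)
  have m: "- e * int (perm_complement \<sigma> ! i) < - e * int (perm_complement \<sigma> ! j) \<longleftrightarrow>
      e * int (\<sigma> ! i) < e * int (\<sigma> ! j)" if "e \<in> {1, -1}" "i < length \<sigma>" "j < length \<sigma>" for e :: int and i j
    using that is_perm_nth_bounds[OF p, of i] is_perm_nth_bounds[OF p, of j]
    by (auto simp: nth_perm_complement)
  obtain k where k: "k \<le> length \<sigma>"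
     "\<And>i j. i < j \<Longrightarrow> j < k \<Longrightarrow> e1 * int (\<sigma> ! i) < e1 * int (\<sigma> ! j)"
     "\<And>i j. k \<le> i \<Longrightarrow> i < j \<Longrightarrow> j < length \<sigma> \<Longrightarrow> e2 * int (\<sigma> ! i) < e2 * int (\<sigma> ! j)"
    using assms(3) unfolding W_iff[OF assms(1,2)] by blast
  have e: "- e1 \<in> {1, -1}" "- e2 \<in> {1, -1}" using assms(1,2) by auto
  show ?thesis
    unfolding W_iff[OF e]
  proof (intro conjI exI[of _ k] allI impI, goal_cases)
    case (3 i j) then show ?case using m[OF assms(1), of i j] k by simp
  next
    case (4 i j) then show ?case using m[OF assms(2), of i j] k by simp
  qed (use p k is_perm_complement in auto)
qed

text \<open>Reading backwards exchanges the two segments and flips both directions, hence the swap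
  and the change of signs; the cut moves to \<open>?n - k\<close>.\<close>

lemma W_revI:
  assumes "e1 \<in> {1, -1}" "e2 \<in> {1, -1}" "\<sigma> \<in> W [e1, e2]"
  shows "rev \<sigma> \<in> W [-e2, -e1]"
proof -
  let ?n = "length \<sigma>"
  obtain k where k: "k \<le> ?n"
     "\<And>i j. i < j \<Longrightarrow> j < k \<Longrightarrow> e1 * int (\<sigma> ! i) < e1 * int (\<sigma> ! j)"
     "\<And>i j. k \<le> i \<Longrightarrow> i < j \<Longrightarrow> j < ?n \<Longrightarrow> e2 * int (\<sigma> ! i) < e2 * int (\<sigma> ! j)"
    using assms(3) unfolding W_iff[OF assms(1,2)] by blast
  have e: "- e2 \<in> {1, -1}" "- e1 \<in> {1, -1}" using assms(1,2) by auto
  show ?thesis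
    unfolding W_iff[OF e]
  proof (intro conjI exI[of _ "?n - k"] allI impI, goal_cases)
    case 1 then show ?case using assms(3) is_perm_W by simp
  next
    case (3 i j)
    then have "k \<le> ?n - Suc j" "?n - Suc j < ?n - Suc i" "?n - Suc i < ?n" "i < ?n" "j < ?n" by linarith+
    then show ?case using k(3)[of "?n - Suc j" "?n - Suc i"] by (simp add: rev_nth)
  next
    case (4 i j)
    then have "?n - Suc i < k" "?n - Suc j < ?n - Suc i" "i < ?n" "j < ?n" using k(1) by auto
    then show ?case using k(2)[of "?n - Suc j" "?n - Suc i"] by (simp add: rev_nth)
  qed auto
qed

lemma rev_in_W_iff:
  assumes "e1 \<in> {1, -1}" "e2 \<in> {1, -1}"
  shows "rev \<sigma> \<in> W [e1, e2] \<longleftrightarrow> \<sigma> \<in> W [-e2, -e1]"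
  using W_revI[of e1 e2 "rev \<sigma>"] W_revI[of "-e2" "-e1" \<sigma>] assms by auto

lemma complement_in_W_iff:
  assumes "e1 \<in> {1, -1}" "e2 \<in> {1, -1}" "is_perm \<sigma>"
  shows "perm_complement \<sigma> \<in> W [e1, e2] \<longleftrightarrow> \<sigma> \<in> W [-e1, -e2]"
  using W_complementI[of e1 e2 "perm_complement \<sigma>"] W_complementI[of "-e1" "-e2" \<sigma>] assms
  by (auto simp: perm_complement_involution)

lemma rev_in_inverse_W_iff:
  assumes "e1 \<in> {1, -1}" "e2 \<in> {1, -1}"
  shows "rev \<sigma> \<in> class_inverse (W [e1, e2]) \<longleftrightarrow> \<sigma> \<in> class_inverse (W [-e1, -e2])"
  using complement_in_W_iff[OF assms, of "perm_inverse \<sigma>"] is_perm_inverse[of \<sigma>]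
  by (auto simp: class_inverse_W_iff perm_inverse_rev)

lemma complement_in_inverse_W_iff:
  assumes "e1 \<in> {1, -1}" "e2 \<in> {1, -1}" "is_perm \<sigma>"
  shows "perm_complement \<sigma> \<in> class_inverse (W [e1, e2]) \<longleftrightarrow> \<sigma> \<in> class_inverse (W [-e2, -e1])"
  using rev_in_W_iff[OF assms(1,2), of "perm_inverse \<sigma>"] is_perm_complement[OF assms(3)] assms(3)
  by (auto simp: class_inverse_W_iff perm_inverse_complement)

lemma is_perm_inverse_W: "\<sigma> \<in> class_inverse (W es) \<Longrightarrow> is_perm \<sigma>"
  by (simp add: class_inverse_W_iff)

lemma noninv_adjacentD:
  "noninv_adjacent \<sigma> \<Longrightarrow> i < j \<Longrightarrow> j < length \<sigma> \<Longrightarrow> \<sigma> ! i < \<sigma> ! j \<Longrightarrow> j = i + 1"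
  by (simp add: noninv_adjacent_def)

text \<open>A half turn of the diagram keeps non-inversions and the distance of their positions.
  Consequently complement and reversal send \<open>L2R\<close> to the same class, and two layered
  classes suffice for all eight symmetries.\<close>

lemma rev_complement_L2R:
  assumes "\<sigma> \<in> L2R" shows "rev (perm_complement \<sigma>) \<in> L2R"
  unfolding L2R_iff
proof
  have p: "is_perm \<sigma>" using assms by (rule is_perm_L2R)
  then show "is_perm (rev (perm_complement \<sigma>))" by (simp add: is_perm_complement)
  let ?n = "length \<sigma>"
  show "noninv_adjacent (rev (perm_complement \<sigma>))"
    unfolding noninv_adjacent_def
  proof (intro allI impI, elim conjE)
    fix i j assume ij: "i < j" "j < length (rev (perm_complement \<sigma>))"
      "rev (perm_complement \<sigma>) ! i < rev (perm_complement \<sigma>) ! j"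
    let ?i = "?n - Suc i" and ?j = "?n - Suc j"
    have "?i < ?n" "?j < ?n" using ij by auto
    then have "length \<sigma> + 1 - \<sigma> ! ?i < length \<sigma> + 1 - \<sigma> ! ?j"
      using ij by (simp add: rev_nth nth_perm_complement)
    then have "\<sigma> ! ?j < \<sigma> ! ?i" by linarith
    moreover have "?j < ?i" using ij by simp
    ultimately have "?i = ?j + 1"
      using noninv_adjacentD[OF L2R_noninv_adjacent[OF assms]] \<open>?i < ?n\<close> by blast
    then show "j = i + 1" using ij by simp
  qed
qed

lemma complement_rev: "perm_complement (rev \<sigma>) = rev (perm_complement \<sigma>)"
  by (simp add: perm_complement_def rev_map)

lemma inverse_L2R:
  assumes "\<sigma> \<in> L2R" shows "perm_inverse \<sigma> \<in> L2R"
  unfolding L2R_iff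
proof
  have p: "is_perm \<sigma>" using assms by (rule is_perm_L2R)
  then show "is_perm (perm_inverse \<sigma>)" by (simp add: is_perm_inverse)
  note adj = noninv_adjacentD[OF L2R_noninv_adjacent[OF assms]]
  show "noninv_adjacent (perm_inverse \<sigma>)"
    unfolding noninv_adjacent_def
  proof (intro allI impI, elim conjE)
    fix u v assume uv: "u < v" "v < length (perm_inverse \<sigma>)" "perm_inverse \<sigma> ! u < perm_inverse \<sigma> ! v"
    define i where "i = perm_inverse \<sigma> ! u - 1"
    define j where "j = perm_inverse \<sigma> ! v - 1"
    have s: "\<sigma> ! i = u + 1" "\<sigma> ! j = v + 1" "i < length \<sigma>" "j < length \<sigma>" "i < j"
      using nth_perm_inverse[OF p, of u] nth_perm_inverse[OF p, of v] uv unfolding i_def j_def by auto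
    have j: "j = i + 1" using adj[of i j] s uv by simp
    show "v = u + 1"
    proof (rule ccontr)
      assume "v \<noteq> u + 1"
      \<comment> \<open>An entry with a value strictly between those of the adjacent pair lies to
        its left or to its right and forms, with the farther member of the pair, a non-inversion at
        distance two or more.\<close>
      then obtain k where k: "k < length \<sigma>" "\<sigma> ! k = u + 2"
        using is_perm_obtain_index[OF p, of "u + 2"] uv by auto
      then have "k \<noteq> i" "k \<noteq> j" using s \<open>v \<noteq> u + 1\<close> by auto
      then consider "k < i" | "j < k" using j by linarith
      then show False
      proof cases
        case 1 then show ?thesis using adj[of k j] s k uv j \<open>v \<noteq> u + 1\<close> by simp
      next
        case 2 then show ?thesis using adj[of i k] s k j by simp
      qed
    qed
  qed
qed

definition growth_classes :: "nat list set set" where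
  "growth_classes = (\<Union>e1\<in>{1, -1}. \<Union>e2\<in>{1, -1}. {W [e1, e2], class_inverse (W [e1, e2])})
     \<union> {L2R, rev ` L2R}"

lemma growth_classes_cases [consumes 1, case_names W inverse L2R rev]:
  assumes "X \<in> growth_classes"
    and "\<And>e1 e2. e1 \<in> {1, -1} \<Longrightarrow> e2 \<in> {1, -1} \<Longrightarrow> X = W [e1, e2] \<Longrightarrow> thesis"
    and "\<And>e1 e2. e1 \<in> {1, -1} \<Longrightarrow> e2 \<in> {1, -1} \<Longrightarrow> X = class_inverse (W [e1, e2]) \<Longrightarrow> thesis"
    and "X = L2R \<Longrightarrow> thesis" and "X = rev ` L2R \<Longrightarrow> thesis"
  shows thesis
  using assms(1) unfolding growth_classes_def Un_iff UN_iff insert_iff empty_iff simp_thms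
  using assms(2-5) by metis

lemma W_growth_classes:
  assumes "e1 \<in> {1, -1}" "e2 \<in> {1, -1}"
  shows "W [e1, e2] \<in> growth_classes" "class_inverse (W [e1, e2]) \<in> growth_classes"
  using assms unfolding growth_classes_def by blast+

lemma L2R_growth_classes: "L2R \<in> growth_classes" "rev ` L2R \<in> growth_classes"
  by (simp_all add: growth_classes_def)

lemma is_perm_growth_classes: "X \<in> growth_classes \<Longrightarrow> \<sigma> \<in> X \<Longrightarrow> is_perm \<sigma>"
  by (erule growth_classes_cases) (auto simp: is_perm_W class_inverse_W_iff is_perm_L2R)

text \<open>For an involution the image of a class can be read off from a membership equivalence,
  which is the form in which the action on the classes W has been computed.\<close>

lemma image_eqI_involution:
  assumes "\<And>p. is_perm p \<Longrightarrow> g (g p) = p" "\<And>p. is_perm p \<Longrightarrow> is_perm (g p)"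
    and "\<And>p. p \<in> X \<Longrightarrow> is_perm p" "\<And>p. p \<in> Y \<Longrightarrow> is_perm p"
    and "\<And>p. is_perm p \<Longrightarrow> g p \<in> Y \<longleftrightarrow> p \<in> X"
  shows "g ` X = Y"
  using assms by (metis image_iff subsetI subset_antisym image_subsetI)

lemma rev_growth_classes: "X \<in> growth_classes \<Longrightarrow> rev ` X \<in> growth_classes"
proof (erule growth_classes_cases)
  fix e1 e2 :: int assume e: "e1 \<in> {1, -1}" "e2 \<in> {1, -1}" and X: "X = W [e1, e2]"
  have "rev ` X = W [- e2, - e1]"
    by (rule image_eqI_involution) (use e X in \<open>auto simp: is_perm_W rev_in_W_iff\<close>)
  then show "rev ` X \<in> growth_classes" using e by (auto intro: W_growth_classes)
next
  fix e1 e2 :: int assume e: "e1 \<in> {1, -1}" "e2 \<in> {1, -1}" and X: "X = class_inverse (W [e1, e2])"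
  have "rev ` X = class_inverse (W [- e1, - e2])"
    by (rule image_eqI_involution) (use e X in \<open>auto simp: is_perm_inverse_W rev_in_inverse_W_iff\<close>)
  then show "rev ` X \<in> growth_classes" using e by (auto intro: W_growth_classes)
qed (auto simp: image_image L2R_growth_classes)

lemma complement_growth_classes: "X \<in> growth_classes \<Longrightarrow> perm_complement ` X \<in> growth_classes"
proof (erule growth_classes_cases)
  fix e1 e2 :: int assume e: "e1 \<in> {1, -1}" "e2 \<in> {1, -1}" and X: "X = W [e1, e2]"
  have "perm_complement ` X = W [- e1, - e2]"
    by (rule image_eqI_involution)
      (use e X in \<open>auto simp: is_perm_W complement_in_W_iff perm_complement_involution is_perm_complement\<close>)
  then show "perm_complement ` X \<in> growth_classes" using e by (auto intro: W_growth_classes)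
next
  fix e1 e2 :: int assume e: "e1 \<in> {1, -1}" "e2 \<in> {1, -1}" and X: "X = class_inverse (W [e1, e2])"
  have "perm_complement ` X = class_inverse (W [- e2, - e1])"
    by (rule image_eqI_involution)
      (use e X in \<open>auto simp: is_perm_inverse_W complement_in_inverse_W_iff
        perm_complement_involution is_perm_complement\<close>)
  then show "perm_complement ` X \<in> growth_classes" using e by (auto intro: W_growth_classes)
next
  \<comment> \<open>The half turn preserves \<open>L2R\<close>, so complementing a layered
    permutation is the same as reversing another one.\<close>
  have L2: "perm_complement ` L2R = rev ` L2R"
  proof
    show "perm_complement ` L2R \<subseteq> rev ` L2R"
      using rev_complement_L2R by (metis image_iff image_subsetI rev_rev_ident)
    show "rev ` L2R \<subseteq> perm_complement ` L2R"
    proof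
      fix \<sigma> assume "\<sigma> \<in> rev ` L2R"
      then obtain \<rho> where r: "\<rho> \<in> L2R" "\<sigma> = rev \<rho>" by auto
      then have "\<sigma> = perm_complement (rev (perm_complement \<rho>))"
        by (simp add: complement_rev perm_complement_involution is_perm_L2R)
      then show "\<sigma> \<in> perm_complement ` L2R" using rev_complement_L2R[OF r(1)] by blast
    qed
  qed
  show "X = L2R \<Longrightarrow> perm_complement ` X \<in> growth_classes" by (simp add: L2 L2R_growth_classes)
  have "perm_complement ` rev ` L2R = rev ` perm_complement ` L2R"
    by (simp add: image_image complement_rev)
  then show "X = rev ` L2R \<Longrightarrow> perm_complement ` X \<in> growth_classes"
    by (simp add: L2 image_image L2R_growth_classes)
qed

lemma inverse_growth_classes: "X \<in> growth_classes \<Longrightarrow> perm_inverse ` X \<in> growth_classes"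
proof (erule growth_classes_cases)
  fix e1 e2 :: int assume e: "e1 \<in> {1, -1}" "e2 \<in> {1, -1}" and X: "X = class_inverse (W [e1, e2])"
  have "perm_inverse ` X = W [e1, e2]"
    by (rule image_eqI_involution)
      (use e X in \<open>auto simp: class_inverse_W_iff perm_inverse_involution is_perm_inverse is_perm_W\<close>)
  then show "perm_inverse ` X \<in> growth_classes" using e by (auto intro: W_growth_classes)
next
  fix e1 e2 :: int assume e: "e1 \<in> {1, -1}" "e2 \<in> {1, -1}" and X: "X = W [e1, e2]"
  show "perm_inverse ` X \<in> growth_classes"
    using W_growth_classes(2)[OF e] by (simp add: X class_inverse_def)
next
  have L: "perm_inverse ` L2R = L2R"
    using inverse_L2R perm_inverse_involution is_perm_L2R
    by (metis image_iff image_subsetI subsetI subset_antisym)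
  show "X = L2R \<Longrightarrow> perm_inverse ` X \<in> growth_classes" by (simp add: L L2R_growth_classes)
  \<comment> \<open>Inverting after reversing amounts to complementing after inverting, and
    \<open>L2R\<close> is closed under inverses.\<close>
  have "perm_inverse ` rev ` L2R = perm_complement ` perm_inverse ` L2R"
    by (auto simp: image_image perm_inverse_rev is_perm_L2R intro!: image_cong)
  then show "X = rev ` L2R \<Longrightarrow> perm_inverse ` X \<in> growth_classes"
    using complement_growth_classes[OF L2R_growth_classes(1)] by (simp add: L)
qed

section \<open>Patterns under the symmetries, and closure of the ten classes under patterns\<close>

lemma occurs_complement:
  assumes "is_perm \<pi>" "occurs \<pi> (\<lambda>i. - p i) n"
  shows "occurs (perm_complement \<pi>) p n"
proof -
  obtain h where h: "\<forall>i<length \<pi>. h i < n" "\<forall>i j. i < j \<longrightarrow> j < length \<pi> \<longrightarrow> h i < h j"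
     "\<forall>i<length \<pi>. \<forall>j<length \<pi>. \<pi> ! i < \<pi> ! j \<longleftrightarrow> - p (h i) < - p (h j)"
    using assms(2) unfolding occurs_def by blast
  show ?thesis
  proof (rule occursI[where h = h])
    fix i j assume ij: "i < length (perm_complement \<pi>)" "j < length (perm_complement \<pi>)"
      "perm_complement \<pi> ! i < perm_complement \<pi> ! j"
    then have "\<pi> ! j < \<pi> ! i"
      using is_perm_nth_bounds[OF assms(1), of i] is_perm_nth_bounds[OF assms(1), of j]
      by (simp add: nth_perm_complement)
    then show "p (h i) < p (h j)" using h ij by simp
  qed (use h assms is_perm_complement in auto)
qed

lemma contains_rev:
  assumes "\<pi> \<preceq> \<sigma>" shows "rev \<pi> \<preceq> rev \<sigma>"
proof -
  let ?m = "length \<pi>" and ?n = "length \<sigma>"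
  obtain h where h: "\<forall>i<?m. h i < ?n" "\<forall>i j. i < j \<longrightarrow> j < ?m \<longrightarrow> h i < h j"
     "\<forall>i<?m. \<forall>j<?m. \<pi> ! i < \<pi> ! j \<longleftrightarrow> \<sigma> ! h i < \<sigma> ! h j"
    using assms unfolding contains_pat_iff_occurs occurs_def by auto
  have k: "h (?m - Suc i) < ?n" if "i < ?m" for i using h(1) that by simp
  show ?thesis
    unfolding contains_pat_iff_occurs occurs_def
  proof (intro exI[of _ "\<lambda>i. ?n - Suc (h (?m - Suc i))"] conjI allI impI)
    fix i assume "i < length (rev \<pi>)" then show "?n - Suc (h (?m - Suc i)) < length (rev \<sigma>)"
      using k[of i] by simp
  next
    fix i j assume ij: "i < j" "j < length (rev \<pi>)"
    then have "h (?m - Suc j) < h (?m - Suc i)" using h(2) by simp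
    then show "?n - Suc (h (?m - Suc i)) < ?n - Suc (h (?m - Suc j))"
      using k[of i] ij by simp
  next
    fix i j assume ij: "i < length (rev \<pi>)" "j < length (rev \<pi>)"
    then show "rev \<pi> ! i < rev \<pi> ! j \<longleftrightarrow> int (rev \<sigma> ! (?n - Suc (h (?m - Suc i))))
       < int (rev \<sigma> ! (?n - Suc (h (?m - Suc j))))"
      using k[of i] k[of j] h(3) by (simp add: rev_nth)
  qed
qed

text \<open>The transposed embedding acts on values: the value \<open>v + 1\<close> sits at position
  \<open>?\<pi> ! v - 1\<close> of the pattern and is sent to the host value at the image of that
  position. Subtracting one turns this value into a 0-based position of the inverse.\<close>

lemma contains_inverse:
  assumes "is_perm \<pi>" "is_perm \<sigma>" "\<pi> \<preceq> \<sigma>"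
  shows "perm_inverse \<pi> \<preceq> perm_inverse \<sigma>"
proof -
  let ?m = "length \<pi>" and ?n = "length \<sigma>" and ?\<pi> = "perm_inverse \<pi>"
  obtain h where h: "\<forall>i<?m. h i < ?n" "\<forall>i j. i < j \<longrightarrow> j < ?m \<longrightarrow> h i < h j"
     "\<forall>i<?m. \<forall>j<?m. \<pi> ! i < \<pi> ! j \<longleftrightarrow> \<sigma> ! h i < \<sigma> ! h j"
    using assms(3) unfolding contains_pat_iff_occurs occurs_def by auto
  have i: "?\<pi> ! v - 1 < ?m" "\<pi> ! (?\<pi> ! v - 1) = v + 1" "1 \<le> ?\<pi> ! v" if "v < ?m" for v
    using nth_perm_inverse[OF assms(1) that] that by auto
  have hn: "h (?\<pi> ! v - 1) < ?n" if "v < ?m" for v using h(1) i(1)[OF that] by simp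
  show ?thesis
    unfolding contains_pat_iff_occurs
  proof (rule occursI[where h = "\<lambda>v. \<sigma> ! h (?\<pi> ! v - 1) - 1"])
    fix v assume "v < length ?\<pi>"
    then show "\<sigma> ! h (?\<pi> ! v - 1) - 1 < length (perm_inverse \<sigma>)"
      using is_perm_nth_bounds[OF assms(2) hn[of v]] by simp
  next
    fix u v assume uv: "u < v" "v < length ?\<pi>"
    then have "\<pi> ! (?\<pi> ! u - 1) < \<pi> ! (?\<pi> ! v - 1)" using i by simp
    then have "\<sigma> ! h (?\<pi> ! u - 1) < \<sigma> ! h (?\<pi> ! v - 1)" using h(3) i(1)[of u] i(1)[of v] uv by simp
    then show "\<sigma> ! h (?\<pi> ! u - 1) - 1 < \<sigma> ! h (?\<pi> ! v - 1) - 1"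
      using is_perm_nth_bounds[OF assms(2) hn[of u]] uv by simp
  next
    fix u v assume uv: "u < length ?\<pi>" "v < length ?\<pi>" "?\<pi> ! u < ?\<pi> ! v"
    then have "h (?\<pi> ! u - 1) < h (?\<pi> ! v - 1)" using h(2) i(1,3)[of u] i(1,3)[of v] by simp
    then show "int (perm_inverse \<sigma> ! (\<sigma> ! h (?\<pi> ! u - 1) - 1))
       < int (perm_inverse \<sigma> ! (\<sigma> ! h (?\<pi> ! v - 1) - 1))"
      using perm_inverse_nth[OF assms(2) hn[of u]] perm_inverse_nth[OF assms(2) hn[of v]] uv by simp
  qed (rule is_perm_inverse[OF assms(1)])
qed

text \<open>This is the source of cut points: a property that is closed downwards holds exactly on
  an initial segment of the positions below \<open>m\<close>.\<close>

lemma initial_segment_threshold: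
  fixes m :: nat
  assumes "\<And>i j. i < j \<Longrightarrow> j < m \<Longrightarrow> P j \<Longrightarrow> P i"
  obtains k where "k \<le> m" "\<And>i. i < m \<Longrightarrow> P i \<longleftrightarrow> i < k"
proof -
  have "\<exists>k\<le>m. \<forall>i<m. P i \<longleftrightarrow> i < k"
    using assms
  proof (induction m)
    case (Suc m)
    then obtain k where k: "k \<le> m" "\<forall>i<m. P i \<longleftrightarrow> i < k" by (metis less_SucI)
    show ?case
    proof (cases "P m")
      case True
      then have "\<forall>i<Suc m. P i" using Suc.prems by (metis less_Suc_eq)
      then show ?thesis by blast
    next
      case False then show ?thesis using k by (intro exI[of _ k]) (auto simp: less_Suc_eq)
    qed
  qed simp
  then show ?thesis using that by blast
qed

text \<open>The cut is pulled back along the embedding: \<open>l\<close> counts the positions of the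
  pattern that are sent before \<open>k\<close>.\<close>

lemma W_closed:
  assumes e: "e1 \<in> {1, -1}" "e2 \<in> {1, -1}" and "\<sigma> \<in> W [e1, e2]" "is_perm \<pi>" "\<pi> \<preceq> \<sigma>"
  shows "\<pi> \<in> W [e1, e2]"
proof -
  let ?m = "length \<pi>" and ?n = "length \<sigma>"
  obtain h where h: "\<forall>i<?m. h i < ?n" "\<forall>i j. i < j \<longrightarrow> j < ?m \<longrightarrow> h i < h j"
     "\<forall>i<?m. \<forall>j<?m. \<pi> ! i < \<pi> ! j \<longleftrightarrow> \<sigma> ! h i < \<sigma> ! h j"
    using assms(5) unfolding contains_pat_iff_occurs occurs_def by auto
  obtain k where k: "k \<le> ?n"
     "\<And>i j. i < j \<Longrightarrow> j < k \<Longrightarrow> e1 * int (\<sigma> ! i) < e1 * int (\<sigma> ! j)"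
     "\<And>i j. k \<le> i \<Longrightarrow> i < j \<Longrightarrow> j < ?n \<Longrightarrow> e2 * int (\<sigma> ! i) < e2 * int (\<sigma> ! j)"
    using assms(3) unfolding W_iff[OF e] by blast
  have "h i < k" if "i < j" "j < ?m" "h j < k" for i j
    using h(2) that by (meson dual_order.strict_trans)
  then obtain l where l: "l \<le> ?m" "\<And>i. i < ?m \<Longrightarrow> h i < k \<longleftrightarrow> i < l"
    by (rule initial_segment_threshold) auto
  have tr: "e * int (\<pi> ! i) < e * int (\<pi> ! j)"
    if "e \<in> {1, -1}" "e * int (\<sigma> ! h i) < e * int (\<sigma> ! h j)" "i < ?m" "j < ?m" for e :: int and i j
    using that h(3) by auto
  show ?thesis
    unfolding W_iff[OF e]
  proof (intro conjI exI[of _ l] allI impI, goal_cases)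
    case (3 i j)
    then show ?case using l h(2) k(2)[of "h i" "h j"] by (intro tr[OF e(1)]) auto
  next
    case (4 i j)
    then have "k \<le> h i" using l(2)[of i] by simp
    then show ?case using 4 h(1,2) k(3)[of "h i" "h j"] by (intro tr[OF e(2)]) auto
  qed (use assms l in auto)
qed

text \<open>An embedding is strictly increasing on positions, so positions with adjacent images are
  themselves adjacent.\<close>

lemma L2R_closed:
  assumes "\<sigma> \<in> L2R" "is_perm \<pi>" "\<pi> \<preceq> \<sigma>"
  shows "\<pi> \<in> L2R"
  unfolding L2R_iff
proof
  show "noninv_adjacent \<pi>"
    unfolding noninv_adjacent_def
  proof (intro allI impI, elim conjE)
    fix i j assume ij: "i < j" "j < length \<pi>" "\<pi> ! i < \<pi> ! j"
    obtain h where h: "\<forall>i<length \<pi>. h i < length \<sigma>" "\<forall>i j. i < j \<longrightarrow> j < length \<pi> \<longrightarrow> h i < h j"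
      "\<forall>i<length \<pi>. \<forall>j<length \<pi>. \<pi> ! i < \<pi> ! j \<longleftrightarrow> \<sigma> ! h i < \<sigma> ! h j"
      using assms(3) unfolding contains_pat_iff_occurs occurs_def by auto
    have "h j = h i + 1"
      using noninv_adjacentD[OF L2R_noninv_adjacent[OF assms(1)], of "h i" "h j"] h ij by simp
    moreover have "h i < h (i + 1)" "i + 1 < j \<longrightarrow> h (i + 1) < h j" using h(2) ij by auto
    ultimately show "j = i + 1" using ij by linarith
  qed
qed (rule assms(2))

lemma growth_classes_closed:
  assumes "X \<in> growth_classes" "\<sigma> \<in> X" "is_perm \<pi>" "\<pi> \<preceq> \<sigma>"
  shows "\<pi> \<in> X"
  using assms(1)
proof (cases rule: growth_classes_cases)
  case (W e1 e2) then show ?thesis using W_closed assms by blast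
next
  case (inverse e1 e2)
  then show ?thesis
    using W_closed[OF inverse(1,2), of "perm_inverse \<sigma>" "perm_inverse \<pi>"] assms
    by (auto simp: class_inverse_W_iff is_perm_inverse contains_inverse)
next
  case L2R then show ?thesis using L2R_closed assms by blast
next
  case rev
  then have "rev \<sigma> \<in> L2R" using assms(2) by auto
  then have "rev \<pi> \<in> L2R" using L2R_closed contains_rev[OF assms(4)] assms(3) by simp
  then show ?thesis using rev by (metis image_iff rev_rev_ident)
qed

text \<open>In the next two lemmas an entry of value (for the inverses: at position) \<open>s\<close> may be placed at either of
  two points of slot \<open>s\<close>, and the cut of the pattern decides which.\<close>

lemma occurs_W:
  assumes e: "e1 \<in> {1, -1}" "e2 \<in> {1, -1}" and \<pi>: "\<pi> \<in> W [e1, e2]" "length \<pi> \<le> N"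
    and LR: "\<And>s t. s < N \<Longrightarrow> t < N \<Longrightarrow> L s < R t" and n: "\<And>s. s < N \<Longrightarrow> R s < n"
    and val: "\<And>s t x y. s < t \<Longrightarrow> t < N \<Longrightarrow> x \<in> {L s, R s} \<Longrightarrow> y \<in> {L t, R t} \<Longrightarrow> p x < p y"
    and L: "\<And>s t. s < t \<Longrightarrow> t < N \<Longrightarrow> e1 * int (L s) < e1 * int (L t)"
    and R: "\<And>s t. s < t \<Longrightarrow> t < N \<Longrightarrow> e2 * int (R s) < e2 * int (R t)"
  shows "occurs \<pi> p n"
proof -
  have p: "is_perm \<pi>" using \<pi>(1) by (rule is_perm_W)
  obtain k where k: "k \<le> length \<pi>"
     "\<And>i j. i < j \<Longrightarrow> j < k \<Longrightarrow> e1 * int (\<pi> ! i) < e1 * int (\<pi> ! j)"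
     "\<And>i j. k \<le> i \<Longrightarrow> i < j \<Longrightarrow> j < length \<pi> \<Longrightarrow> e2 * int (\<pi> ! i) < e2 * int (\<pi> ! j)"
    using \<pi>(1) unfolding W_iff[OF e] by blast
  define h where "h i = (if i < k then L else R) (\<pi> ! i - 1)" for i
  have N: "\<pi> ! i - 1 < N" "0 < \<pi> ! i" if "i < length \<pi>" for i
    using is_perm_nth_bounds[OF p that] \<pi>(2) by auto
  show ?thesis
  proof (rule occursI[OF p, where h = h])
    fix i assume i: "i < length \<pi>"
    show "h i < n"
      using LR[OF N(1)[OF i] N(1)[OF i]] n[OF N(1)[OF i]] by (auto simp: h_def)
  next
    fix i j assume ij: "i < j" "j < length \<pi>"
    then have Nij: "\<pi> ! i - 1 < N" "0 < \<pi> ! i" "\<pi> ! j - 1 < N" "0 < \<pi> ! j" using N by auto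
    consider "j < k" | "i < k" "k \<le> j" | "k \<le> i" using ij by linarith
    then show "h i < h j"
    proof cases
      case 1
      then have "e1 * int (\<pi> ! i) < e1 * int (\<pi> ! j)" using k ij by blast
      then show ?thesis
        using L[of "\<pi> ! i - 1" "\<pi> ! j - 1"] L[of "\<pi> ! j - 1" "\<pi> ! i - 1"] Nij e(1) 1 ij
        by (auto simp: h_def)
    next
      case 2 then show ?thesis using LR Nij by (simp add: h_def)
    next
      case 3
      then have "e2 * int (\<pi> ! i) < e2 * int (\<pi> ! j)" using k ij by blast
      then show ?thesis
        using R[of "\<pi> ! i - 1" "\<pi> ! j - 1"] R[of "\<pi> ! j - 1" "\<pi> ! i - 1"] Nij e(2) 3 ij
        by (auto simp: h_def)
    qed
  next
    fix i j assume ij: "i < length \<pi>" "j < length \<pi>" "\<pi> ! i < \<pi> ! j"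
    then show "p (h i) < p (h j)"
      using N[of i] N[of j] by (intro val[of "\<pi> ! i - 1" "\<pi> ! j - 1"]) (auto simp: h_def)
  qed
qed

lemma occurs_inverse_W:
  assumes e: "e1 \<in> {1, -1}" "e2 \<in> {1, -1}" and \<pi>: "\<pi> \<in> class_inverse (W [e1, e2])" "length \<pi> \<le> N"
    and AB: "\<And>s t. s < N \<Longrightarrow> t < N \<Longrightarrow> p (A s) < p (B t)" and n: "\<And>s. s < N \<Longrightarrow> A s < n \<and> B s < n"
    and pos: "\<And>s t x y. s < t \<Longrightarrow> t < N \<Longrightarrow> x \<in> {A s, B s} \<Longrightarrow> y \<in> {A t, B t} \<Longrightarrow> x < y"
    and A: "\<And>s t. s < t \<Longrightarrow> t < N \<Longrightarrow> e1 * p (A s) < e1 * p (A t)"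
    and B: "\<And>s t. s < t \<Longrightarrow> t < N \<Longrightarrow> e2 * p (B s) < e2 * p (B t)"
  shows "occurs \<pi> p n"
proof -
  have p: "is_perm \<pi>" using \<pi>(1) by (simp add: class_inverse_W_iff)
  obtain k where k:
     "\<forall>i j. i < j \<and> j < length \<pi> \<and> \<pi> ! i \<le> k \<and> \<pi> ! j \<le> k \<longrightarrow> e1 * int (\<pi> ! i) < e1 * int (\<pi> ! j)"
     "\<forall>i j. i < j \<and> j < length \<pi> \<and> k < \<pi> ! i \<and> k < \<pi> ! j \<longrightarrow> e2 * int (\<pi> ! i) < e2 * int (\<pi> ! j)"
    using \<pi>(1) unfolding inverse_W_iff[OF e] by (elim conjE exE) (rule that)
  define h where "h i = (if \<pi> ! i \<le> k then A else B) i" for i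
  show ?thesis
  proof (rule occursI[OF p, where h = h])
    fix i assume "i < length \<pi>" then show "h i < n" using n[of i] \<pi>(2) by (simp add: h_def)
  next
    fix i j assume ij: "i < j" "j < length \<pi>"
    show "h i < h j" by (rule pos[of i j]) (use ij \<pi>(2) in \<open>auto simp: h_def\<close>)
  next
    fix i j assume ij: "i < length \<pi>" "j < length \<pi>" "\<pi> ! i < \<pi> ! j"
    then have N: "i < N" "j < N" "i \<noteq> j" using \<pi>(2) by auto
    \<comment> \<open>Within one of the two sequences the order of positions and the order of values
      agree if the sign is 1 and are opposite if it is -1; pattern and host share the sign.\<close>
    have signed: "p (F i) < p (F j)"
      if "e \<in> {1, -1}" and F: "\<And>s t. s < t \<Longrightarrow> t < N \<Longrightarrow> e * p (F s) < e * p (F t)"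
        and m: "i < j \<Longrightarrow> e * int (\<pi> ! i) < e * int (\<pi> ! j)" "j < i \<Longrightarrow> e * int (\<pi> ! j) < e * int (\<pi> ! i)"
      for F and e :: int
    proof (cases "i < j")
      case True
      then have "e = 1" using m(1) that(1) ij by auto
      then show ?thesis using F[OF True] N by simp
    next
      case False
      then have "j < i" using N by simp
      moreover from this have "e = -1" using m(2) that(1) ij by auto
      ultimately show ?thesis using F[of j i] N by simp
    qed
    consider "\<pi> ! j \<le> k" | "\<pi> ! i \<le> k" "k < \<pi> ! j" | "k < \<pi> ! i" using ij by linarith
    then show "p (h i) < p (h j)"
    proof cases
      case 1
      have "p (A i) < p (A j)"
        by (rule signed[OF e(1) A]) (use ij 1 k(1) in auto)
      then show ?thesis using 1 ij by (simp add: h_def)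
    next
      case 2 then show ?thesis using AB N by (simp add: h_def)
    next
      case 3
      have "p (B i) < p (B j)"
        by (rule signed[OF e(2) B]) (use ij 3 k(2) in auto)
      then show ?thesis using 3 ij by (simp add: h_def)
    qed
  qed
qed

text \<open>The pairs \<open>P s\<close>, \<open>Q s\<close> are ascents, each below and to the
  right of the preceding ones. A singleton layer takes the lower point of its slot; a doubleton
  takes both points of the slot of its first entry and leaves the slot of its second entry
  empty.\<close>

lemma occurs_L2R:
  assumes \<pi>: "\<pi> \<in> L2R" "length \<pi> \<le> N"
    and PQ: "\<And>s. s < N \<Longrightarrow> P s < Q s \<and> p (P s) < p (Q s) \<and> Q s < n"
    and pos: "\<And>s t x y. s < t \<Longrightarrow> t < N \<Longrightarrow> x \<in> {P s, Q s} \<Longrightarrow> y \<in> {P t, Q t} \<Longrightarrow> x < y \<and> p y < p x"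
  shows "occurs \<pi> p n"
proof -
  have p: "is_perm \<pi>" using \<pi>(1) by (rule is_perm_L2R)
  note adj = noninv_adjacentD[OF L2R_noninv_adjacent[OF \<pi>(1)]]
  \<comment> \<open>\<open>top i\<close> marks the second entry of a doubleton.\<close>
  define top where "top i \<longleftrightarrow> i > 0 \<and> \<pi> ! (i - 1) < \<pi> ! i" for i
  define slot where "slot i = (if top i then i - 1 else i)" for i
  define h where "h i = (if top i then Q (slot i) else P (slot i))" for i
  have h: "h i \<in> {P (slot i), Q (slot i)}" for i by (simp add: h_def)
  have slot: "slot i \<le> i" "i \<le> slot i + 1" for i by (auto simp: slot_def)
  show ?thesis
  proof (rule occursI[OF p, where h = h])
    fix i assume "i < length \<pi>"
    then have "slot i < N" using slot[of i] \<pi>(2) by simp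
    then show "h i < n" using PQ[of "slot i"] by (auto simp: h_def)
  next
    fix i j assume ij: "i < j" "j < length \<pi>"
    show "h i < h j"
    proof (cases "slot i < slot j")
      case True
      then show ?thesis using pos[OF True _ h h] slot(1)[of j] ij \<pi>(2) by simp
    next
      case False
      then have j: "j = i + 1" "slot i = i" "slot j = i" using slot[of i] slot[of j] ij by auto
      then have "top j" "\<not> top i" using ij by (auto simp: slot_def top_def split: if_splits)
      then show ?thesis using PQ[of i] j ij \<pi>(2) by (simp add: h_def)
    qed
  next
    fix i j assume ij: "i < length \<pi>" "j < length \<pi>" "\<pi> ! i < \<pi> ! j"
    then consider "i < j" | "j < i" by (metis linorder_neqE_nat less_irrefl)
    then show "p (h i) < p (h j)"
    proof cases
      case 1
      then have j: "j = i + 1" using adj ij by blast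
      have "\<not> top i"
      proof
        assume "top i"
        then have "i - 1 < j" "\<pi> ! (i - 1) < \<pi> ! j" "0 < i" using ij j by (auto simp: top_def)
        then show False using adj[of "i - 1" j] ij j by simp
      qed
      moreover have "top j" using ij j by (simp add: top_def)
      ultimately show ?thesis using j ij PQ[of i] \<pi>(2) by (simp add: h_def slot_def)
    next
      case 2
      have "slot j < slot i"
      proof (rule ccontr)
        assume "\<not> slot j < slot i"
        then have "i = j + 1" "slot i \<noteq> i" using slot[of i] slot[of j] 2 by auto
        then show False using ij by (auto simp: slot_def top_def split: if_splits)
      qed
      then show ?thesis using pos[OF _ _ h h] slot(1)[of i] ij \<pi>(2) by simp
    qed
  qed
qed

text \<open>Negating the values turns the picture upside down; the complement of a reversed layered
  permutation is layered by the half turn.\<close>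

lemma occurs_rev_L2R:
  assumes \<pi>: "\<pi> \<in> rev ` L2R" "length \<pi> \<le> N"
    and PQ: "\<And>s. s < N \<Longrightarrow> P s < Q s \<and> p (Q s) < p (P s) \<and> Q s < n"
    and pos: "\<And>s t x y. s < t \<Longrightarrow> t < N \<Longrightarrow> x \<in> {P s, Q s} \<Longrightarrow> y \<in> {P t, Q t} \<Longrightarrow> x < y \<and> p x < p y"
  shows "occurs \<pi> p n"
proof -
  have r: "rev \<pi> \<in> L2R" "is_perm \<pi>" using \<pi>(1) is_perm_L2R by auto
  have "perm_complement \<pi> \<in> L2R"
    using rev_complement_L2R[OF r(1)] by (simp add: complement_rev)
  then have "occurs (perm_complement \<pi>) (\<lambda>i. - p i) n"
  proof (rule occurs_L2R)
    fix s t x y assume "s < t" "t < N" "x \<in> {P s, Q s}" "y \<in> {P t, Q t}"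
    then show "x < y \<and> - p y < - p x" using pos[of s t x y] by simp
  qed (use \<pi>(2) PQ in simp_all)
  then show ?thesis
    using occurs_complement[OF is_perm_complement[OF r(2)]] perm_complement_involution[OF r(2)] by simp
qed

section \<open>Permutations with many breaks\<close>

text \<open>Ramsey's theorem for graphs is iterated: it gives a set homogeneous for one relation and
  still large enough for the other \<open>k\<close>. Homogeneity survives the further thinning
  because it passes to subsets.\<close>

lemma ramsey_relations:
  "\<exists>K. \<forall>Rs (V :: nat set). length Rs = k \<longrightarrow> finite V \<longrightarrow> K \<le> card V \<longrightarrow>
     (\<exists>H\<subseteq>V. card H = N \<and> (\<forall>R\<in>set Rs. (\<forall>i\<in>H. \<forall>j\<in>H. i < j \<longrightarrow> R i j) \<or> (\<forall>i\<in>H. \<forall>j\<in>H. i < j \<longrightarrow> \<not> R i j)))"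
proof (induction k)
  case 0
  show ?case
  proof (intro exI[of _ N] allI impI)
    fix Rs :: "(nat \<Rightarrow> nat \<Rightarrow> bool) list" and V :: "nat set"
    assume "length Rs = 0" "N \<le> card V"
    moreover from this obtain H where "H \<subseteq> V" "card H = N" using obtain_subset_with_card_n by metis
    ultimately show "\<exists>H\<subseteq>V. card H = N \<and> (\<forall>R\<in>set Rs. (\<forall>i\<in>H. \<forall>j\<in>H. i < j \<longrightarrow> R i j) \<or> (\<forall>i\<in>H. \<forall>j\<in>H. i < j \<longrightarrow> \<not> R i j))"
      by auto
  qed
next
  case (Suc k)
  then obtain K where K: "\<And>Rs V :: nat set. length Rs = k \<Longrightarrow> finite V \<Longrightarrow> K \<le> card V \<Longrightarrow>
     \<exists>H\<subseteq>V. card H = N \<and> (\<forall>R\<in>set Rs. (\<forall>i\<in>H. \<forall>j\<in>H. i < j \<longrightarrow> R i j) \<or> (\<forall>i\<in>H. \<forall>j\<in>H. i < j \<longrightarrow> \<not> R i j))"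
    by blast
  obtain r where r: "\<And>(V :: nat set) E. finite V \<Longrightarrow> r \<le> card V \<Longrightarrow>
      \<exists>U\<subseteq>V. card U = K \<and> clique U E \<or> card U = K \<and> indep U E"
    using ramsey2[of K K] by metis
  show ?case
  proof (intro exI[of _ r] allI impI)
    fix Rs :: "(nat \<Rightarrow> nat \<Rightarrow> bool) list" and V :: "nat set"
    assume "length Rs = Suc k" and V: "finite V" "r \<le> card V"
    then obtain R Rs' where Rs: "Rs = R # Rs'" "length Rs' = k" by (cases Rs) auto
    \<comment> \<open>An unordered edge records the relation in the increasing orientation of its
      two vertices, so asymmetric relations are covered.\<close>
    define E where "E = {{i, j} | i j. i < j \<and> R i j}"
    obtain U where U: "U \<subseteq> V" "card U = K" "clique U E \<or> indep U E" using r[OF V] by blast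
    have hU: "(\<forall>i\<in>U. \<forall>j\<in>U. i < j \<longrightarrow> R i j) \<or> (\<forall>i\<in>U. \<forall>j\<in>U. i < j \<longrightarrow> \<not> R i j)"
    proof -
      have "{i, j} \<in> E \<longleftrightarrow> R i j" if "i < j" for i j
        using that by (auto simp: E_def doubleton_eq_iff)
      then show ?thesis using U(3) unfolding clique_def indep_def by (metis less_irrefl)
    qed
    obtain H where H: "H \<subseteq> U" "card H = N"
      "\<forall>R\<in>set Rs'. (\<forall>i\<in>H. \<forall>j\<in>H. i < j \<longrightarrow> R i j) \<or> (\<forall>i\<in>H. \<forall>j\<in>H. i < j \<longrightarrow> \<not> R i j)"
      using K[OF Rs(2), of U] U V(1) finite_subset by blast
    moreover have "(\<forall>i\<in>H. \<forall>j\<in>H. i < j \<longrightarrow> R i j) \<or> (\<forall>i\<in>H. \<forall>j\<in>H. i < j \<longrightarrow> \<not> R i j)"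
      using hU H(1) by (meson subsetD)
    ultimately have "\<forall>R\<in>set Rs. (\<forall>i\<in>H. \<forall>j\<in>H. i < j \<longrightarrow> R i j) \<or> (\<forall>i\<in>H. \<forall>j\<in>H. i < j \<longrightarrow> \<not> R i j)"
      by (simp add: Rs(1))
    then show "\<exists>H\<subseteq>V. card H = N \<and>
      (\<forall>R\<in>set Rs. (\<forall>i\<in>H. \<forall>j\<in>H. i < j \<longrightarrow> R i j) \<or> (\<forall>i\<in>H. \<forall>j\<in>H. i < j \<longrightarrow> \<not> R i j))"
      using H U(1) by (intro exI[of _ H]) simp
  qed
qed

lemma ramsey_relations_enum:
  "\<exists>K. \<forall>Rs (V :: nat set). length Rs = k \<longrightarrow> finite V \<longrightarrow> K \<le> card V \<longrightarrow>
     (\<exists>e. (\<forall>s<N::nat. e s \<in> V) \<and> (\<forall>s t. s < t \<longrightarrow> t < N \<longrightarrow> e s < e t) \<and>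
       (\<forall>R\<in>set Rs. (\<forall>s t. s < t \<longrightarrow> t < N \<longrightarrow> R (e s) (e t)) \<or> (\<forall>s t. s < t \<longrightarrow> t < N \<longrightarrow> \<not> R (e s) (e t))))"
proof -
  obtain K where K: "\<And>Rs V :: nat set. length Rs = k \<Longrightarrow> finite V \<Longrightarrow> K \<le> card V \<Longrightarrow>
     \<exists>H\<subseteq>V. card H = N \<and> (\<forall>R\<in>set Rs. (\<forall>i\<in>H. \<forall>j\<in>H. i < j \<longrightarrow> R i j) \<or> (\<forall>i\<in>H. \<forall>j\<in>H. i < j \<longrightarrow> \<not> R i j))"
    using ramsey_relations[of k N] by blast
  show ?thesis
  proof (intro exI[of _ K] allI impI)
    fix Rs :: "(nat \<Rightarrow> nat \<Rightarrow> bool) list" and V :: "nat set"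
    assume a: "length Rs = k" "finite V" "K \<le> card V"
    obtain H where H: "H \<subseteq> V" "card H = N"
      "\<forall>R\<in>set Rs. (\<forall>i\<in>H. \<forall>j\<in>H. i < j \<longrightarrow> R i j) \<or> (\<forall>i\<in>H. \<forall>j\<in>H. i < j \<longrightarrow> \<not> R i j)"
      using K[OF a] by blast
    have fin: "finite H" using H(1) a(2) finite_subset by blast
    define e where "e s = sorted_list_of_set H ! s" for s
    have len: "length (sorted_list_of_set H) = N" using H(2) by simp
    have e1: "e s \<in> H" if "s < N" for s
      using nth_mem[of s "sorted_list_of_set H"] that len fin by (simp add: e_def)
    have e2: "e s < e t" if "s < t" "t < N" for s t
      using that len strict_sorted_list_of_set[of H] by (simp add: e_def sorted_wrt_iff_nth_less)
    show "\<exists>e. (\<forall>s<N. e s \<in> V) \<and> (\<forall>s t. s < t \<longrightarrow> t < N \<longrightarrow> e s < e t) \<and>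
       (\<forall>R\<in>set Rs. (\<forall>s t. s < t \<longrightarrow> t < N \<longrightarrow> R (e s) (e t)) \<or> (\<forall>s t. s < t \<longrightarrow> t < N \<longrightarrow> \<not> R (e s) (e t)))"
    proof (intro exI[of _ e] conjI ballI)
      fix R assume "R \<in> set Rs"
      then have "(\<forall>i\<in>H. \<forall>j\<in>H. i < j \<longrightarrow> R i j) \<or> (\<forall>i\<in>H. \<forall>j\<in>H. i < j \<longrightarrow> \<not> R i j)" using H(3) by blast
      then show "(\<forall>s t. s < t \<longrightarrow> t < N \<longrightarrow> R (e s) (e t)) \<or> (\<forall>s t. s < t \<longrightarrow> t < N \<longrightarrow> \<not> R (e s) (e t))"
        using e1 e2 by (meson dual_order.strict_trans)
    qed (use e1 e2 H(1) in auto)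
  qed
qed

text \<open>If the pairs are descents, they are the layers of a reversed layered configuration. If
  they are ascents, either the separators \<open>C s\<close> run past all later pairs or before all
  earlier ones, which gives a class W, or each stays beside its own pair and forms an inversion with
  the nearer entry, which again gives layers. The hypotheses \<open>up\<close> and \<open>h1\<close>
  to \<open>h4\<close> are what Ramsey's theorem supplies. The two spare indices have two uses:
  homogeneity says something about a property of \<open>s\<close> alone only if there is a larger
  \<open>t\<close>, and the pair at \<open>N\<close> or at 0 is a barrier between separators and
  pairs.\<close>

lemma ascending_separated_pairs:
  fixes p :: "nat \<Rightarrow> int" and e C :: "nat \<Rightarrow> nat"
  assumes gap: "\<And>s t. s < t \<Longrightarrow> t < N + 2 \<Longrightarrow> e s + 1 < e t"
    and n: "\<And>s. s < N + 2 \<Longrightarrow> e s + 1 < n \<and> C s < n"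
    and sep: "\<And>s. s < N + 2 \<Longrightarrow> min (p (e s)) (p (e s + 1)) < p (C s) \<and> p (C s) < max (p (e s)) (p (e s + 1))"
    and asc: "\<And>s t. s < t \<Longrightarrow> t < N + 2 \<Longrightarrow> max (p (e s)) (p (e s + 1)) < min (p (e t)) (p (e t + 1))"
    and up: "(\<forall>s t. s < t \<longrightarrow> t < N + 2 \<longrightarrow> p (e s) < p (e s + 1)) \<or> (\<forall>s t. s < t \<longrightarrow> t < N + 2 \<longrightarrow> \<not> p (e s) < p (e s + 1))"
    and h1: "(\<forall>s t. s < t \<longrightarrow> t < N + 2 \<longrightarrow> C s < e t) \<or> (\<forall>s t. s < t \<longrightarrow> t < N + 2 \<longrightarrow> \<not> C s < e t)"
    and h2: "(\<forall>s t. s < t \<longrightarrow> t < N + 2 \<longrightarrow> C t < e s) \<or> (\<forall>s t. s < t \<longrightarrow> t < N + 2 \<longrightarrow> \<not> C t < e s)"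
    and h3: "(\<forall>s t. s < t \<longrightarrow> t < N + 2 \<longrightarrow> C s < C t) \<or> (\<forall>s t. s < t \<longrightarrow> t < N + 2 \<longrightarrow> \<not> C s < C t)"
    and h4: "(\<forall>s t. s < t \<longrightarrow> t < N + 2 \<longrightarrow> C s < e s) \<or> (\<forall>s t. s < t \<longrightarrow> t < N + 2 \<longrightarrow> \<not> C s < e s)"
  shows "\<exists>X\<in>growth_classes. \<forall>\<pi>\<in>X. length \<pi> \<le> N \<longrightarrow> occurs \<pi> p n"
proof -
  have val: "p x < p y"
    if "s < t" "t < N + 2" "x = e s \<or> x = e s + 1 \<or> x = C s" "y = e t \<or> y = e t + 1 \<or> y = C t" for s t x y
  proof -
    have "p x \<le> max (p (e s)) (p (e s + 1))" using that sep[of s] by auto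
    also have "\<dots> < min (p (e t)) (p (e t + 1))" by (rule asc[OF that(1,2)])
    also have "\<dots> \<le> p y" using that sep[of t] by auto
    finally show ?thesis .
  qed
  have emono: "e s < e t" if "s < t" "t < N + 2" for s t using gap[OF that] by simp
  have Cneq: "C s \<noteq> e t \<and> C s \<noteq> e t + 1" if "s < N + 2" "t < N + 2" for s t
  proof (cases s t rule: linorder_cases)
    case less then show ?thesis using val[of s t "C s" "C s"] that by auto
  next
    case equal then show ?thesis using sep[of s] that by fastforce
  next
    case greater then show ?thesis using val[of t s "C s" "C s"] that by auto
  qed
  have CC: "C s \<noteq> C t" if "s < t" "t < N + 2" for s t using val[of s t "C s" "C s"] that by auto
  show ?thesis
  proof (cases "\<forall>s t. s < t \<longrightarrow> t < N + 2 \<longrightarrow> p (e s) < p (e s + 1)")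
    case False
    then have not_up: "\<forall>s t. s < t \<longrightarrow> t < N + 2 \<longrightarrow> \<not> p (e s) < p (e s + 1)" using up by blast
    have down: "p (e s + 1) < p (e s)" if "s < N" for s
      using not_up[rule_format, of s "s + 1"] sep[of s] that by auto
    have "occurs \<pi> p n" if "\<pi> \<in> rev ` L2R" "length \<pi> \<le> N" for \<pi>
    proof (rule occurs_rev_L2R[OF that, where P = e and Q = "\<lambda>s. e s + 1"])
      fix s assume "s < N" then show "e s < e s + 1 \<and> p (e s + 1) < p (e s) \<and> e s + 1 < n"
        using down n[of s] by simp
    next
      fix s t x y assume "s < t" "t < N" "x \<in> {e s, e s + 1}" "y \<in> {e t, e t + 1}"
      then show "x < y \<and> p x < p y" using val[of s t x y] gap[of s t] by auto
    qed
    then show ?thesis using L2R_growth_classes(2) by blast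
  next
    case True
    then have up: "p (e s) < p (C s)" "p (C s) < p (e s + 1)" if "s \<le> N" for s
      using that sep[of s] True[rule_format, of s "N + 1"] by auto
    show ?thesis
    proof (cases "\<forall>s t. s < t \<longrightarrow> t < N + 2 \<longrightarrow> C s < e t")
      case False
      then have "\<forall>s t. s < t \<longrightarrow> t < N + 2 \<longrightarrow> \<not> C s < e t" using h1 by blast
      then have C: "e t + 1 < C s" if "s < t" "t < N + 2" for s t
        using that Cneq[of s t] by fastforce
      define e2 :: int where "e2 = (if \<forall>s t. s < t \<longrightarrow> t < N + 2 \<longrightarrow> C s < C t then 1 else -1)"
      have e: "1 \<in> {1, -1 :: int}" "e2 \<in> {1, -1}" by (auto simp: e2_def)
      have "occurs \<pi> p n" if "\<pi> \<in> W [1, e2]" "length \<pi> \<le> N" for \<pi>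
      proof (rule occurs_W[OF e that, where L = e and R = C])
        fix s t assume "s < N" "t < N"
        \<comment> \<open>The spare pair at \<open>N\<close> lies to the right of all pairs used and
          to the left of all separators used.\<close>
        then show "e s < C t" using emono[of s N] C[of t N] by simp
      next
        fix s assume "s < N" then show "C s < n" using n[of s] by simp
      next
        fix s t x y assume "s < t" "t < N" "x \<in> {e s, C s}" "y \<in> {e t, C t}"
        then show "p x < p y" using val[of s t x y] by auto
      next
        fix s t assume "s < t" "t < N" then show "1 * int (e s) < 1 * int (e t)" using emono[of s t] by simp
      next
        fix s t assume st: "s < t" "t < N"
        then show "e2 * int (C s) < e2 * int (C t)"
          using h3 CC[of s t] unfolding e2_def by (auto simp: linorder_neq_iff)
      qed
      then show ?thesis using W_growth_classes(1)[OF e] by blast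
    next
      case right: True
      show ?thesis
      proof (cases "\<forall>s t. s < t \<longrightarrow> t < N + 2 \<longrightarrow> C t < e s")
        case True
        define e1 :: int where "e1 = (if \<forall>s t. s < t \<longrightarrow> t < N + 2 \<longrightarrow> C s < C t then 1 else -1)"
        have e: "e1 \<in> {1, -1}" "1 \<in> {1, -1 :: int}" by (auto simp: e1_def)
        have "occurs \<pi> p n" if "\<pi> \<in> W [e1, 1]" "length \<pi> \<le> N" for \<pi>
        proof (rule occurs_W[OF e that, where L = "\<lambda>s. C (s + 1)" and R = "\<lambda>s. e (s + 1)"])
          fix s t assume "s < N" "t < N"
          \<comment> \<open>The shift by one frees index 0, whose pair lies to the right of all
            separators used and to the left of all pairs used.\<close>
          then have "C (s + 1) < e 0" "e 0 < e (t + 1)" using emono[of 0 "t + 1"] True by auto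
          then show "C (s + 1) < e (t + 1)" by simp
        next
          fix s assume "s < N" then show "e (s + 1) < n" using n[of "s + 1"] by simp
        next
          fix s t x y assume "s < t" "t < N" "x \<in> {C (s + 1), e (s + 1)}" "y \<in> {C (t + 1), e (t + 1)}"
          then show "p x < p y" using val[of "s + 1" "t + 1" x y] by auto
        next
          fix s t assume "s < t" "t < N"
          then show "1 * int (e (s + 1)) < 1 * int (e (t + 1))" using emono[of "s + 1" "t + 1"] by simp
        next
          fix s t assume st: "s < t" "t < N"
          then show "e1 * int (C (s + 1)) < e1 * int (C (t + 1))"
            using h3 CC[of "s + 1" "t + 1"] unfolding e1_def by (auto simp: linorder_neq_iff)
        qed
        then show ?thesis using W_growth_classes(1)[OF e] by blast
      next
        case False
        then have "\<forall>s t. s < t \<longrightarrow> t < N + 2 \<longrightarrow> \<not> C t < e s" using h2 by blast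
        then have left: "e s + 1 < C t" if "s < t" "t < N + 2" for s t
          using that Cneq[of t s] by fastforce
        show ?thesis
        proof (cases "\<forall>s t. s < t \<longrightarrow> t < N + 2 \<longrightarrow> C s < e s")
          case True
          then have Cl: "C s < e s" if "s < N" for s using that True[rule_format, of s "s + 1"] by simp
          have "occurs \<pi> p n" if "\<pi> \<in> rev ` L2R" "length \<pi> \<le> N" for \<pi>
          proof (rule occurs_rev_L2R[OF that, where P = C and Q = e])
            fix s assume "s < N" then show "C s < e s \<and> p (e s) < p (C s) \<and> e s < n"
              using Cl up[of s] n[of s] by simp
          next
            fix s t x y assume st: "s < t" "t < N" "x \<in> {C s, e s}" "y \<in> {C t, e t}"
            then show "x < y \<and> p x < p y"
              using val[of s t x y] Cl[of s] left[of s t] emono[of s t] by auto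
          qed
          then show ?thesis using L2R_growth_classes(2) by blast
        next
          case False
          then have not_left: "\<forall>s t. s < t \<longrightarrow> t < N + 2 \<longrightarrow> \<not> C s < e s" using h4 by blast
          have Cr: "e s + 1 < C s" if "s < N" for s
            using not_left[rule_format, of s "s + 1"] that Cneq[of s s] by simp
          have "occurs \<pi> p n" if "\<pi> \<in> rev ` L2R" "length \<pi> \<le> N" for \<pi>
          proof (rule occurs_rev_L2R[OF that, where P = "\<lambda>s. e s + 1" and Q = C])
            fix s assume "s < N" then show "e s + 1 < C s \<and> p (C s) < p (e s + 1) \<and> C s < n"
              using Cr up[of s] n[of s] by simp
          next
            fix s t x y assume st: "s < t" "t < N" "x \<in> {e s + 1, C s}" "y \<in> {e t + 1, C t}"
            have "C s < e t" using right st by simp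
            then show "x < y \<and> p x < p y"
              using val[of s t x y] Cr[of s] Cr[of t] left[of s t] emono[of s t] gap[of s t] st by auto
          qed
          then show ?thesis using L2R_growth_classes(2) by blast
        qed
      qed
    qed
  qed
qed

section \<open>Breaks, and the configurations forced by many of them\<close>

definition breaks :: "nat list \<Rightarrow> nat set" where
  "breaks \<sigma> = {i. i + 1 < length \<sigma> \<and> \<sigma> ! (i + 1) \<noteq> \<sigma> ! i + 1 \<and> \<sigma> ! i \<noteq> \<sigma> ! (i + 1) + 1}"

lemma finite_breaks: "finite (breaks \<sigma>)"
  by (rule finite_subset[of _ "{..<length \<sigma>}"]) (auto simp: breaks_def)

lemma breaks_separator:
  assumes "is_perm \<sigma>" "i \<in> breaks \<sigma>"
  obtains c where "c < length \<sigma>" "min (\<sigma> ! i) (\<sigma> ! (i + 1)) < \<sigma> ! c" "\<sigma> ! c < max (\<sigma> ! i) (\<sigma> ! (i + 1))"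
proof -
  have i: "i + 1 < length \<sigma>" "\<sigma> ! (i + 1) \<noteq> \<sigma> ! i + 1" "\<sigma> ! i \<noteq> \<sigma> ! (i + 1) + 1"
    using assms(2) by (auto simp: breaks_def)
  have "\<sigma> ! i \<noteq> \<sigma> ! (i + 1)" using is_perm_nth_eq_iff[OF assms(1), of i "i + 1"] i by simp
  then have v: "min (\<sigma> ! i) (\<sigma> ! (i + 1)) + 1 < max (\<sigma> ! i) (\<sigma> ! (i + 1))" using i by linarith
  moreover have "max (\<sigma> ! i) (\<sigma> ! (i + 1)) \<le> length \<sigma>"
    using is_perm_nth_bounds(2)[OF assms(1), of i] is_perm_nth_bounds(2)[OF assms(1), of "i + 1"] i by simp
  ultimately have "min (\<sigma> ! i) (\<sigma> ! (i + 1)) + 1 \<le> length \<sigma>" by linarith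
  then obtain c where "c < length \<sigma>" "\<sigma> ! c = min (\<sigma> ! i) (\<sigma> ! (i + 1)) + 1"
    using is_perm_obtain_index[OF assms(1), of "min (\<sigma> ! i) (\<sigma> ! (i + 1)) + 1"] by auto
  then show thesis using that[of c] v by simp
qed

text \<open>Overlap puts every lower end below every upper end. The lower and the upper ends are
  then two monotone sequences stacked in value, while the pairs stay disjoint in position: these are
  the slots of an inverse class, and one end is chosen from each pair.\<close>

lemma intersecting_pairs:
  fixes p :: "nat \<Rightarrow> int" and e :: "nat \<Rightarrow> nat"
  assumes gap: "\<And>s t. s < t \<Longrightarrow> t < N \<Longrightarrow> e s + 1 < e t"
    and n: "\<And>s. s < N \<Longrightarrow> e s + 1 < n"
    and neq: "\<And>i j. i < n \<Longrightarrow> j < n \<Longrightarrow> i \<noteq> j \<Longrightarrow> p i \<noteq> p j"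
    and meet: "\<And>s t. s < N \<Longrightarrow> t < N \<Longrightarrow> min (p (e s)) (p (e s + 1)) < max (p (e t)) (p (e t + 1))"
    and lo: "(\<forall>s t. s < t \<longrightarrow> t < N \<longrightarrow> min (p (e s)) (p (e s + 1)) < min (p (e t)) (p (e t + 1))) \<or>
      (\<forall>s t. s < t \<longrightarrow> t < N \<longrightarrow> \<not> min (p (e s)) (p (e s + 1)) < min (p (e t)) (p (e t + 1)))"
    and hi: "(\<forall>s t. s < t \<longrightarrow> t < N \<longrightarrow> max (p (e s)) (p (e s + 1)) < max (p (e t)) (p (e t + 1))) \<or>
      (\<forall>s t. s < t \<longrightarrow> t < N \<longrightarrow> \<not> max (p (e s)) (p (e s + 1)) < max (p (e t)) (p (e t + 1)))"
  shows "\<exists>X\<in>growth_classes. \<forall>\<pi>\<in>X. length \<pi> \<le> N \<longrightarrow> occurs \<pi> p n"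
proof -
  define A where "A s = (if p (e s) < p (e s + 1) then e s else e s + 1)" for s
  define B where "B s = (if p (e s) < p (e s + 1) then e s + 1 else e s)" for s
  have A: "p (A s) = min (p (e s)) (p (e s + 1))" and B: "p (B s) = max (p (e s)) (p (e s + 1))" for s
    by (auto simp: A_def B_def)
  have mem: "A s \<in> {e s, e s + 1}" "B s \<in> {e s, e s + 1}" for s by (auto simp: A_def B_def)
  have pos: "x < y" if "s < t" "t < N" "x \<in> {A s, B s}" "y \<in> {A t, B t}" for s t x y
  proof -
    have "x \<le> e s + 1" "e t \<le> y" using that mem[of s] mem[of t] by auto
    then show ?thesis using gap[of s t] that by simp
  qed
  have AB: "A s < n" "B s < n" if "s < N" for s
    using n[OF that] by (auto simp: A_def B_def)
  have ne: "p (A s) \<noteq> p (A t)" "p (B s) \<noteq> p (B t)" if "s < t" "t < N" for s t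
    using neq AB[of s] AB[of t] pos[OF that, of "A s" "A t"] pos[OF that, of "B s" "B t"] that by auto
  define e1 :: int where "e1 = (if \<forall>s t. s < t \<longrightarrow> t < N \<longrightarrow> p (A s) < p (A t) then 1 else -1)"
  define e2 :: int where "e2 = (if \<forall>s t. s < t \<longrightarrow> t < N \<longrightarrow> p (B s) < p (B t) then 1 else -1)"
  have e: "e1 \<in> {1, -1}" "e2 \<in> {1, -1}" by (auto simp: e1_def e2_def)
  have "occurs \<pi> p n" if "\<pi> \<in> class_inverse (W [e1, e2])" "length \<pi> \<le> N" for \<pi>
  proof (rule occurs_inverse_W[OF e that, where A = A and B = B])
    fix s t assume "s < N" "t < N" then show "p (A s) < p (B t)" using meet by (simp add: A B)
  next
    fix s assume "s < N" then show "A s < n \<and> B s < n" using AB by simp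
  next
    fix s t x y assume "s < t" "t < N" "x \<in> {A s, B s}" "y \<in> {A t, B t}"
    then show "x < y" by (rule pos)
  next
    fix s t assume st: "s < t" "t < N"
    show "e1 * p (A s) < e1 * p (A t)"
    proof (cases "\<forall>s t. s < t \<longrightarrow> t < N \<longrightarrow> p (A s) < p (A t)")
      case False
      then have "\<forall>s t. s < t \<longrightarrow> t < N \<longrightarrow> \<not> p (A s) < p (A t)" using lo unfolding A[symmetric] by blast
      then have "\<not> p (A s) < p (A t)" using st by blast
      moreover have "e1 = -1" using False unfolding e1_def by (rule if_not_P)
      ultimately show ?thesis using ne(1)[OF st] by simp
    qed (use st in \<open>simp add: e1_def\<close>)
    show "e2 * p (B s) < e2 * p (B t)"
    proof (cases "\<forall>s t. s < t \<longrightarrow> t < N \<longrightarrow> p (B s) < p (B t)")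
      case False
      then have "\<forall>s t. s < t \<longrightarrow> t < N \<longrightarrow> \<not> p (B s) < p (B t)" using hi unfolding B[symmetric] by blast
      then have "\<not> p (B s) < p (B t)" using st by blast
      moreover have "e2 = -1" using False unfolding e2_def by (rule if_not_P)
      ultimately show ?thesis using ne(2)[OF st] by simp
    qed (use st in \<open>simp add: e2_def\<close>)
  qed
  then show ?thesis using W_growth_classes(2)[OF e] by blast
qed

text \<open>After ten relations have been made homogeneous at once, any two value intervals of the
  selected pairs are in the same relative position: ascending, descending or overlapping
  throughout.\<close>

lemma many_breaks:
  "\<exists>K. \<forall>\<sigma>. is_perm \<sigma> \<longrightarrow> K \<le> card (breaks \<sigma>) \<longrightarrow>
     (\<exists>X\<in>growth_classes. \<forall>\<pi>\<in>X. length \<pi> \<le> N \<longrightarrow> \<pi> \<preceq> \<sigma>)"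
proof -
  \<comment> \<open>The separated case needs \<open>N + 2\<close> indices, and at least three are
    needed, even for \<open>N = 0\<close>, to exclude that any two selected breaks are adjacent
    positions.\<close>
  let ?M = "N + 3"
  obtain K where K: "\<forall>Rs (V :: nat set). length Rs = 10 \<longrightarrow> finite V \<longrightarrow> K \<le> card V \<longrightarrow>
     (\<exists>e. (\<forall>s<?M. e s \<in> V) \<and> (\<forall>s t. s < t \<longrightarrow> t < ?M \<longrightarrow> e s < e t) \<and>
       (\<forall>R\<in>set Rs. (\<forall>s t. s < t \<longrightarrow> t < ?M \<longrightarrow> R (e s) (e t)) \<or> (\<forall>s t. s < t \<longrightarrow> t < ?M \<longrightarrow> \<not> R (e s) (e t))))"
    using ramsey_relations_enum[of 10 ?M] by (rule exE)
  show ?thesis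
  proof (intro exI[of _ K] allI impI)
    fix \<sigma> assume \<sigma>: "is_perm \<sigma>" "K \<le> card (breaks \<sigma>)"
    let ?n = "length \<sigma>"
    define p where "p = (\<lambda>i. int (\<sigma> ! i))"
    have "\<forall>i\<in>breaks \<sigma>. \<exists>c. c < ?n \<and> min (p i) (p (i + 1)) < p c \<and> p c < max (p i) (p (i + 1))"
    proof
      fix i assume "i \<in> breaks \<sigma>"
      then obtain c where "c < ?n" "min (\<sigma> ! i) (\<sigma> ! (i + 1)) < \<sigma> ! c" "\<sigma> ! c < max (\<sigma> ! i) (\<sigma> ! (i + 1))"
        using breaks_separator[OF \<sigma>(1)] by blast
      then show "\<exists>c. c < ?n \<and> min (p i) (p (i + 1)) < p c \<and> p c < max (p i) (p (i + 1))"
        unfolding p_def by (intro exI[of _ c]) linarith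
    qed
    then obtain c where c: "\<forall>i\<in>breaks \<sigma>. c i < ?n \<and> min (p i) (p (i + 1)) < p (c i) \<and> p (c i) < max (p i) (p (i + 1))"
      by metis
    define lo where "lo i = min (p i) (p (i + 1))" for i
    define hi where "hi i = max (p i) (p (i + 1))" for i
    \<comment> \<open>The first relation detects neighbouring breaks, the next five the direction of
      a pair and the position of the value intervals, the last four the location of the separators.
      A property of \<open>i\<close> alone is passed as a relation that ignores
      \<open>j\<close>.\<close>
    define Rs where "Rs = [\<lambda>i j. i + 1 = j, \<lambda>i j. p i < p (i + 1), \<lambda>i j. hi i < lo j, \<lambda>i j. hi j < lo i,
      \<lambda>i j. lo i < lo j, \<lambda>i j. hi i < hi j, \<lambda>i j. c i < j, \<lambda>i j. c j < i, \<lambda>i j. c i < c j, \<lambda>i j. c i < i]"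
    have "length Rs = 10" by (simp add: Rs_def)
    obtain e where e: "\<forall>s<?M. e s \<in> breaks \<sigma>" "\<forall>s t. s < t \<longrightarrow> t < ?M \<longrightarrow> e s < e t"
      and R: "\<forall>R\<in>set Rs. (\<forall>s t. s < t \<longrightarrow> t < ?M \<longrightarrow> R (e s) (e t)) \<or> (\<forall>s t. s < t \<longrightarrow> t < ?M \<longrightarrow> \<not> R (e s) (e t))"
      using K[THEN spec, THEN spec, THEN mp, THEN mp, THEN mp, OF \<open>length Rs = 10\<close> finite_breaks \<sigma>(2)]
      by (elim exE conjE) (rule that)
    have hom: "(\<forall>s t. s < t \<longrightarrow> t < M \<longrightarrow> R (e s) (e t)) \<or> (\<forall>s t. s < t \<longrightarrow> t < M \<longrightarrow> \<not> R (e s) (e t))"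
      if "R \<in> set Rs" "M \<le> ?M" for R M
    proof -
      have "t < ?M" if "t < M" for t using that \<open>M \<le> ?M\<close> by simp
      then show ?thesis using R[rule_format, OF that(1)] by blast
    qed
    have en: "e s + 1 < ?n" if "s < ?M" for s using e(1) that by (auto simp: breaks_def)
    have cn: "c (e s) < ?n" if "s < ?M" for s using e(1) c that by simp
    have "\<not> (\<forall>s t. s < t \<longrightarrow> t < ?M \<longrightarrow> e s + 1 = e t)"
    proof
      assume h: "\<forall>s t. s < t \<longrightarrow> t < ?M \<longrightarrow> e s + 1 = e t"
      have "e 0 + 1 = e 1" "e 0 + 1 = e 2" "e 1 < e 2"
        using h[rule_format, of 0 1] h[rule_format, of 0 2] e(2)[rule_format, of 1 2] by auto
      then show False by simp
    qed
    then have nadj: "\<forall>s t. s < t \<longrightarrow> t < ?M \<longrightarrow> \<not> e s + 1 = e t"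
      using hom[of "\<lambda>i j. i + 1 = j" ?M] by (auto simp: Rs_def)
    have gap: "e s + 1 < e t" if "s < t" "t < ?M" for s t
      using nadj[rule_format, OF that] e(2)[rule_format, OF that] by linarith
    have neq: "p i \<noteq> p j" if "i < ?n" "j < ?n" "i \<noteq> j" for i j
      using is_perm_nth_eq_iff[OF \<sigma>(1) that(1,2)] that(3) by (simp add: p_def)
    have sep: "lo (e s) < p (c (e s))" "p (c (e s)) < hi (e s)" if "s < ?M" for s
      using c e(1) that by (auto simp: lo_def hi_def)
    show "\<exists>X\<in>growth_classes. \<forall>\<pi>\<in>X. length \<pi> \<le> N \<longrightarrow> \<pi> \<preceq> \<sigma>"
    proof (cases "\<forall>s t. s < t \<longrightarrow> t < N + 2 \<longrightarrow> hi (e s) < lo (e t)")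
      case True
      have "\<exists>X\<in>growth_classes. \<forall>\<pi>\<in>X. length \<pi> \<le> N \<longrightarrow> occurs \<pi> p ?n"
      proof (rule ascending_separated_pairs[where e = e and C = "\<lambda>s. c (e s)"])
        fix s t assume "s < t" "t < N + 2" then show "e s + 1 < e t" using gap by simp
      next
        fix s assume "s < N + 2" then show "e s + 1 < ?n \<and> c (e s) < ?n" using en cn by simp
      next
        fix s assume "s < N + 2"
        then show "min (p (e s)) (p (e s + 1)) < p (c (e s)) \<and> p (c (e s)) < max (p (e s)) (p (e s + 1))"
          using sep[of s] by (simp add: lo_def hi_def)
      next
        fix s t assume "s < t" "t < N + 2"
        then show "max (p (e s)) (p (e s + 1)) < min (p (e t)) (p (e t + 1))"
          using True by (simp only: lo_def hi_def)
      next
        show "(\<forall>s t. s < t \<longrightarrow> t < N + 2 \<longrightarrow> p (e s) < p (e s + 1)) \<or> (\<forall>s t. s < t \<longrightarrow> t < N + 2 \<longrightarrow> \<not> p (e s) < p (e s + 1))"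
          by (rule hom[of "\<lambda>i j. p i < p (i + 1)"]) (simp_all add: Rs_def)
        show "(\<forall>s t. s < t \<longrightarrow> t < N + 2 \<longrightarrow> c (e s) < e t) \<or> (\<forall>s t. s < t \<longrightarrow> t < N + 2 \<longrightarrow> \<not> c (e s) < e t)"
          by (rule hom[of "\<lambda>i j. c i < j"]) (simp_all add: Rs_def)
        show "(\<forall>s t. s < t \<longrightarrow> t < N + 2 \<longrightarrow> c (e t) < e s) \<or> (\<forall>s t. s < t \<longrightarrow> t < N + 2 \<longrightarrow> \<not> c (e t) < e s)"
          by (rule hom[of "\<lambda>i j. c j < i"]) (simp_all add: Rs_def)
        show "(\<forall>s t. s < t \<longrightarrow> t < N + 2 \<longrightarrow> c (e s) < c (e t)) \<or> (\<forall>s t. s < t \<longrightarrow> t < N + 2 \<longrightarrow> \<not> c (e s) < c (e t))"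
          by (rule hom[of "\<lambda>i j. c i < c j"]) (simp_all add: Rs_def)
        show "(\<forall>s t. s < t \<longrightarrow> t < N + 2 \<longrightarrow> c (e s) < e s) \<or> (\<forall>s t. s < t \<longrightarrow> t < N + 2 \<longrightarrow> \<not> c (e s) < e s)"
          by (rule hom[of "\<lambda>i j. c i < i"]) (simp_all add: Rs_def)
      qed
      then show ?thesis by (simp add: contains_pat_iff_occurs p_def)
    next
      case not_asc: False
      show ?thesis
      proof (cases "\<forall>s t. s < t \<longrightarrow> t < N + 2 \<longrightarrow> hi (e t) < lo (e s)")
        case True
        \<comment> \<open>Negation makes the descending intervals ascend; the class found for
          \<open>q\<close> is complemented at the end.\<close>
        define q where "q i = - p i" for i
        have up: "(\<forall>s t. s < t \<longrightarrow> t < N + 2 \<longrightarrow> q (e s) < q (e s + 1)) \<or> (\<forall>s t. s < t \<longrightarrow> t < N + 2 \<longrightarrow> \<not> q (e s) < q (e s + 1))"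
        proof -
          have "q (e s) < q (e s + 1) \<longleftrightarrow> \<not> p (e s) < p (e s + 1)" if "s < N + 2" for s
            using neq[of "e s" "e s + 1"] en[of s] that by (auto simp: q_def)
          moreover have "(\<forall>s t. s < t \<longrightarrow> t < N + 2 \<longrightarrow> p (e s) < p (e s + 1)) \<or> (\<forall>s t. s < t \<longrightarrow> t < N + 2 \<longrightarrow> \<not> p (e s) < p (e s + 1))"
            by (rule hom[of "\<lambda>i j. p i < p (i + 1)"]) (simp_all add: Rs_def)
          ultimately show ?thesis by (meson dual_order.strict_trans)
        qed
        have "\<exists>X\<in>growth_classes. \<forall>\<pi>\<in>X. length \<pi> \<le> N \<longrightarrow> occurs \<pi> q ?n"
        proof (rule ascending_separated_pairs[where e = e and C = "\<lambda>s. c (e s)"])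
          fix s t assume "s < t" "t < N + 2" then show "e s + 1 < e t" using gap by simp
        next
          fix s assume "s < N + 2" then show "e s + 1 < ?n \<and> c (e s) < ?n" using en cn by simp
        next
          fix s assume "s < N + 2"
          then show "min (q (e s)) (q (e s + 1)) < q (c (e s)) \<and> q (c (e s)) < max (q (e s)) (q (e s + 1))"
            using sep[of s] by (auto simp: lo_def hi_def q_def)
        next
          fix s t assume "s < t" "t < N + 2"
          then have "hi (e t) < lo (e s)" using True by blast
          then show "max (q (e s)) (q (e s + 1)) < min (q (e t)) (q (e t + 1))"
            by (auto simp: lo_def hi_def q_def)
        next
          show "(\<forall>s t. s < t \<longrightarrow> t < N + 2 \<longrightarrow> c (e s) < e t) \<or> (\<forall>s t. s < t \<longrightarrow> t < N + 2 \<longrightarrow> \<not> c (e s) < e t)"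
            by (rule hom[of "\<lambda>i j. c i < j"]) (simp_all add: Rs_def)
          show "(\<forall>s t. s < t \<longrightarrow> t < N + 2 \<longrightarrow> c (e t) < e s) \<or> (\<forall>s t. s < t \<longrightarrow> t < N + 2 \<longrightarrow> \<not> c (e t) < e s)"
            by (rule hom[of "\<lambda>i j. c j < i"]) (simp_all add: Rs_def)
          show "(\<forall>s t. s < t \<longrightarrow> t < N + 2 \<longrightarrow> c (e s) < c (e t)) \<or> (\<forall>s t. s < t \<longrightarrow> t < N + 2 \<longrightarrow> \<not> c (e s) < c (e t))"
            by (rule hom[of "\<lambda>i j. c i < c j"]) (simp_all add: Rs_def)
          show "(\<forall>s t. s < t \<longrightarrow> t < N + 2 \<longrightarrow> c (e s) < e s) \<or> (\<forall>s t. s < t \<longrightarrow> t < N + 2 \<longrightarrow> \<not> c (e s) < e s)"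
            by (rule hom[of "\<lambda>i j. c i < i"]) (simp_all add: Rs_def)
        qed (rule up)
        then obtain X where X: "X \<in> growth_classes" "\<forall>\<pi>\<in>X. length \<pi> \<le> N \<longrightarrow> occurs \<pi> (\<lambda>i. - p i) ?n"
          unfolding q_def by blast
        then have "\<forall>\<pi>\<in>perm_complement ` X. length \<pi> \<le> N \<longrightarrow> \<pi> \<preceq> \<sigma>"
          using occurs_complement is_perm_growth_classes[OF X(1)]
          by (auto simp: contains_pat_iff_occurs p_def)
        then show ?thesis using complement_growth_classes[OF X(1)] by blast
      next
        case not_desc: False
        have "\<forall>s t. s < t \<longrightarrow> t < N + 2 \<longrightarrow> \<not> hi (e s) < lo (e t)"
          using not_asc hom[of "\<lambda>i j. hi i < lo j" "N + 2"] by (auto simp: Rs_def)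
        moreover have "\<forall>s t. s < t \<longrightarrow> t < N + 2 \<longrightarrow> \<not> hi (e t) < lo (e s)"
          using not_desc hom[of "\<lambda>i j. hi j < lo i" "N + 2"] by (auto simp: Rs_def)
        ultimately have le: "lo (e t) \<le> hi (e s)" if "s \<noteq> t" "s < N + 2" "t < N + 2" for s t
          using that by (metis linorder_neqE_nat not_le_imp_less)
        \<comment> \<open>Intervals that are not separated give only a weak inequality. It is strict
          because different pairs occupy disjoint positions and so have distinct values.\<close>
        have meet: "lo (e s) < hi (e t)" if "s < N + 2" "t < N + 2" for s t
        proof (cases "s = t")
          case True then show ?thesis using sep[of t] that by simp
        next
          case False
          have ends: "lo (e s) \<in> {p (e s), p (e s + 1)}" "hi (e t) \<in> {p (e t), p (e t + 1)}"
            by (auto simp: lo_def hi_def)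
          have "{e s, e s + 1} \<inter> {e t, e t + 1} = {}"
            using gap[of s t] gap[of t s] False that by (cases "s < t") auto
          then have "lo (e s) \<noteq> hi (e t)"
            using ends neq[of "e s" "e t"] neq[of "e s + 1" "e t"] neq[of "e s" "e t + 1"]
              neq[of "e s + 1" "e t + 1"] en[of s] en[of t] that by auto
          then show ?thesis using le[of t s] False that by simp
        qed
        have "\<exists>X\<in>growth_classes. \<forall>\<pi>\<in>X. length \<pi> \<le> N \<longrightarrow> occurs \<pi> p ?n"
        proof (rule intersecting_pairs[where e = e])
          fix s t assume "s < t" "t < N" then show "e s + 1 < e t" using gap by simp
        next
          fix s assume "s < N" then show "e s + 1 < ?n" using en by simp
        next
          fix s t assume "s < N" "t < N"
          then show "min (p (e s)) (p (e s + 1)) < max (p (e t)) (p (e t + 1))"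
            using meet[of s t] by (simp add: lo_def hi_def)
        next
          have "(\<forall>s t. s < t \<longrightarrow> t < N \<longrightarrow> lo (e s) < lo (e t)) \<or> (\<forall>s t. s < t \<longrightarrow> t < N \<longrightarrow> \<not> lo (e s) < lo (e t))"
            by (rule hom[of "\<lambda>i j. lo i < lo j"]) (simp_all add: Rs_def)
          then show "(\<forall>s t. s < t \<longrightarrow> t < N \<longrightarrow> min (p (e s)) (p (e s + 1)) < min (p (e t)) (p (e t + 1))) \<or>
            (\<forall>s t. s < t \<longrightarrow> t < N \<longrightarrow> \<not> min (p (e s)) (p (e s + 1)) < min (p (e t)) (p (e t + 1)))"
            by (simp only: lo_def)
          have "(\<forall>s t. s < t \<longrightarrow> t < N \<longrightarrow> hi (e s) < hi (e t)) \<or> (\<forall>s t. s < t \<longrightarrow> t < N \<longrightarrow> \<not> hi (e s) < hi (e t))"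
            by (rule hom[of "\<lambda>i j. hi i < hi j"]) (simp_all add: Rs_def)
          then show "(\<forall>s t. s < t \<longrightarrow> t < N \<longrightarrow> max (p (e s)) (p (e s + 1)) < max (p (e t)) (p (e t + 1))) \<or>
            (\<forall>s t. s < t \<longrightarrow> t < N \<longrightarrow> \<not> max (p (e s)) (p (e s + 1)) < max (p (e t)) (p (e t + 1)))"
            by (simp only: hi_def)
        qed (rule neq)
        then show ?thesis by (simp add: contains_pat_iff_occurs p_def)
      qed
    qed
  qed
qed

section \<open>The criterion for polynomial growth\<close>

lemma finite_perms_length: "finite {\<sigma>. is_perm \<sigma> \<and> length \<sigma> = n}"
  by (rule finite_subset[of _ "permutations_of_set {1..n}"]) (auto simp: is_perm_def)

text \<open>A maximal run is determined by its start, its first value and its direction, which the second value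
  reveals; \<open>0\<close> marks the absence of a next entry.\<close>

definition run_starts :: "nat list \<Rightarrow> (nat \<times> nat \<times> nat) set" where
  "run_starts \<sigma> = (\<lambda>i. (i, \<sigma> ! i, if i + 1 < length \<sigma> then \<sigma> ! (i + 1) else 0)) ` insert 0 (Suc ` breaks \<sigma>)"

lemma not_break_cases:
  assumes "i \<notin> breaks \<sigma>" "i + 1 < length \<sigma>"
  shows "\<sigma> ! (i + 1) = \<sigma> ! i + 1 \<or> \<sigma> ! i = \<sigma> ! (i + 1) + 1"
  using assms by (auto simp: breaks_def)

text \<open>The permutation is rebuilt entry by entry. A run start and the entry after it are
  recorded. Any other entry differs by one from its predecessor and is distinct from the entry
  before that one, so it continues in the direction of the run.\<close>

lemma inj_on_run_starts: "inj_on run_starts {\<sigma>. is_perm \<sigma> \<and> length \<sigma> = n}"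
proof (rule inj_onI, clarify)
  fix \<sigma> \<tau> assume p: "is_perm \<sigma>" "is_perm \<tau>" and len: "length \<tau> = length \<sigma>"
    and eq: "run_starts \<sigma> = run_starts \<tau>"
  let ?n = "length \<sigma>"
  \<comment> \<open>The first components give back the breaks, so both permutations break at the
    same positions.\<close>
  have "fst ` run_starts \<rho> = insert 0 (Suc ` breaks \<rho>)" for \<rho>
    by (auto simp: run_starts_def image_image)
  then have "insert 0 (Suc ` breaks \<sigma>) = insert 0 (Suc ` breaks \<tau>)" using eq by metis
  then have br: "i \<in> breaks \<sigma> \<longleftrightarrow> i \<in> breaks \<tau>" for i by auto
  have start: "\<sigma> ! i = \<tau> ! i \<and> (i + 1 < ?n \<longrightarrow> \<sigma> ! (i + 1) = \<tau> ! (i + 1))"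
    if "i \<in> insert 0 (Suc ` breaks \<sigma>)" for i
  proof -
    have "(i, \<sigma> ! i, if i + 1 < ?n then \<sigma> ! (i + 1) else 0) \<in> run_starts \<tau>"
      using that unfolding eq[symmetric] by (auto simp: run_starts_def)
    then show ?thesis using len by (auto simp: run_starts_def split: if_splits)
  qed
  show "\<sigma> = \<tau>"
  proof (rule nth_equalityI)
    fix i assume "i < ?n"
    then show "\<sigma> ! i = \<tau> ! i"
    proof (induction i rule: less_induct)
      case (less i)
      show ?case
      proof (cases "i \<in> insert 0 (Suc ` breaks \<sigma>)")
        case False
        then obtain k where k: "i = k + 1" "k \<notin> breaks \<sigma>" by (cases i) auto
        show ?thesis
        proof (cases "k \<in> insert 0 (Suc ` breaks \<sigma>)")
          case True then show ?thesis using start[OF True] k less.prems by simp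
        next
          case False
          then obtain m where m: "k = m + 1" "m \<notin> breaks \<sigma>" by (cases k) auto
          have "\<sigma> ! i \<noteq> \<sigma> ! m" "\<tau> ! i \<noteq> \<tau> ! m"
            using is_perm_nth_eq_iff[OF p(1), of i m] is_perm_nth_eq_iff[OF p(2), of i m] less.prems k m len
            by auto
          moreover have "\<sigma> ! m = \<tau> ! m" "\<sigma> ! k = \<tau> ! k" using less.IH[of m] less.IH[of k] less.prems k m by auto
          moreover have "\<sigma> ! i = \<sigma> ! k + 1 \<or> \<sigma> ! k = \<sigma> ! i + 1"
            unfolding k(1) by (rule not_break_cases) (use k less.prems in simp_all)
          moreover have "\<tau> ! i = \<tau> ! k + 1 \<or> \<tau> ! k = \<tau> ! i + 1"
            unfolding k(1) by (rule not_break_cases) (use k br[of k] less.prems len in simp_all)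
          moreover have "\<sigma> ! k = \<sigma> ! m + 1 \<or> \<sigma> ! m = \<sigma> ! k + 1"
            unfolding m(1) by (rule not_break_cases) (use k m less.prems in simp_all)
          ultimately show ?thesis by auto
        qed
      qed (use start in blast)
    qed
  qed (simp add: len)
qed

text \<open>Padding by repetition makes every small nonempty set the set of a list of one fixed
  length, and such lists are easy to count.\<close>

lemma set_obtain_list:
  assumes "finite S" "S \<noteq> {}" "card S \<le> r"
  obtains xs where "set xs = S" "length xs = r"
proof -
  obtain ys where ys: "set ys = S" "length ys = card S"
    using assms(1) by (metis distinct_card finite_distinct_list)
  obtain a where a: "a \<in> S" using assms(2) by blast
  show thesis
  proof (rule that)
    show "set (ys @ replicate (r - card S) a) = S" using ys(1) a by auto
    show "length (ys @ replicate (r - card S) a) = r" using ys(2) assms(3) by simp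
  qed
qed

lemma few_breaks_polynomial_growth:
  assumes C: "\<And>\<sigma>. \<sigma> \<in> C \<Longrightarrow> is_perm \<sigma> \<and> card (breaks \<sigma>) < K"
  shows "polynomial_growth C"
  unfolding polynomial_growth_def
proof (intro exI allI impI)
  fix n :: nat assume n: "1 \<le> n"
  define U where "U = {..n} \<times> {..n} \<times> {..n}"
  define P where "P = {xs. set xs \<subseteq> U \<and> length xs = K}"
  have fin: "finite U" "finite P" by (auto simp: U_def P_def finite_lists_length_eq)
  have "run_starts ` {\<sigma> \<in> C. length \<sigma> = n} \<subseteq> set ` P"
  proof clarify
    fix \<sigma> assume \<sigma>: "\<sigma> \<in> C" "n = length \<sigma>"
    have p: "is_perm \<sigma>" "card (breaks \<sigma>) < K" using C \<sigma> by auto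
    have "card (run_starts \<sigma>) \<le> card (insert 0 (Suc ` breaks \<sigma>))"
      unfolding run_starts_def by (rule card_image_le) (simp add: finite_breaks)
    also have "\<dots> \<le> Suc (card (Suc ` breaks \<sigma>))" by (simp add: card_insert_if finite_breaks)
    also have "\<dots> \<le> K" using card_image_le[OF finite_breaks, of Suc \<sigma>] p(2) by simp
    finally have card: "card (run_starts \<sigma>) \<le> K" .
    have "finite (run_starts \<sigma>)" "run_starts \<sigma> \<noteq> {}" by (auto simp: run_starts_def finite_breaks)
    then obtain xs where xs: "set xs = run_starts \<sigma>" "length xs = K" using set_obtain_list[OF _ _ card] by blast
    have "run_starts \<sigma> \<subseteq> U"
    proof
      fix z assume "z \<in> run_starts \<sigma>"
      then obtain i where i: "i = 0 \<or> i \<in> Suc ` breaks \<sigma>"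
        "z = (i, \<sigma> ! i, if i + 1 < length \<sigma> then \<sigma> ! (i + 1) else 0)"
        by (auto simp: run_starts_def)
      have "i < length \<sigma>" using i(1) n \<sigma>(2) by (auto simp: breaks_def)
      then show "z \<in> U" using i(2) is_perm_nth_bounds(2)[OF p(1)] \<sigma>(2) by (auto simp: U_def)
    qed
    then show "run_starts \<sigma> \<in> set ` P" using xs by (auto simp: P_def intro!: image_eqI[of _ _ xs])
  qed
  then have "card (run_starts ` {\<sigma> \<in> C. length \<sigma> = n}) \<le> card (set ` P)"
    by (rule card_mono[rotated]) (simp add: fin)
  also have "\<dots> \<le> card P" by (rule card_image_le[OF fin(2)])
  also have "\<dots> = card U ^ K" unfolding P_def by (rule card_lists_length_eq[OF fin(1)])
  also have "card U = (n + 1) ^ 3"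
    by (simp add: U_def card_cartesian_product power3_eq_cube mult.assoc del: mult_Suc mult_Suc_right)
  also have "\<dots> ^ K = (n + 1) ^ (3 * K)" by (simp only: power_mult)
  \<comment> \<open>Here \<open>n \<ge> 1\<close> enters; it turns the bound into a constant times a
    power of \<open>n\<close>.\<close>
  also have "\<dots> \<le> (2 * n) ^ (3 * K)" using n by (intro power_mono) auto
  finally have "card (run_starts ` {\<sigma> \<in> C. length \<sigma> = n}) \<le> (2 * n) ^ (3 * K)" .
  moreover have "inj_on run_starts {\<sigma> \<in> C. length \<sigma> = n}"
    by (rule inj_on_subset[OF inj_on_run_starts[of n]]) (use C in auto)
  ultimately have "class_count C n \<le> (2 * n) ^ (3 * K)" by (simp add: class_count_def card_image)
  then have "real (class_count C n) \<le> real ((2 * n) ^ (3 * K))" by (rule of_nat_mono)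
  then show "real (class_count C n) \<le> 2 ^ (3 * K) * real n ^ (3 * K)" by (simp add: power_mult_distrib)
qed

section \<open>Exponential lower bounds for the ten classes\<close>

lemma class_count_mono:
  assumes "X \<subseteq> C" "\<And>\<sigma>. \<sigma> \<in> C \<Longrightarrow> is_perm \<sigma>"
  shows "class_count X n \<le> class_count C n"
  unfolding class_count_def
  by (rule card_mono, rule finite_subset[OF _ finite_perms_length[of n]]) (use assms in auto)

lemma class_count_image:
  assumes "inj_on g X" "\<And>\<sigma>. length (g \<sigma>) = length \<sigma>"
  shows "class_count (g ` X) n = class_count X n"
proof -
  have "{\<sigma> \<in> g ` X. length \<sigma> = n} = g ` {\<sigma> \<in> X. length \<sigma> = n}" using assms(2) by auto
  then show ?thesis using assms(1) by (simp add: class_count_def card_image inj_on_subset)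
qed

definition signed_list :: "int \<Rightarrow> nat set \<Rightarrow> nat list" where
  "signed_list e S = (if e = 1 then sorted_list_of_set S else rev (sorted_list_of_set S))"

text \<open>A subset of 1, ..., n fills the first segment and its complement the second. Different
  subsets may give the same permutation, but the place of the cut, which is the cardinality of the
  subset, tells them apart; hence the factor \<open>n + 1\<close>.\<close>

lemma W_count:
  assumes e: "e1 \<in> {1, -1}" "e2 \<in> {1, -1}"
  shows "2 ^ n \<le> (n + 1) * class_count (W [e1, e2]) n"
proof -
  let ?\<phi> = "\<lambda>S. (signed_list e1 S @ signed_list e2 ({1..n} - S), card S)"
  have sl: "set (signed_list e S) = S" "length (signed_list e S) = card S" "distinct (signed_list e S)"
    if "finite S" for e S
    using that by (auto simp: signed_list_def)
  have mono: "monotone_seg e (signed_list e S)" if "e \<in> {1, -1}" for e S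
    using that by (auto simp: monotone_seg_def signed_list_def sorted_wrt_rev)
  have fin: "finite S" if "S \<subseteq> {1..n}" for S using that finite_subset by blast
  have card: "card S + card ({1..n} - S) = n" if "S \<subseteq> {1..n}" for S
    using card_mono[OF finite_atLeastAtMost that] card_Diff_subset[OF fin[OF that] that] by simp
  have "card (Pow {1..n}) \<le> card ({\<sigma> \<in> W [e1, e2]. length \<sigma> = n} \<times> {..n})"
  proof (rule card_inj_on_le)
    show "inj_on ?\<phi> (Pow {1..n})"
    proof (rule inj_onI)
      fix S T assume S: "S \<in> Pow {1..n}" "T \<in> Pow {1..n}" and eq: "?\<phi> S = ?\<phi> T"
      have "set (take (card R) (signed_list e1 R @ signed_list e2 ({1..n} - R))) = R" if "R \<subseteq> {1..n}" for R
        using sl[OF fin[OF that], of e1] by simp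
      then show "S = T" using S eq by (metis PowD prod.inject)
    qed
    show "?\<phi> ` Pow {1..n} \<subseteq> {\<sigma> \<in> W [e1, e2]. length \<sigma> = n} \<times> {..n}"
    proof (rule image_subsetI)
      fix S assume "S \<in> Pow {1..n}"
      then have S: "S \<subseteq> {1..n}" by simp
      let ?\<sigma> = "signed_list e1 S @ signed_list e2 ({1..n} - S)"
      have len: "length ?\<sigma> = n" using sl[OF fin[OF S]] sl[of "{1..n} - S"] card[OF S] by simp
      have "is_perm ?\<sigma>"
        unfolding is_perm_iff len using sl[OF fin[OF S]] sl[of "{1..n} - S"] S by auto
      moreover have "concat [signed_list e1 S, signed_list e2 ({1..n} - S)] = ?\<sigma> \<and>
          list_all2 monotone_seg [e1, e2] [signed_list e1 S, signed_list e2 ({1..n} - S)]"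
        using mono e by simp
      ultimately have "?\<sigma> \<in> W [e1, e2]" unfolding W_def by blast
      then show "?\<phi> S \<in> {\<sigma> \<in> W [e1, e2]. length \<sigma> = n} \<times> {..n}" using len card[OF S] by simp
    qed
    show "finite ({\<sigma> \<in> W [e1, e2]. length \<sigma> = n} \<times> {..n})"
      by (rule finite_cartesian_product, rule finite_subset[OF _ finite_perms_length[of n]])
        (auto simp: is_perm_W)
  qed
  then show ?thesis by (simp add: card_Pow card_cartesian_product class_count_def mult.commute)
qed

text \<open>Putting either a doubleton or two singletons on top doubles the number of permutations
  with every two additional entries.\<close>

lemma L2R_count: "2 ^ k \<le> class_count L2R (2 * k)"
proof (induction k)
  case 0
  have "{\<sigma> \<in> L2R. length \<sigma> = 0} = {[]}" using L2R_Nil by auto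
  then show ?case by (simp add: class_count_def)
next
  case (Suc k)
  let ?n = "2 * k"
  let ?A = "{\<sigma> \<in> L2R. length \<sigma> = ?n}"
  let ?f = "\<lambda>\<sigma>. [?n + 1, ?n + 2] @ \<sigma>" and ?g = "\<lambda>\<sigma>. [?n + 2, ?n + 1] @ \<sigma>"
  have finA: "finite ?A"
    by (rule finite_subset[OF _ finite_perms_length[of ?n]]) (auto simp: is_perm_L2R)
  have "?g \<sigma> \<in> L2R" if "\<sigma> \<in> ?A" for \<sigma>
    using L2R_single[OF L2R_single[of \<sigma>]] that by simp
  moreover have "?f \<sigma> \<in> L2R" if "\<sigma> \<in> ?A" for \<sigma>
    using L2R_double[of \<sigma>] that by simp
  ultimately have "?f ` ?A \<union> ?g ` ?A \<subseteq> {\<sigma> \<in> L2R. length \<sigma> = 2 * Suc k}" by auto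
  moreover have "finite {\<sigma> \<in> L2R. length \<sigma> = 2 * Suc k}"
    by (rule finite_subset[OF _ finite_perms_length[of "2 * Suc k"]]) (auto simp: is_perm_L2R)
  ultimately have "card (?f ` ?A \<union> ?g ` ?A) \<le> class_count L2R (2 * Suc k)"
    unfolding class_count_def by (rule card_mono[rotated])
  moreover have "card (?f ` ?A \<union> ?g ` ?A) = card ?A + card ?A"
  proof -
    have "card (?f ` ?A) = card ?A" "card (?g ` ?A) = card ?A"
      by (auto intro!: card_image inj_onI)
    moreover have "?f ` ?A \<inter> ?g ` ?A = {}" by auto
    ultimately show ?thesis using finA by (simp add: card_Un_disjoint)
  qed
  ultimately show ?case using Suc by (simp add: class_count_def)
qed

text \<open>Even lengths and the factor \<open>2 * k + 1\<close> are the common denominator of the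
  two counts above.\<close>

lemma growth_class_count:
  assumes "X \<in> growth_classes"
  shows "2 ^ k \<le> (2 * k + 1) * class_count X (2 * k)"
proof -
  have W: "2 ^ k \<le> (2 * k + 1) * class_count (W [e1, e2]) (2 * k)" if "e1 \<in> {1, -1}" "e2 \<in> {1, -1}" for e1 e2
  proof -
    have "(2::nat) ^ k \<le> 2 ^ (2 * k)" by (rule power_increasing) auto
    then show ?thesis using W_count[OF that, of "2 * k"] by (meson order_trans)
  qed
  have L: "2 ^ k \<le> (2 * k + 1) * class_count L2R (2 * k)"
    using L2R_count[of k] by (rule order_trans) simp
  from assms show ?thesis
  proof (cases rule: growth_classes_cases)
    case (inverse e1 e2)
    have "inj_on perm_inverse (W [e1, e2])"
      by (rule inj_on_inverseI[of _ perm_inverse]) (simp add: perm_inverse_involution is_perm_W)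
    then show ?thesis using W[OF inverse(1,2)] by (simp add: inverse(3) class_inverse_def class_count_image)
  next
    case rev then show ?thesis using L by (simp add: class_count_image)
  qed (use W L in auto)
qed

lemma growth_class_superpolynomial:
  assumes "X \<in> growth_classes" "X \<subseteq> C" "\<And>\<sigma>. \<sigma> \<in> C \<Longrightarrow> is_perm \<sigma>"
  shows "\<not> polynomial_growth C"
proof
  assume "polynomial_growth C"
  then obtain A :: real and d where A: "\<And>n. n \<ge> 1 \<Longrightarrow> real (class_count C n) \<le> A * real n ^ d"
    unfolding polynomial_growth_def by blast
  \<comment> \<open>The 3 comes from \<open>2 * k + 1 \<le> 3 * k\<close>, the power of two from
    \<open>(2 * k) ^ d\<close>; the absolute value guards against a negative
    \<open>A\<close>.\<close>
  define a where "a = \<bar>A\<bar> * 3 * 2 ^ d"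
  have bound: "2 ^ k \<le> a * real k ^ (d + 1)" if "k \<ge> 1" for k
  proof -
    have "real (2 ^ k) \<le> real ((2 * k + 1) * class_count X (2 * k))"
      using growth_class_count[OF assms(1), of k] by (rule of_nat_mono)
    also have "\<dots> \<le> (2 * real k + 1) * real (class_count C (2 * k))"
      unfolding of_nat_mult using class_count_mono[OF assms(2,3), of "2 * k"] by (intro mult_mono) auto
    also have "\<dots> \<le> (3 * real k) * (\<bar>A\<bar> * real (2 * k) ^ d)"
    proof (rule mult_mono)
      have "real (class_count C (2 * k)) \<le> A * real (2 * k) ^ d" using A[of "2 * k"] that by simp
      also have "\<dots> \<le> \<bar>A\<bar> * real (2 * k) ^ d" by (rule mult_right_mono) auto
      finally show "real (class_count C (2 * k)) \<le> \<bar>A\<bar> * real (2 * k) ^ d" .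
    qed (use that in auto)
    also have "\<dots> = a * real k ^ (d + 1)" by (simp add: a_def power_mult_distrib algebra_simps)
    finally show ?thesis by simp
  qed
  \<comment> \<open>A power divided by the exponential tends to 0; this is used along the points
    \<open>ln 2 * real k\<close>, and the power of \<open>ln 2\<close> is a constant factor.\<close>
  have "((\<lambda>k. real k ^ (d + 1) / exp (ln 2 * real k)) \<longlongrightarrow> 0) sequentially"
  proof -
    have "((\<lambda>x. x ^ (d + 1) / exp x) \<longlongrightarrow> (0::real)) at_top" by (rule tendsto_power_div_exp_0)
    moreover have "filterlim (\<lambda>k. ln 2 * real k) at_top sequentially"
      by (rule filterlim_tendsto_pos_mult_at_top[OF tendsto_const _ filterlim_real_sequentially]) simp
    ultimately have "((\<lambda>k. (ln 2 * real k) ^ (d + 1) / exp (ln 2 * real k)) \<longlongrightarrow> 0) sequentially"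
      by (rule filterlim_compose)
    then have "((\<lambda>k. (1 / ln 2 ^ (d + 1)) * ((ln 2 * real k) ^ (d + 1) / exp (ln 2 * real k))) \<longlongrightarrow>
        (1 / ln 2 ^ (d + 1)) * 0) sequentially"
      by (rule tendsto_mult_left)
    then show ?thesis by (simp add: power_mult_distrib)
  qed
  then have "((\<lambda>k. a * (real k ^ (d + 1) / exp (ln 2 * real k))) \<longlongrightarrow> a * 0) sequentially"
    by (rule tendsto_mult_left)
  then have "eventually (\<lambda>k. a * (real k ^ (d + 1) / exp (ln 2 * real k)) < 1) sequentially"
    by (rule order_tendstoD(2)) simp
  then obtain k where k: "k \<ge> 1" "a * (real k ^ (d + 1) / exp (ln 2 * real k)) < 1"
    using eventually_conj[OF eventually_ge_at_top[of 1]] eventually_happens' trivial_limit_sequentially by blast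
  moreover have "exp (ln 2 * real k) = 2 ^ k" by (simp add: exp_of_nat2_mult)
  ultimately have "a * real k ^ (d + 1) < 2 ^ k" by (simp add: field_simps)
  then show False using bound[OF k(1)] by simp
qed

lemma finite_growth_classes: "finite growth_classes"
  by (simp add: growth_classes_def)

text \<open>For sufficiency one member of \<open>P\<close> is chosen from each of the finitely many
  classes. The greatest of their lengths, \<open>N\<close>, says how large a configuration the
  breaks have to produce.\<close>

theorem polynomial_growth_Av_iff:
  assumes "\<And>\<pi>. \<pi> \<in> P \<Longrightarrow> is_perm \<pi>"
  shows "polynomial_growth (Av P) \<longleftrightarrow> (\<forall>X\<in>growth_classes. X \<inter> P \<noteq> {})"
proof
  assume pg: "polynomial_growth (Av P)"
  show "\<forall>X\<in>growth_classes. X \<inter> P \<noteq> {}"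
  proof (intro ballI notI)
    fix X assume X: "X \<in> growth_classes" "X \<inter> P = {}"
    have "X \<subseteq> Av P"
    proof
      fix \<sigma> assume \<sigma>: "\<sigma> \<in> X"
      have "\<not> \<pi> \<preceq> \<sigma>" if "\<pi> \<in> P" for \<pi>
        using growth_classes_closed[OF X(1) \<sigma> assms[OF that]] that X(2) by blast
      then show "\<sigma> \<in> Av P" using is_perm_growth_classes[OF X(1) \<sigma>] by (simp add: Av_def)
    qed
    then show False using growth_class_superpolynomial[OF X(1)] pg by (auto simp: Av_def)
  qed
next
  assume meets: "\<forall>X\<in>growth_classes. X \<inter> P \<noteq> {}"
  then have "\<forall>X\<in>growth_classes. \<exists>\<pi>. \<pi> \<in> X \<inter> P" by blast
  then obtain f where f: "\<forall>X\<in>growth_classes. f X \<in> X \<inter> P" by (rule bchoice[THEN exE])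
  define N where "N = Max (length ` f ` growth_classes)"
  have N: "length (f X) \<le> N" if "X \<in> growth_classes" for X
    unfolding N_def using that finite_growth_classes by simp
  obtain K where K: "\<forall>\<sigma>. is_perm \<sigma> \<longrightarrow> K \<le> card (breaks \<sigma>) \<longrightarrow>
     (\<exists>X\<in>growth_classes. \<forall>\<pi>\<in>X. length \<pi> \<le> N \<longrightarrow> \<pi> \<preceq> \<sigma>)"
    using many_breaks[of N] by (rule exE)
  show "polynomial_growth (Av P)"
  proof (rule few_breaks_polynomial_growth)
    fix \<sigma> assume \<sigma>: "\<sigma> \<in> Av P"
    have "card (breaks \<sigma>) < K"
    proof (rule ccontr)
      assume "\<not> card (breaks \<sigma>) < K"
      then obtain X where "X \<in> growth_classes" "\<forall>\<pi>\<in>X. length \<pi> \<le> N \<longrightarrow> \<pi> \<preceq> \<sigma>"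
        using K \<sigma> unfolding Av_def by (metis (mono_tags, lifting) linorder_not_less mem_Collect_eq)
      then show False using f N \<sigma> unfolding Av_def by blast
    qed
    then show "is_perm \<sigma> \<and> card (breaks \<sigma>) < K" using \<sigma> by (simp add: Av_def)
  qed
qed

section \<open>Members of the ten classes\<close>

text \<open>A step against the first sign forces the cut to be at most \<open>i + 1\<close>, so
  every later step follows the second sign. Non-membership is proved below by exhibiting two steps
  that violate this.\<close>

lemma W_switch:
  assumes e: "e1 \<in> {1, -1}" "e2 \<in> {1, -1}" and "\<sigma> \<in> W [e1, e2]"
    and "i < j" "j + 1 < length \<sigma>" "\<not> e1 * int (\<sigma> ! i) < e1 * int (\<sigma> ! (i + 1))"
  shows "e2 * int (\<sigma> ! j) < e2 * int (\<sigma> ! (j + 1))"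
proof -
  obtain k where k:
     "\<And>i j. i < j \<Longrightarrow> j < k \<Longrightarrow> e1 * int (\<sigma> ! i) < e1 * int (\<sigma> ! j)"
     "\<And>i j. k \<le> i \<Longrightarrow> i < j \<Longrightarrow> j < length \<sigma> \<Longrightarrow> e2 * int (\<sigma> ! i) < e2 * int (\<sigma> ! j)"
    using assms(3) unfolding W_iff[OF e] by blast
  have "k \<le> i + 1" using k(1)[of i "i + 1"] assms(6) by (meson less_add_one linorder_not_less)
  then show ?thesis using k(2)[of j "j + 1"] assms(4,5) by simp
qed

lemma monotone_in_W:
  assumes "is_perm \<sigma>" and e: "e \<in> {1, -1}" "e' \<in> {1, -1}"
    and mono: "\<And>i j. i < j \<Longrightarrow> j < length \<sigma> \<Longrightarrow> e * int (\<sigma> ! i) < e * int (\<sigma> ! j)"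
  shows "\<sigma> \<in> W [e, e']" "\<sigma> \<in> W [e', e]"
    "\<sigma> \<in> class_inverse (W [e, e'])" "\<sigma> \<in> class_inverse (W [e', e])"
proof -
  have b: "0 < \<sigma> ! i \<and> \<sigma> ! i \<le> length \<sigma>" if "i < length \<sigma>" for i
    using is_perm_nth_bounds[OF assms(1) that] by simp
  show "\<sigma> \<in> W [e, e']"
    unfolding W_iff[OF e] using assms(1) mono by (auto intro!: exI[of _ "length \<sigma>"])
  show "\<sigma> \<in> W [e', e]"
    unfolding W_iff[OF e(2,1)] using assms(1) mono by (auto intro!: exI[of _ 0])
  show "\<sigma> \<in> class_inverse (W [e, e'])"
    unfolding inverse_W_iff[OF e]
  proof (intro conjI exI[of _ "length \<sigma>"] allI impI, goal_cases)
    case (4 i j) then show ?case using b[of j] by simp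
  qed (use assms(1) mono in auto)
  show "\<sigma> \<in> class_inverse (W [e', e])"
    unfolding inverse_W_iff[OF e(2,1)]
  proof (intro conjI exI[of _ 0] allI impI, goal_cases)
    case (3 i j) then show ?case using b[of j] by simp
  qed (use assms(1) mono in auto)
qed

text \<open>The first comparison decides. In one of the two classes it goes against the first sign,
  and there all later steps have to follow the second sign, which is its own direction.\<close>

lemma up_down_up_monotone:
  assumes "\<sigma> \<in> W [1, -1]" "\<sigma> \<in> W [-1, 1]"
  shows "sorted_wrt (<) \<sigma> \<or> sorted_wrt (>) \<sigma>"
proof -
  have p: "is_perm \<sigma>" using assms(1) by (rule is_perm_W)
  have neq: "\<sigma> ! i \<noteq> \<sigma> ! j" if "i < j" "j < length \<sigma>" for i j
    using is_perm_nth_eq_iff[OF p, of i j] that by simp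
  have ud: "\<sigma> ! (j + 1) < \<sigma> ! j" if "i < j" "j + 1 < length \<sigma>" "\<sigma> ! (i + 1) < \<sigma> ! i" for i j
    using W_switch[OF _ _ assms(1) that(1,2)] that(3) by simp
  have du: "\<sigma> ! j < \<sigma> ! (j + 1)" if "i < j" "j + 1 < length \<sigma>" "\<sigma> ! i < \<sigma> ! (i + 1)" for i j
    using W_switch[OF _ _ assms(2) that(1,2)] that(3) by simp
  show ?thesis
  proof (cases "\<sigma> ! 0 < \<sigma> ! 1")
    case True
    have "\<sigma> ! i < \<sigma> ! Suc i" if "Suc i < length \<sigma>" for i
      using du[of 0 i] True that by (cases "i = 0") auto
    then show ?thesis by (auto simp: sorted_wrt_iff_nth_Suc_transp)
  next
    case False
    have "\<sigma> ! Suc i < \<sigma> ! i" if "Suc i < length \<sigma>" for i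
    proof (cases "i = 0")
      case True
      then have "\<sigma> ! 0 \<noteq> \<sigma> ! 1" using neq[of 0 1] that by simp
      then show ?thesis using False True by simp
    next
      case i: False
      then have "\<sigma> ! 0 \<noteq> \<sigma> ! 1" using neq[of 0 1] that by simp
      then have "\<sigma> ! 1 < \<sigma> ! 0" using False by simp
      then show ?thesis using ud[of 0 i] i that by simp
    qed
    then show ?thesis by (auto simp: sorted_wrt_iff_nth_Suc_transp)
  qed
qed

text \<open>For \<open>1 \<le> j < m\<close> this is the decreasing permutation of length
  \<open>m\<close> with a single layer of size two, holding the values \<open>j\<close> and
  \<open>j + 1\<close> at the 0-based positions \<open>m - 1 - j\<close> and
  \<open>m - j\<close>.\<close>

definition one_double :: "nat \<Rightarrow> nat \<Rightarrow> nat list" where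
  "one_double m j = rev [j+2..<m+1] @ [j, j+1] @ rev [1..<j]"

lemma length_one_double: "1 \<le> j \<Longrightarrow> j < m \<Longrightarrow> length (one_double m j) = m"
  by (simp add: one_double_def del: upt_Suc; linarith)

lemma nth_one_double:
  assumes "1 \<le> j" "j < m" "i < m"
  shows "one_double m j ! i = (if i + 1 + j = m then j else if i + j = m then j + 1 else m - i)"
proof -
  consider "i < m - 1 - j" | "i = m - 1 - j" | "i = m - j" | "m - j < i" using assms by linarith
  then show ?thesis
  proof cases
    case 1
    then have "one_double m j ! i = rev [j+2..<m+1] ! i"
      unfolding one_double_def by (subst nth_append) (simp del: upt_Suc)
    also have "\<dots> = m - i" using 1 assms by (simp add: rev_nth del: upt_Suc)
    finally show ?thesis using 1 by auto
  next
    case 2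
    then show ?thesis using assms unfolding one_double_def by (subst nth_append) (auto simp del: upt_Suc)
  next
    case 3
    then have "i - (m - 1 - j) = 1" using assms by simp
    then show ?thesis using 3 assms unfolding one_double_def by (subst nth_append) (auto simp del: upt_Suc)
  next
    case 4
    then obtain d where d: "i = m - j + 1 + d" by (metis add.assoc add.commute Suc_eq_plus1 less_imp_Suc_add)
    then have "i - (m - 1 - j) = d + 2" "d < j - 1" using assms by auto
    then have "one_double m j ! i = rev [1..<j] ! d"
      using 4 unfolding one_double_def by (subst nth_append) (auto simp del: upt_Suc)
    also have "\<dots> = m - i" using \<open>d < j - 1\<close> d assms by (simp add: rev_nth del: upt_Suc)
    finally show ?thesis using 4 by auto
  qed
qed

lemma nth_one_double_pair:
  assumes "1 \<le> j" "j < m"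
  shows "one_double m j ! (m - 1 - j) = j" "one_double m j ! (m - j) = j + 1"
proof -
  have "m - 1 - j < m" "m - j < m" "m - 1 - j + 1 + j = m" "m - j + 1 + j \<noteq> m" "m - j + j = m"
    using assms by linarith+
  then show "one_double m j ! (m - 1 - j) = j" "one_double m j ! (m - j) = j + 1"
    using nth_one_double[OF assms] by presburger+
qed

lemma one_double_L2R:
  assumes "1 \<le> j" "j < m" shows "one_double m j \<in> L2R"
  unfolding L2R_iff
proof
  show "is_perm (one_double m j)"
    by (rule is_permI) (use assms in \<open>auto simp: length_one_double nth_one_double split: if_splits\<close>)
  show "noninv_adjacent (one_double m j)"
    unfolding noninv_adjacent_def
    using assms by (auto simp: length_one_double nth_one_double split: if_splits)
qed

text \<open>Transposing moves the doubleton from \<open>j\<close> to \<open>m - j\<close>, so every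
  question about the inverse classes becomes one about the classes W.\<close>

lemma inverse_one_double:
  assumes "1 \<le> j" "j < m" shows "perm_inverse (one_double m j) = one_double m (m - j)"
proof (rule perm_inverse_eqI)
  fix i assume "i < length (one_double m j)"
  then have i: "i < m" using assms by (simp add: length_one_double)
  consider "i + 1 + j = m" | "i + j = m" | "i + 1 + j \<noteq> m" "i + j \<noteq> m" by blast
  then show "one_double m (m - j) ! (one_double m j ! i - 1) = i + 1"
    by cases (use assms i in \<open>auto simp: nth_one_double\<close>)
qed (use assms is_perm_L2R[OF one_double_L2R[OF assms]] in \<open>auto simp: length_one_double\<close>)

lemma complement_one_double:
  assumes "1 \<le> j" "j < m" shows "perm_complement (one_double m j) = rev (one_double m (m - j))"
proof (rule nth_equalityI)
  fix i assume "i < length (perm_complement (one_double m j))"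
  then have i: "i < m" using assms by (simp add: length_one_double)
  consider "i + 1 + j = m" | "i + j = m" | "i + 1 + j \<noteq> m" "i + j \<noteq> m" by blast
  then show "perm_complement (one_double m j) ! i = rev (one_double m (m - j)) ! i"
    by cases (use assms i in \<open>auto simp: nth_perm_complement rev_nth length_one_double nth_one_double\<close>)
qed (use assms in \<open>auto simp: length_one_double\<close>)

text \<open>The cut falls inside the doubleton, which is the only ascent.\<close>

lemma one_double_W:
  assumes "1 \<le> j" "j < m"
  shows "one_double m j \<in> W [-1, -1]" "one_double m j \<in> class_inverse (W [-1, -1])"
proof -
  have *: "one_double m l \<in> W [-1, -1]" if l: "1 \<le> l" "l < m" for l
    by (subst W_iff) (use l is_perm_L2R[OF one_double_L2R[OF l]] in
      \<open>auto simp: length_one_double nth_one_double intro!: exI[of _ "m - l"]\<close>)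
  show "one_double m j \<in> W [-1, -1]" using *[OF assms] .
  show "one_double m j \<in> class_inverse (W [-1, -1])"
    using *[of "m - j"] assms is_perm_L2R[OF one_double_L2R[OF assms]]
    by (simp add: class_inverse_W_iff inverse_one_double)
qed

text \<open>With the doubleton at the end the entries fall and then rise once; the inverse has the
  doubleton in front, rises once and then falls.\<close>

lemma one_double_first_W:
  assumes "2 \<le> m"
  shows "one_double m 1 \<in> W [-1, 1]" "one_double m 1 \<in> class_inverse (W [1, -1])"
proof -
  have l: "1 \<le> (1::nat)" "1 < m" "1 \<le> m - 1" "m - 1 < m" using assms by auto
  show "one_double m 1 \<in> W [-1, 1]"
    by (subst W_iff) (use l(1,2) is_perm_L2R[OF one_double_L2R[OF l(1,2)]] in
      \<open>auto simp: length_one_double nth_one_double intro!: exI[of _ "m - 1"]\<close>)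
  have "one_double m (m - 1) \<in> W [1, -1]"
    by (subst W_iff) (use l(3,4) is_perm_L2R[OF one_double_L2R[OF l(3,4)]] in
      \<open>auto simp: length_one_double nth_one_double intro!: exI[of _ 1]\<close>)
  then show "one_double m 1 \<in> class_inverse (W [1, -1])"
    using l is_perm_L2R[OF one_double_L2R[OF l(1,2)]] by (simp add: class_inverse_W_iff inverse_one_double)
qed

text \<open>Unless the doubleton comes first, a descent precedes its ascent.\<close>

lemma one_double_up_down:
  assumes "1 \<le> j" "j < m" "one_double m j \<in> W [1, -1]" shows "j = m - 1"
proof (rule ccontr)
  assume "j \<noteq> m - 1"
  then have j: "j + 1 < m" using assms(2) by simp
  have "one_double m j ! 0 = m" "one_double m j ! 1 < m" using assms(1) j by (auto simp: nth_one_double)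
  moreover have "0 < m - 1 - j" "m - 1 - j + 1 < m" using assms(1) j by auto
  ultimately have "one_double m j ! (m - 1 - j + 1) < one_double m j ! (m - 1 - j)"
    using W_switch[OF _ _ assms(3), of 0 "m - 1 - j"] assms(1,2) by (simp add: length_one_double)
  moreover have "m - 1 - j + 1 = m - j" using j by simp
  ultimately show False using nth_one_double_pair[OF assms(1,2)] by simp
qed

lemma one_double_down_up:
  assumes "1 \<le> j" "j < m" "one_double m j \<in> W [-1, 1]" shows "j = 1"
proof (rule ccontr)
  assume "j \<noteq> 1"
  then have j: "2 \<le> j" using assms(1) by simp
  have "m - 1 - j < m - j" "m - j + 1 < m" "m - 1 - j + 1 = m - j" using assms(2) j by auto
  then have "one_double m j ! (m - j) < one_double m j ! (m - j + 1)"
    using W_switch[OF _ _ assms(3), of "m - 1 - j" "m - j"] nth_one_double_pair[OF assms(1,2)] assms(1,2)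
    by (simp add: length_one_double)
  moreover have "one_double m j ! (m - j + 1) = j - 1"
    using nth_one_double[OF assms(1,2) \<open>m - j + 1 < m\<close>] assms(2) j by simp
  ultimately show False using nth_one_double_pair[OF assms(1,2)] by simp
qed

lemma one_double_inverse_up_down:
  assumes "1 \<le> j" "j < m" "one_double m j \<in> class_inverse (W [1, -1])" shows "j = 1"
proof -
  have "1 \<le> m - j" "m - j < m" using assms(1,2) by linarith+
  moreover have "one_double m (m - j) \<in> W [1, -1]"
    using assms by (simp add: class_inverse_W_iff inverse_one_double)
  ultimately have "m - j = m - 1" by (rule one_double_up_down)
  then show ?thesis using assms(1,2) by linarith
qed

lemma one_double_inverse_down_up:
  assumes "1 \<le> j" "j < m" "one_double m j \<in> class_inverse (W [-1, 1])" shows "j = m - 1"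
proof -
  have "1 \<le> m - j" "m - j < m" using assms(1,2) by linarith+
  moreover have "one_double m (m - j) \<in> W [-1, 1]"
    using assms by (simp add: class_inverse_W_iff inverse_one_double)
  ultimately have "m - j = 1" by (rule one_double_down_up)
  then show ?thesis using assms(1,2) by linarith
qed

text \<open>From length 4 on there are two descents, one more than two increasing segments allow,
  whereas 312 has only one. This is why 213 is singled out in the classification.\<close>

lemma one_double_first_not_up_up:
  assumes "4 \<le> m"
  shows "one_double m 1 \<notin> W [1, 1]" "one_double m 1 \<notin> class_inverse (W [1, 1])"
proof -
  show "one_double m 1 \<notin> W [1, 1]"
  proof
    assume "one_double m 1 \<in> W [1, 1]"
    from W_switch[OF _ _ this, of 0 1] show False
      using assms by (auto simp: length_one_double nth_one_double split: if_splits)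
  qed
  have "one_double m (m - 1) \<notin> W [1, 1]"
  proof
    assume "one_double m (m - 1) \<in> W [1, 1]"
    from W_switch[OF _ _ this, of 1 2] show False
      using assms by (auto simp: length_one_double nth_one_double split: if_splits)
  qed
  then show "one_double m 1 \<notin> class_inverse (W [1, 1])"
    using assms by (simp add: class_inverse_W_iff inverse_one_double)
qed

lemma contains_Cons: "\<pi> \<preceq> \<sigma> \<Longrightarrow> \<pi> \<preceq> a # \<sigma>"
  unfolding contains_pat_def by (meson list_emb_Cons)

lemma two_doubles_contain_3412: "subseq [j, j + 1] \<rho> \<Longrightarrow> j + 1 \<le> n \<Longrightarrow> [3, 4, 1, 2] \<preceq> [n + 1, n + 2] @ \<rho>"
  unfolding contains_pat_def
proof (intro exI[of _ "[n + 1, n + 2] @ [j, j + 1]"] conjI)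
  assume "subseq [j, j + 1] \<rho>"
  then show "subseq ([n + 1, n + 2] @ [j, j + 1]) ([n + 1, n + 2] @ \<rho>)" by simp
  assume "j + 1 \<le> n"
  then show "order_iso [3, 4, 1, 2] ([n + 1, n + 2] @ [j, j + 1])"
    unfolding order_iso_def by (simp add: less_Suc_eq numeral_eq_Suc) auto
qed

text \<open>Layers are added on top: the first doubleton yields \<open>one_double\<close>, and a
  second one completes 3412 together with the doubleton already present.\<close>

lemma L2R_shape:
  assumes "\<sigma> \<in> L2R"
  obtains "[3, 4, 1, 2] \<preceq> \<sigma>" | "\<sigma> = rev [1..<length \<sigma> + 1]"
  | j where "1 \<le> j" "j < length \<sigma>" "\<sigma> = one_double (length \<sigma>) j"
proof -
  have "[3, 4, 1, 2] \<preceq> \<sigma> \<or> \<sigma> = rev [1..<length \<sigma> + 1] \<or>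
    (\<exists>j. 1 \<le> j \<and> j < length \<sigma> \<and> \<sigma> = one_double (length \<sigma>) j)"
    using assms
  proof (induction rule: L2R_induct)
    case Nil then show ?case by simp
  next
    case (single \<sigma>)
    let ?n = "length \<sigma>"
    from single(2) consider "[3, 4, 1, 2] \<preceq> \<sigma>" | "\<sigma> = rev [1..<?n + 1]"
      | j where "1 \<le> j" "j < ?n" "\<sigma> = one_double ?n j" by blast
    then show ?case
    proof cases
      case 1 then show ?thesis by (simp add: contains_Cons)
    next
      case 2
      then have "(?n + 1) # \<sigma> = (?n + 1) # rev [1..<?n + 1]" by simp
      also have "\<dots> = rev [1..<length ((?n + 1) # \<sigma>) + 1]" by simp
      finally show ?thesis by blast
    next
      case 3
      then have "(?n + 1) # \<sigma> = (?n + 1) # one_double ?n j" by simp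
      also have "\<dots> = one_double (length ((?n + 1) # \<sigma>)) j" using 3 by (simp add: one_double_def)
      finally have "(?n + 1) # \<sigma> = one_double (length ((?n + 1) # \<sigma>)) j" .
      moreover have "j < length ((?n + 1) # \<sigma>)" using 3(2) by simp
      ultimately show ?thesis using 3(1) by blast
    qed
  next
    case (double \<sigma>)
    let ?n = "length \<sigma>"
    from double(2) consider "[3, 4, 1, 2] \<preceq> \<sigma>" | "\<sigma> = rev [1..<?n + 1]"
      | j where "1 \<le> j" "j < ?n" "\<sigma> = one_double ?n j" by blast
    then show ?case
    proof cases
      case 1 then show ?thesis by (simp add: contains_Cons)
    next
      case 2
      then have "[?n + 1, ?n + 2] @ \<sigma> = [?n + 1, ?n + 2] @ rev [1..<?n + 1]" by simp
      also have "\<dots> = one_double (length ([?n + 1, ?n + 2] @ \<sigma>)) (?n + 1)" by (simp add: one_double_def)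
      finally have "[?n + 1, ?n + 2] @ \<sigma> = one_double (length ([?n + 1, ?n + 2] @ \<sigma>)) (?n + 1)" .
      moreover have "1 \<le> ?n + 1" "?n + 1 < length ([?n + 1, ?n + 2] @ \<sigma>)" by simp_all
      ultimately show ?thesis by blast
    next
      case 3
      have "subseq [j, j + 1] (one_double ?n j)"
        unfolding one_double_def by (intro subseq_drop_many list_emb_prefix subseq_order.order_refl)
      then show ?thesis using two_doubles_contain_3412[of j \<sigma> ?n] 3 by simp
    qed
  qed
  then show thesis using that by blast
qed

text \<open>The pattern 3412 goes up, down, up and is its own inverse. These steps contradict a sign
  -1 in either place, and closure under patterns carries the conclusion to
  \<open>\<sigma>\<close>.\<close>

lemma not_W_3412:
  assumes "[3, 4, 1, 2] \<preceq> \<sigma>" "e1 \<in> {1, -1}" "e2 \<in> {1, -1}" "e1 = -1 \<or> e2 = -1"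
  shows "\<sigma> \<notin> W [e1, e2]" "\<sigma> \<notin> class_inverse (W [e1, e2])"
proof -
  let ?\<pi> = "[3, 4, 1, 2] :: nat list"
  have p: "is_perm ?\<pi>" by (auto simp: is_perm_iff)
  have inv: "perm_inverse ?\<pi> = ?\<pi>"
    by (rule perm_inverse_eqI[OF p]) (auto simp: less_Suc_eq numeral_eq_Suc)
  have W: "?\<pi> \<notin> W [e1, e2]"
  proof
    assume "?\<pi> \<in> W [e1, e2]"
    from W_switch[OF assms(2,3) this, of 0 1] W_switch[OF assms(2,3) this, of 1 2]
      W_switch[OF assms(2,3) this, of 0 2]
    show False using assms(2-4) by auto
  qed
  then have iW: "?\<pi> \<notin> class_inverse (W [e1, e2])" using inv by (simp add: class_inverse_W_iff)
  show "\<sigma> \<notin> W [e1, e2]"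
    using W growth_classes_closed[OF W_growth_classes(1)[OF assms(2,3)] _ p assms(1)] by blast
  show "\<sigma> \<notin> class_inverse (W [e1, e2])"
    using iW growth_classes_closed[OF W_growth_classes(2)[OF assms(2,3)] _ p assms(1)] by blast
qed

section \<open>Permutations of the form 1 2 ... k n (n-1) ... (k+1)\<close>

definition up_then_down :: "nat \<Rightarrow> nat \<Rightarrow> nat list" where
  "up_then_down n k = [1..<k+1] @ rev [k+1..<n+1]"

lemma length_up_then_down: "k \<le> n \<Longrightarrow> length (up_then_down n k) = n"
  by (simp add: up_then_down_def del: upt_Suc)

lemma nth_up_then_down:
  assumes "k \<le> n" "i < n"
  shows "up_then_down n k ! i = (if i < k then i + 1 else n + k - i)"
  using assms unfolding up_then_down_def
  by (subst nth_append) (auto simp: rev_nth simp del: upt_Suc)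

lemma is_perm_up_then_down:
  assumes "k \<le> n" shows "is_perm (up_then_down n k)"
  by (rule is_permI) (use assms in \<open>auto simp: length_up_then_down nth_up_then_down split: if_splits\<close>)

lemma up_then_down_W:
  assumes "k \<le> n"
  shows "up_then_down n k \<in> W [1, -1]" "up_then_down n k \<in> class_inverse (W [1, -1])"
proof -
  show "up_then_down n k \<in> W [1, -1]"
    by (subst W_iff) (use assms in \<open>auto simp: is_perm_up_then_down length_up_then_down nth_up_then_down
      intro!: exI[of _ k]\<close>)
  show "up_then_down n k \<in> class_inverse (W [1, -1])"
    by (subst inverse_W_iff) (use assms in \<open>auto simp: is_perm_up_then_down length_up_then_down nth_up_then_down
      split: if_splits intro!: exI[of _ k]\<close>)
qed

text \<open>The first segment is the single entry 1, which counts as decreasing.\<close>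

lemma up_then_down_first_W:
  assumes "1 \<le> n"
  shows "up_then_down n 1 \<in> W [-1, -1]" "up_then_down n 1 \<in> class_inverse (W [-1, -1])"
proof -
  show "up_then_down n 1 \<in> W [-1, -1]"
    by (subst W_iff) (use assms in \<open>auto simp: is_perm_up_then_down length_up_then_down nth_up_then_down
      intro!: exI[of _ 1]\<close>)
  show "up_then_down n 1 \<in> class_inverse (W [-1, -1])"
    by (subst inverse_W_iff) (use assms in \<open>auto simp: is_perm_up_then_down length_up_then_down nth_up_then_down
      split: if_splits intro!: exI[of _ 1]\<close>)
qed

text \<open>Take \<open>k\<close> as the length of the longest prefix of fixed points. A later
  ascent would begin in the rising segment while the value \<open>k + 1\<close> comes afterwards, in
  the falling one; the lower part of the value cut would then contain an inversion.\<close>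

lemma up_then_down_characterization:
  assumes "\<sigma> \<in> W [1, -1]" "\<sigma> \<in> class_inverse (W [1, -1])"
  shows "\<exists>k\<le>length \<sigma>. \<sigma> = up_then_down (length \<sigma>) k"
proof -
  let ?n = "length \<sigma>"
  have p: "is_perm \<sigma>" using assms(1) by (rule is_perm_W)
  have "(\<forall>l\<le>i. \<sigma> ! l = l + 1)" if "i < j" "j < ?n" "\<forall>l\<le>j. \<sigma> ! l = l + 1" for i j using that by simp
  then obtain k where k: "k \<le> ?n" "\<And>i. i < ?n \<Longrightarrow> (\<forall>l\<le>i. \<sigma> ! l = l + 1) \<longleftrightarrow> i < k"
    by (rule initial_segment_threshold) auto
  have pre: "\<sigma> ! i = i + 1" if "i < k" for i using k(1) k(2)[of i] that by auto
  have large: "k < \<sigma> ! i" if i: "k \<le> i" "i < ?n" for i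
  proof (rule ccontr)
    assume "\<not> k < \<sigma> ! i"
    then have "\<sigma> ! (\<sigma> ! i - 1) = \<sigma> ! i" "\<sigma> ! i - 1 < i"
      using pre[of "\<sigma> ! i - 1"] is_perm_nth_bounds[OF p i(2)] i by auto
    then show False using is_perm_nth_eq_iff[OF p, of "\<sigma> ! i - 1" i] i by auto
  qed
  have desc: "\<sigma> ! Suc i < \<sigma> ! i" if i: "k \<le> i" "Suc i < ?n" for i
  proof (rule ccontr)
    assume "\<not> \<sigma> ! Suc i < \<sigma> ! i"
    moreover have "\<sigma> ! i \<noteq> \<sigma> ! Suc i" using is_perm_nth_eq_iff[OF p, of i "Suc i"] i by simp
    ultimately have asc: "\<sigma> ! i < \<sigma> ! Suc i" by simp
    obtain c where c: "\<And>i j. i < j \<Longrightarrow> j < c \<Longrightarrow> \<sigma> ! i < \<sigma> ! j"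
      "\<And>i j. c \<le> i \<Longrightarrow> i < j \<Longrightarrow> j < ?n \<Longrightarrow> \<sigma> ! j < \<sigma> ! i"
      using assms(1) by (subst (asm) W_iff) (simp_all, blast)
    obtain v where v: "\<And>i j. i < j \<Longrightarrow> j < ?n \<Longrightarrow> \<sigma> ! i \<le> v \<Longrightarrow> \<sigma> ! j \<le> v \<Longrightarrow> \<sigma> ! i < \<sigma> ! j"
      "\<And>i j. i < j \<Longrightarrow> j < ?n \<Longrightarrow> v < \<sigma> ! i \<Longrightarrow> v < \<sigma> ! j \<Longrightarrow> \<sigma> ! j < \<sigma> ! i"
      using assms(2) by (subst (asm) inverse_W_iff) (simp_all, blast)
    have ic: "i < c" using c(2)[of i "Suc i"] asc i by (meson lessI linorder_not_less order_less_asym)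
    have "\<sigma> ! k \<noteq> k + 1"
    proof
      assume "\<sigma> ! k = k + 1"
      then have "\<forall>l\<le>k. \<sigma> ! l = l + 1" using pre by (metis le_neq_implies_less)
      then show False using k(2)[of k] i by simp
    qed
    then have k1: "k + 1 < \<sigma> ! k" using large[of k] i by simp
    obtain q where q: "q < ?n" "\<sigma> ! q = k + 1"
      using is_perm_obtain_index[OF p, of "k + 1"] i by auto
    have "q > k" using q pre[of q] k1 by (metis add_right_cancel linorder_neqE_nat order_less_irrefl)
    \<comment> \<open>Entries of the rising segment after position \<open>k\<close> exceed
      \<open>\<sigma> ! k\<close>, and hence \<open>k + 1\<close>.\<close>
    have "\<not> q < c" using c(1)[of k q] \<open>q > k\<close> k1 q by auto
    then have "i < q" using ic by simp
    moreover have "q \<noteq> Suc i" using q asc large[of i] i by auto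
    ultimately have "Suc i < q" by simp
    have qi: "\<sigma> ! q < \<sigma> ! i"
    proof -
      have "\<sigma> ! i \<noteq> \<sigma> ! q" using is_perm_nth_eq_iff[OF p, of i q] \<open>i < q\<close> q by simp
      then show ?thesis using large[of i] i q by simp
    qed
    \<comment> \<open>Values above \<open>v\<close> decrease, so the lower entry of the ascent at
      \<open>i\<close> is at most \<open>v\<close>; the entry at \<open>q\<close> is smaller
      still.\<close>
    have "\<sigma> ! i \<le> v" using v(2)[of i "Suc i"] asc i by (meson lessI linorder_not_less order_less_asym order_less_trans)
    then show False using v(1)[of i q] \<open>i < q\<close> q qi by simp
  qed
  \<comment> \<open>The rest decreases within the values \<open>k + 1\<close> to \<open>?n\<close>
    and is thereby determined: a lower bound counted from the right end and an upper bound counted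
    from \<open>k\<close> coincide.\<close>
  have suffix: "\<sigma> ! (?n - 1 - d) = k + 1 + d" if "k + d < ?n" for d
  proof -
    have dec: "\<sigma> ! j < \<sigma> ! i" if "k \<le> i" "i < j" "j < ?n" for i j
      using that(2,3)
    proof (induction j)
      case (Suc j)
      then show ?case using desc[of j] that(1) by (cases "i = j") (auto intro: less_trans)
    qed simp
    have lower: "k + 1 + d \<le> \<sigma> ! (?n - 1 - d)" if "k + d < ?n" for d
      using that
    proof (induction d)
      case 0
      then have "k \<le> ?n - 1" "?n - 1 < ?n" by linarith+
      then show ?case using large[of "?n - 1"] by simp
    next
      case (Suc d)
      have "\<sigma> ! (?n - 1 - d) < \<sigma> ! (?n - 1 - Suc d)" using Suc.prems by (intro dec) auto
      then show ?case using Suc by simp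
    qed
    have upper: "\<sigma> ! (k + d) + d \<le> ?n" if "k + d < ?n" for d
      using that
    proof (induction d)
      case 0 then show ?case using is_perm_nth_bounds(2)[OF p, of k] by simp
    next
      case (Suc d)
      have "\<sigma> ! (k + Suc d) < \<sigma> ! (k + d)" using Suc.prems by (intro dec) auto
      then show ?case using Suc by simp
    qed
    define c where "c = ?n - 1 - d - k"
    have c: "k + c = ?n - 1 - d" "k + c < ?n" using that by (simp_all add: c_def)
    have "\<sigma> ! (?n - 1 - d) + c \<le> ?n" using upper[OF c(2)] unfolding c(1) .
    then show ?thesis using lower[OF that] c that by linarith
  qed
  have "\<sigma> = up_then_down ?n k"
  proof (rule nth_equalityI)
    fix i assume i: "i < ?n"
    show "\<sigma> ! i = up_then_down ?n k ! i"
    proof (cases "i < k")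
      case False
      then have d: "k + (?n - 1 - i) < ?n" "?n - 1 - (?n - 1 - i) = i" using i by linarith+
      have "\<sigma> ! i = k + 1 + (?n - 1 - i)" using suffix[OF d(1)] unfolding d(2) .
      then have "\<sigma> ! i = ?n + k - i" using i False by linarith
      then show ?thesis using nth_up_then_down[OF k(1) i] False by simp
    qed (use i k(1) pre in \<open>simp add: nth_up_then_down\<close>)
  qed (simp add: length_up_then_down k(1))
  then show ?thesis using k(1) by blast
qed

text \<open>For \<open>k \<ge> 2\<close> the first three entries increase, and two consecutive
  ascents do not fit into two decreasing segments.\<close>

lemma up_then_down_in_down_down:
  assumes "k \<le> n" "3 \<le> n" "up_then_down n k \<in> W [-1, -1]" shows "k \<le> 1"
proof (rule ccontr)
  assume "\<not> k \<le> 1"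
  then show False
    using W_switch[OF _ _ assms(3), of 0 1] assms(1,2)
    by (auto simp: length_up_then_down nth_up_then_down split: if_splits)
qed

section \<open>The meeting condition and its invariance under the symmetries\<close>

definition meets_growth_classes :: "nat list set \<Rightarrow> bool" where
  "meets_growth_classes P \<longleftrightarrow> (\<forall>X\<in>growth_classes. X \<inter> P \<noteq> {})"

lemma meets_growth_classesI:
  assumes "\<exists>p\<in>P. p \<in> W [1, 1]" "\<exists>p\<in>P. p \<in> W [1, -1]" "\<exists>p\<in>P. p \<in> W [-1, 1]" "\<exists>p\<in>P. p \<in> W [-1, -1]"
    "\<exists>p\<in>P. p \<in> class_inverse (W [1, 1])" "\<exists>p\<in>P. p \<in> class_inverse (W [1, -1])"
    "\<exists>p\<in>P. p \<in> class_inverse (W [-1, 1])" "\<exists>p\<in>P. p \<in> class_inverse (W [-1, -1])"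
    "\<exists>p\<in>P. p \<in> L2R" "\<exists>p\<in>P. rev p \<in> L2R"
  shows "meets_growth_classes P"
  unfolding meets_growth_classes_def
proof
  fix X assume "X \<in> growth_classes"
  then show "X \<inter> P \<noteq> {}"
  proof (cases rule: growth_classes_cases)
    case (W e1 e2)
    then have "\<exists>p\<in>P. p \<in> X" using assms(1-4) by auto
    then show ?thesis by blast
  next
    case (inverse e1 e2)
    then have "\<exists>p\<in>P. p \<in> X" using assms(5-8) by auto
    then show ?thesis by blast
  next
    case L2R then show ?thesis using assms(9) by blast
  next
    case rev
    obtain p where "p \<in> P" "rev p \<in> L2R" using assms(10) by blast
    then have "p \<in> X" unfolding rev by (metis image_eqI rev_rev_ident)
    then show ?thesis using \<open>p \<in> P\<close> by blast
  qed
qed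

lemma meets_growth_classesD:
  "meets_growth_classes P \<Longrightarrow> X \<in> growth_classes \<Longrightarrow> \<exists>p\<in>P. p \<in> X"
  unfolding meets_growth_classes_def by blast

lemma meets_growth_classes_mono:
  "meets_growth_classes P \<Longrightarrow> P \<subseteq> Q \<Longrightarrow> meets_growth_classes Q"
  unfolding meets_growth_classes_def by blast

text \<open>The generators permute the ten classes and are involutions on permutations, so
  \<open>Y\<close> meets the image of \<open>P\<close> because the image of \<open>Y\<close> meets
  \<open>P\<close>.\<close>

lemma meets_growth_classes_image:
  assumes "g \<in> {rev, perm_complement, perm_inverse}" "\<And>p. p \<in> P \<Longrightarrow> is_perm p" "meets_growth_classes P"
  shows "meets_growth_classes (g ` P)"
  unfolding meets_growth_classes_def
proof
  fix Y assume Y: "Y \<in> growth_classes"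
  then have "g ` Y \<in> growth_classes"
    using assms(1) rev_growth_classes complement_growth_classes inverse_growth_classes by blast
  then obtain p where p: "p \<in> P" "p \<in> g ` Y" using meets_growth_classesD[OF assms(3)] by blast
  then obtain y where y: "y \<in> Y" "p = g y" by blast
  have "g p = y"
    using assms(1) y is_perm_growth_classes[OF Y y(1)] perm_complement_involution perm_inverse_involution by auto
  then show "Y \<inter> g ` P \<noteq> {}" using y(1) p(1) by blast
qed

lemma symmetries_perm:
  "f \<in> symmetries \<Longrightarrow> is_perm p \<Longrightarrow> is_perm (f p) \<and> length (f p) = length p"
  by (induction rule: symmetries.induct) (auto simp: is_perm_complement is_perm_inverse)

text \<open>The inductive definition composes generators on the left; replacing a triple by its
  image under a generator calls for composition on the right.\<close>

lemma symmetries_comp: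
  assumes "f \<in> symmetries" "g \<in> {rev, perm_complement, perm_inverse}"
  shows "f \<circ> g \<in> symmetries"
  using assms(1)
proof (induction rule: symmetries.induct)
  case identity
  have "g \<circ> id \<in> symmetries"
    using assms(2) symmetries.identity symmetries.reversal symmetries.complement symmetries.inverse by blast
  then show ?case by simp
qed (simp_all only: comp_assoc symmetries.intros)

text \<open>The outermost generator is undone by applying it once more, and induction removes the
  rest.\<close>

lemma meets_growth_classes_symmetry:
  assumes "f \<in> symmetries" "\<And>p. p \<in> P \<Longrightarrow> is_perm p" "meets_growth_classes (f ` P)"
  shows "meets_growth_classes P"
  using assms(1,3)
proof (induction rule: symmetries.induct)
  have step: "meets_growth_classes (f ` P)"
    if g: "g \<in> {rev, perm_complement, perm_inverse}" and f: "f \<in> symmetries"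
      and m: "meets_growth_classes ((g \<circ> f) ` P)" for f g
  proof -
    have p: "is_perm (f q)" if "q \<in> P" for q using symmetries_perm[OF f] assms(2)[OF that] by blast
    have gg: "g (g (f q)) = f q" "is_perm (g (f q))" if "q \<in> P" for q
      using g p[OF that] perm_complement_involution perm_inverse_involution is_perm_complement is_perm_inverse
      by auto
    have "meets_growth_classes (g ` (g \<circ> f) ` P)"
      by (rule meets_growth_classes_image[OF g _ m]) (use gg(2) in auto)
    moreover have "g ` (g \<circ> f) ` P = f ` P" using gg(1) by (auto simp: image_image intro!: image_cong)
    ultimately show ?thesis by simp
  qed
  {
    case (reversal f) then show ?case using step[of rev f] by blast
  next
    case (complement f) then show ?case using step[of perm_complement f] by blast
  next
    case (inverse f) then show ?case using step[of perm_inverse f] by blast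
  }
qed simp

text \<open>This isolates the alternatives of the final statement, with the lengths substituted, for
  one fixed choice of symmetry and roles.\<close>

definition listed :: "nat list \<Rightarrow> nat list \<Rightarrow> nat list \<Rightarrow> bool" where
  "listed a b c \<longleftrightarrow>
      (a = [2, 1, 3] \<and>
         (([3, 4, 1, 2] \<preceq> b \<and> b \<in> L2R \<and>
             (\<exists>k\<le>length c. c = [1..<k+1] @ rev [k+1..<length c+1])) \<or>
          ((\<exists>j. 1 \<le> j \<and> j < length b \<and> b = rev [j+2..<length b+1] @ [j, j+1] @ rev [1..<j]) \<and>
             (\<exists>k\<le>length c. c = [1..<k+1] @ rev [k+1..<length c+1])) \<or>
          (b = rev [3..<length b+1] @ [1, 2] \<and> c \<in> W [1, -1])))
       \<or>
       (sorted_wrt (<) a \<and>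
         (([3, 4, 1, 2] \<preceq> b \<and> b \<in> L2R \<and>
             c \<in> W [-1, -1] \<inter> class_inverse (W [-1, -1])) \<or>
          polynomial_growth (Av {a, b})))
       \<or>
       (a = [2, 1] @ [3..<length a+1] \<and>
         (([3, 4, 1, 2] \<preceq> b \<and> b \<in> L2R \<and> c = [1] @ rev [2..<length c+1]) \<or>
          ((\<exists>j. 1 \<le> j \<and> j < length b \<and> b = rev [j+2..<length b+1] @ [j, j+1] @ rev [1..<j]) \<and>
             (\<exists>k\<le>length c. c = [1..<k+1] @ rev [k+1..<length c+1])) \<or>
          (b = rev [3..<length b+1] @ [1, 2] \<and> c \<in> W [1, -1])))"

lemma listed_three_three:
  "\<lbrakk>a = [2, 1, 3]; [3, 4, 1, 2] \<preceq> b; b \<in> L2R; k \<le> length c; c = up_then_down (length c) k\<rbrakk> \<Longrightarrow> listed a b c"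
  unfolding listed_def up_then_down_def by (intro disjI1 conjI exI[of _ k])

lemma listed_increasing_double:
  "\<lbrakk>sorted_wrt (<) a; [3, 4, 1, 2] \<preceq> b; b \<in> L2R; c \<in> W [-1, -1] \<inter> class_inverse (W [-1, -1])\<rbrakk> \<Longrightarrow> listed a b c"
  unfolding listed_def by (rule disjI2, rule disjI1) (intro disjI1 conjI)

lemma listed_increasing_pair:
  "\<lbrakk>sorted_wrt (<) a; polynomial_growth (Av {a, b})\<rbrakk> \<Longrightarrow> listed a b c"
  unfolding listed_def by (rule disjI2, rule disjI1) (intro disjI2 conjI)

lemma listed_first_double_3412:
  "\<lbrakk>a = [2, 1] @ [3..<length a+1]; [3, 4, 1, 2] \<preceq> b; b \<in> L2R; c = [1] @ rev [2..<length c+1]\<rbrakk> \<Longrightarrow> listed a b c"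
  unfolding listed_def by (rule disjI2, rule disjI2) (intro disjI1 conjI)

lemma listed_first_double_one_double:
  "\<lbrakk>a = [2, 1] @ [3..<length a+1]; 1 \<le> j; j < length b; b = one_double (length b) j;
    k \<le> length c; c = up_then_down (length c) k\<rbrakk> \<Longrightarrow> listed a b c"
  unfolding listed_def one_double_def up_then_down_def
  by (rule disjI2, rule disjI2, rule conjI, assumption, rule disjI2, rule disjI1)
    (intro conjI exI[of _ j] exI[of _ k])

lemma listed_first_double_last:
  "\<lbrakk>a = [2, 1] @ [3..<length a+1]; b = rev [3..<length b+1] @ [1, 2]; c \<in> W [1, -1]\<rbrakk> \<Longrightarrow> listed a b c"
  unfolding listed_def by (rule disjI2, rule disjI2, rule conjI, assumption) (intro disjI2 conjI)

text \<open>Equality of multisets lets the three permutations exchange their roles after one common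
  symmetry.\<close>

definition listed_up_to_symmetry :: "nat list \<Rightarrow> nat list \<Rightarrow> nat list \<Rightarrow> bool" where
  "listed_up_to_symmetry \<alpha> \<beta> \<gamma> \<longleftrightarrow> (\<exists>f\<in>symmetries. \<exists>a b c.
     mset [a, b, c] = mset [f \<alpha>, f \<beta>, f \<gamma>] \<and> listed a b c)"

section \<open>Listed triples meet all ten classes\<close>

lemma rev_one_double_first: "rev (one_double m 1) = [2, 1] @ [3..<m+1]"
  by (simp add: one_double_def numeral_3_eq_3 del: upt_Suc)

lemma one_double_first: "one_double m 1 = rev [3..<m+1] @ [1, 2]"
  by (simp add: one_double_def numeral_3_eq_3 del: upt_Suc)

lemma up_then_down_first: "up_then_down n 1 = [1] @ rev [2..<n+1]"
proof -
  have "[1..<1+1] = [1::nat]" by simp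
  then show ?thesis unfolding up_then_down_def by (metis one_add_one)
qed

text \<open>The whole permutation fills a segment of sign 1 and the other segment is empty. This
  settles seven classes and leaves three to the other two permutations.\<close>

lemma increasing_in_growth_classes:
  assumes "is_perm \<sigma>" "sorted_wrt (<) \<sigma>"
  shows "\<sigma> \<in> W [1, 1]" "\<sigma> \<in> W [1, -1]" "\<sigma> \<in> W [-1, 1]"
    "\<sigma> \<in> class_inverse (W [1, 1])" "\<sigma> \<in> class_inverse (W [1, -1])" "\<sigma> \<in> class_inverse (W [-1, 1])"
    "rev \<sigma> \<in> L2R"
proof -
  have m: "1 * int (\<sigma> ! i) < 1 * int (\<sigma> ! j)" if "i < j" "j < length \<sigma>" for i j
    using assms(2) that by (simp add: sorted_wrt_iff_nth_less)
  show "\<sigma> \<in> W [1, 1]" "\<sigma> \<in> W [1, -1]" "\<sigma> \<in> W [-1, 1]"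
    "\<sigma> \<in> class_inverse (W [1, 1])" "\<sigma> \<in> class_inverse (W [1, -1])" "\<sigma> \<in> class_inverse (W [-1, 1])"
    using monotone_in_W[OF assms(1) _ _ m] by simp_all
  have "noninv_adjacent (rev \<sigma>)"
    unfolding noninv_adjacent_def
  proof (intro allI impI, elim conjE)
    fix i j assume ij: "i < j" "j < length (rev \<sigma>)" "rev \<sigma> ! i < rev \<sigma> ! j"
    have "\<sigma> ! (length \<sigma> - Suc j) < \<sigma> ! (length \<sigma> - Suc i)"
      using m[of "length \<sigma> - Suc j" "length \<sigma> - Suc i"] ij(1,2) by simp
    then show "j = i + 1" using ij by (simp add: rev_nth)
  qed
  then show "rev \<sigma> \<in> L2R" using assms(1) by (simp add: L2R_iff)
qed

lemma decreasing_in_W: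
  assumes "is_perm \<sigma>" "sorted_wrt (>) \<sigma>"
  shows "\<sigma> \<in> W [-1, -1]" "\<sigma> \<in> class_inverse (W [-1, -1])"
proof -
  have "-1 * int (\<sigma> ! i) < -1 * int (\<sigma> ! j)" if "i < j" "j < length \<sigma>" for i j
    using assms(2) that by (simp add: sorted_wrt_iff_nth_less)
  then show "\<sigma> \<in> W [-1, -1]" "\<sigma> \<in> class_inverse (W [-1, -1])"
    using monotone_in_W[OF assms(1), of "-1" "-1"] by simp_all
qed

lemma sorted_rev_upt: "sorted_wrt (>) (rev [a..<b::nat])"
  by (simp add: sorted_wrt_rev)

lemma meets_increasing:
  assumes "is_perm \<alpha>" "sorted_wrt (<) \<alpha>" "\<beta> \<in> L2R" "\<exists>p\<in>P. p \<in> W [-1, -1]"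
    "\<exists>p\<in>P. p \<in> class_inverse (W [-1, -1])" "\<alpha> \<in> P" "\<beta> \<in> P"
  shows "meets_growth_classes P"
  by (rule meets_growth_classesI) (use assms increasing_in_growth_classes[OF assms(1,2)] in blast)+

lemma first_double_in_growth_classes:
  assumes "2 \<le> s"
  shows "rev (one_double s 1) \<in> W [1, 1]" "rev (one_double s 1) \<in> W [-1, 1]"
    "rev (one_double s 1) \<in> class_inverse (W [1, 1])" "rev (one_double s 1) \<in> class_inverse (W [-1, 1])"
    "rev (rev (one_double s 1)) \<in> L2R"
  using one_double_W[of 1 s] one_double_first_W[of s] one_double_L2R[of 1 s] assms
  by (simp_all add: rev_in_W_iff rev_in_inverse_W_iff)

text \<open>Here \<open>a\<close> is 2 1 3 ... s, which settles four classes of W kind and the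
  reversal of \<open>L2R\<close>; \<open>b\<close> settles \<open>L2R\<close>. The hypotheses
  \<open>rest\<close> are the four remaining classes.\<close>

lemma listed_first_double_meets:
  assumes a: "a = rev (one_double s 1)" "2 \<le> s" and b: "b \<in> L2R" and P: "{a, b, c} \<subseteq> P"
    and rest: "\<exists>p\<in>P. p \<in> W [1, -1]" "\<exists>p\<in>P. p \<in> class_inverse (W [1, -1])"
      "\<exists>p\<in>P. p \<in> W [-1, -1]" "\<exists>p\<in>P. p \<in> class_inverse (W [-1, -1])"
  shows "meets_growth_classes P"
  by (rule meets_growth_classesI)
    (use assms first_double_in_growth_classes[OF a(2), folded a(1)] in blast)+

lemma perm_213: "is_perm [2, 1, 3]" by (auto simp: is_perm_iff)

text \<open>The split is 21|3, and 213 is its own inverse. At length 3 two of the remaining four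
  classes are thus met, which relaxes the conditions on the other permutations.\<close>

lemma W_213: "[2, 1, 3] \<in> W [-1, -1]" "[2, 1, 3] \<in> class_inverse (W [-1, -1])"
proof -
  show "[2, 1, 3] \<in> W [-1, -1]"
    unfolding W_def using perm_213
    by (auto simp: monotone_seg_def intro!: exI[of _ "[[2, 1], [3]]"])
  moreover have "perm_inverse [2, 1, 3] = [2, 1, 3]"
    by (rule perm_inverse_eqI[OF perm_213]) (auto simp: less_Suc_eq numeral_3_eq_3)
  ultimately show "[2, 1, 3] \<in> class_inverse (W [-1, -1])" using perm_213 by (simp add: class_inverse_W_iff)
qed

lemma listed_meets:
  assumes p: "is_perm a" "is_perm b" "is_perm c" and len: "3 \<le> length a" "3 \<le> length b" "3 \<le> length c"
    and "listed a b c"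
  shows "meets_growth_classes {a, b, c}"
proof -
  have double: "b \<in> L2R \<and> b \<in> W [-1, -1] \<and> b \<in> class_inverse (W [-1, -1])"
    if d: "\<exists>j. 1 \<le> j \<and> j < length b \<and> b = rev [j+2..<length b+1] @ [j, j+1] @ rev [1..<j]"
  proof -
    from d obtain j where j: "1 \<le> j" "j < length b" "b = rev [j+2..<length b+1] @ [j, j+1] @ rev [1..<j]"
      by (elim exE conjE)
    have "b = one_double (length b) j" using j(3) unfolding one_double_def .
    then show ?thesis using one_double_L2R[OF j(1,2)] one_double_W[OF j(1,2)] by simp
  qed
  have first: "b \<in> L2R \<and> b \<in> W [-1, -1] \<and> b \<in> class_inverse (W [-1, -1]) \<and> b \<in> class_inverse (W [1, -1])"
    if "b = rev [3..<length b+1] @ [1, 2]"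
  proof -
    have "b = one_double (length b) 1" using that by (simp only: one_double_first)
    then show ?thesis
      using one_double_L2R[of 1 "length b"] one_double_W[of 1 "length b"] one_double_first_W[of "length b"] len
      by simp
  qed
  have updown: "c \<in> W [1, -1] \<and> c \<in> class_inverse (W [1, -1])"
    if d: "\<exists>k\<le>length c. c = [1..<k+1] @ rev [k+1..<length c+1]"
  proof -
    from d obtain k where k: "k \<le> length c" "c = [1..<k+1] @ rev [k+1..<length c+1]"
      by (elim exE conjE)
    have "c = up_then_down (length c) k" using k(2) unfolding up_then_down_def .
    then show ?thesis using k(1) up_then_down_W[of k "length c"] by simp
  qed
  have updown1: "c \<in> W [1, -1] \<and> c \<in> class_inverse (W [1, -1]) \<and> c \<in> W [-1, -1] \<and> c \<in> class_inverse (W [-1, -1])"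
    if "c = [1] @ rev [2..<length c+1]"
  proof -
    have "c = up_then_down (length c) 1" using that by (simp only: up_then_down_first)
    then show ?thesis
      using up_then_down_W[of 1 "length c"] up_then_down_first_W[of "length c"] len by simp
  qed
  \<comment> \<open>This makes 213 the instance \<open>s = 3\<close> of 2 1 3 ... s.\<close>
  have a213: "a = rev (one_double 3 1)" if "a = [2, 1, 3]" using that by (simp add: one_double_def upt_rec)
  have s: "2 \<le> length a" "2 \<le> (3::nat)" using len by auto
  from assms(7)[unfolded listed_def] show ?thesis
  proof (elim disjE conjE)
    assume a: "a = [2, 1, 3]" and b: "b \<in> L2R" and c: "\<exists>k\<le>length c. c = [1..<k+1] @ rev [k+1..<length c+1]"
    show ?thesis
      by (rule listed_first_double_meets[OF a213[OF a] s(2) b order_refl])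
        (use updown[OF c] W_213 a in blast)+
  next
    assume a: "a = [2, 1, 3]" and b: "\<exists>j. 1 \<le> j \<and> j < length b \<and> b = rev [j+2..<length b+1] @ [j, j+1] @ rev [1..<j]"
      and c: "\<exists>k\<le>length c. c = [1..<k+1] @ rev [k+1..<length c+1]"
    have bL: "b \<in> L2R" using double[OF b] by blast
    show ?thesis
      by (rule listed_first_double_meets[OF a213[OF a] s(2) bL order_refl])
        (use updown[OF c] double[OF b] in blast)+
  next
    assume a: "a = [2, 1, 3]" and b: "b = rev [3..<length b+1] @ [1, 2]" and c: "c \<in> W [1, -1]"
    have bL: "b \<in> L2R" using first[OF b] by blast
    show ?thesis
      by (rule listed_first_double_meets[OF a213[OF a] s(2) bL order_refl])
        (use c first[OF b] in blast)+
  next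
    assume a: "sorted_wrt (<) a" and b: "b \<in> L2R" and c: "c \<in> W [-1, -1] \<inter> class_inverse (W [-1, -1])"
    show ?thesis by (rule meets_increasing[OF p(1) a b]) (use c in blast)+
  next
    assume "polynomial_growth (Av {a, b})"
    then have "meets_growth_classes {a, b}"
      using polynomial_growth_Av_iff[of "{a, b}"] p unfolding meets_growth_classes_def by blast
    then show ?thesis by (rule meets_growth_classes_mono) blast
  next
    assume a: "a = [2, 1] @ [3..<length a+1]" and b: "b \<in> L2R" and c: "c = [1] @ rev [2..<length c+1]"
    show ?thesis
      by (rule listed_first_double_meets[OF a[folded rev_one_double_first] s(1) b order_refl])
        (use updown1[OF c] in blast)+
  next
    assume a: "a = [2, 1] @ [3..<length a+1]"
      and b: "\<exists>j. 1 \<le> j \<and> j < length b \<and> b = rev [j+2..<length b+1] @ [j, j+1] @ rev [1..<j]"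
      and c: "\<exists>k\<le>length c. c = [1..<k+1] @ rev [k+1..<length c+1]"
    have bL: "b \<in> L2R" using double[OF b] by blast
    show ?thesis
      by (rule listed_first_double_meets[OF a[folded rev_one_double_first] s(1) bL order_refl])
        (use updown[OF c] double[OF b] in blast)+
  next
    assume a: "a = [2, 1] @ [3..<length a+1]" and b: "b = rev [3..<length b+1] @ [1, 2]" and c: "c \<in> W [1, -1]"
    have bL: "b \<in> L2R" using first[OF b] by blast
    show ?thesis
      by (rule listed_first_double_meets[OF a[folded rev_one_double_first] s(1) bL order_refl])
        (use c first[OF b] in blast)+
  qed
qed

lemma listed_up_to_symmetryI: "listed a b c \<Longrightarrow> listed_up_to_symmetry a b c"
  unfolding listed_up_to_symmetry_def by (rule bexI[OF _ symmetries.identity]) auto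

lemma listed_up_to_symmetry_permute:
  assumes "listed_up_to_symmetry \<alpha> \<beta> \<gamma>" "mset [\<alpha>, \<beta>, \<gamma>] = mset [\<alpha>', \<beta>', \<gamma>']"
  shows "listed_up_to_symmetry \<alpha>' \<beta>' \<gamma>'"
proof -
  have "mset [f \<alpha>, f \<beta>, f \<gamma>] = mset [f \<alpha>', f \<beta>', f \<gamma>']" for f :: "nat list \<Rightarrow> nat list"
    using arg_cong[OF assms(2), of "image_mset f"] by simp
  then show ?thesis using assms(1) unfolding listed_up_to_symmetry_def by metis
qed

lemma listed_up_to_symmetry_image:
  assumes "g \<in> {rev, perm_complement, perm_inverse}" "listed_up_to_symmetry (g \<alpha>) (g \<beta>) (g \<gamma>)"
  shows "listed_up_to_symmetry \<alpha> \<beta> \<gamma>"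
proof -
  obtain f a b c where "f \<in> symmetries" "mset [a, b, c] = mset [f (g \<alpha>), f (g \<beta>), f (g \<gamma>)]" "listed a b c"
    using assms(2) unfolding listed_up_to_symmetry_def by blast
  then show ?thesis
    using symmetries_comp[OF _ assms(1)] unfolding listed_up_to_symmetry_def
    by (intro bexI[of _ "f \<circ> g"] exI[of _ a] exI[of _ b] exI[of _ c]) auto
qed

section \<open>Triples of permutations\<close>

text \<open>These are the three classes left open by \<open>increasing_in_growth_classes\<close>;
  three increasing entries exclude each of them.\<close>

lemma increasing_not_in:
  assumes "is_perm \<sigma>" "sorted_wrt (<) \<sigma>" "3 \<le> length \<sigma>"
  shows "\<sigma> \<notin> W [-1, -1]" "\<sigma> \<notin> class_inverse (W [-1, -1])" "\<sigma> \<notin> L2R"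
proof -
  have m: "\<sigma> ! 0 < \<sigma> ! 1" "\<sigma> ! 1 < \<sigma> ! 2" "\<sigma> ! 0 < \<sigma> ! 2"
    using assms(2,3) by (auto simp: sorted_wrt_iff_nth_less)
  show "\<sigma> \<notin> W [-1, -1]"
  proof
    assume "\<sigma> \<in> W [-1, -1]"
    from W_switch[OF _ _ this, of 0 1] show False using m assms(3) by (simp add: numeral_2_eq_2)
  qed
  show "\<sigma> \<notin> class_inverse (W [-1, -1])"
  proof
    assume "\<sigma> \<in> class_inverse (W [-1, -1])"
    then obtain v where v: "\<And>i j. i < j \<Longrightarrow> j < length \<sigma> \<Longrightarrow> \<sigma> ! i \<le> v \<Longrightarrow> \<sigma> ! j \<le> v \<Longrightarrow> \<sigma> ! j < \<sigma> ! i"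
      "\<And>i j. i < j \<Longrightarrow> j < length \<sigma> \<Longrightarrow> v < \<sigma> ! i \<Longrightarrow> v < \<sigma> ! j \<Longrightarrow> \<sigma> ! j < \<sigma> ! i"
      by (subst (asm) inverse_W_iff) (simp_all, blast)
    have "\<not> \<sigma> ! 1 \<le> v" "\<not> v < \<sigma> ! 1" using v(1)[of 0 1] v(2)[of 1 2] m assms(3) by auto
    then show False by simp
  qed
  show "\<sigma> \<notin> L2R"
    using noninv_adjacentD[OF L2R_noninv_adjacent, of \<sigma> 0 2] m assms(3) by auto
qed

text \<open>Besides \<open>L2R\<close>, an increasing \<open>\<alpha>\<close> leaves W(-1,-1) and
  its inverse class. If \<open>\<beta>\<close> contains 3412, it lies in neither, so
  \<open>\<gamma>\<close> lies in both. Otherwise \<open>\<beta>\<close> has at most one doubleton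
  and lies in both, and the pair \<open>\<alpha>\<close>, \<open>\<beta>\<close> alone gives
  polynomial growth.\<close>

lemma listed_increasing:
  assumes p: "is_perm \<alpha>" "is_perm \<beta>" "is_perm \<gamma>" and len: "3 \<le> length \<alpha>"
    and inc: "sorted_wrt (<) \<alpha>" and \<beta>: "\<beta> \<in> L2R" and meets: "meets_growth_classes {\<alpha>, \<beta>, \<gamma>}"
  shows "listed_up_to_symmetry \<alpha> \<beta> \<gamma>"
proof (rule listed_up_to_symmetryI)
  show "listed \<alpha> \<beta> \<gamma>"
  proof (cases "[3, 4, 1, 2] \<preceq> \<beta>")
    case True
    have "\<gamma> \<in> W [-1, -1] \<inter> class_inverse (W [-1, -1])"
      using meets_growth_classesD[OF meets W_growth_classes(1)[of "-1" "-1"]]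
        meets_growth_classesD[OF meets W_growth_classes(2)[of "-1" "-1"]]
        increasing_not_in[OF p(1) inc len] not_W_3412[OF True, of "-1" "-1"] by auto
    then show ?thesis using listed_increasing_double[OF inc True \<beta>] by blast
  next
    case False
    have "\<beta> \<in> W [-1, -1] \<and> \<beta> \<in> class_inverse (W [-1, -1])"
      using \<beta>
    proof (cases rule: L2R_shape)
      case 2
      have "sorted_wrt (>) \<beta>" using sorted_rev_upt[of 1 "length \<beta> + 1", folded 2] .
      then show ?thesis using decreasing_in_W[OF p(2)] by blast
    next
      case (3 j) then show ?thesis using one_double_W[OF 3(1,2), folded 3(3)] by blast
    qed (use False in blast)
    then have "meets_growth_classes {\<alpha>, \<beta>}"
      using meets_increasing[OF p(1) inc \<beta>, of "{\<alpha>, \<beta>}"] by blast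
    then have "polynomial_growth (Av {\<alpha>, \<beta>})"
      using polynomial_growth_Av_iff[of "{\<alpha>, \<beta>}"] p unfolding meets_growth_classes_def by blast
    then show ?thesis using listed_increasing_pair[OF inc] by blast
  qed
qed

lemma listed_contains_increasing:
  assumes p: "is_perm \<alpha>" "is_perm \<beta>" "is_perm \<gamma>" and len: "3 \<le> length \<alpha>"
    and inc: "sorted_wrt (<) \<alpha>" and meets: "meets_growth_classes {\<alpha>, \<beta>, \<gamma>}"
  shows "listed_up_to_symmetry \<alpha> \<beta> \<gamma>"
proof -
  have "\<beta> \<in> L2R \<or> \<gamma> \<in> L2R"
    using meets_growth_classesD[OF meets L2R_growth_classes(1)] increasing_not_in(3)[OF p(1) inc len] by auto
  then show ?thesis
  proof
    assume "\<beta> \<in> L2R" then show ?thesis using listed_increasing[OF p len inc _ meets] by blast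
  next
    assume "\<gamma> \<in> L2R"
    then have "listed_up_to_symmetry \<alpha> \<gamma> \<beta>"
      using listed_increasing[OF p(1,3,2) len inc] meets by (simp add: insert_commute)
    then show ?thesis by (rule listed_up_to_symmetry_permute) simp
  qed
qed

lemma listed_contains_decreasing:
  assumes p: "is_perm \<alpha>" "is_perm \<beta>" "is_perm \<gamma>" and len: "3 \<le> length \<alpha>"
    and dec: "sorted_wrt (>) \<alpha>" and meets: "meets_growth_classes {\<alpha>, \<beta>, \<gamma>}"
  shows "listed_up_to_symmetry \<alpha> \<beta> \<gamma>"
proof (rule listed_up_to_symmetry_image[of rev])
  have "meets_growth_classes (rev ` {\<alpha>, \<beta>, \<gamma>})"
    by (rule meets_growth_classes_image) (use p meets in auto)
  then have "meets_growth_classes {rev \<alpha>, rev \<beta>, rev \<gamma>}" by simp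
  then show "listed_up_to_symmetry (rev \<alpha>) (rev \<beta>) (rev \<gamma>)"
    using listed_contains_increasing[of "rev \<alpha>" "rev \<beta>" "rev \<gamma>"] p len dec by (simp add: sorted_wrt_rev)
qed simp

definition monotone_list :: "nat list \<Rightarrow> bool" where
  "monotone_list \<sigma> \<longleftrightarrow> sorted_wrt (<) \<sigma> \<or> sorted_wrt (>) \<sigma>"

lemma monotone_list_rev [simp]: "monotone_list (rev \<sigma>) \<longleftrightarrow> monotone_list \<sigma>"
  by (auto simp: monotone_list_def sorted_wrt_rev)

lemma listed_contains_monotone:
  assumes p: "is_perm \<alpha>" "is_perm \<beta>" "is_perm \<gamma>" and len: "3 \<le> length \<alpha>"
    and mono: "monotone_list \<alpha>" and meets: "meets_growth_classes {\<alpha>, \<beta>, \<gamma>}"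
  shows "listed_up_to_symmetry \<alpha> \<beta> \<gamma>"
  using mono listed_contains_increasing[OF p len _ meets] listed_contains_decreasing[OF p len _ meets]
  unfolding monotone_list_def by blast

section \<open>Triples in which no member is monotone\<close>

lemma L2R_shape_not_monotone:
  assumes "\<sigma> \<in> L2R" "\<not> monotone_list \<sigma>"
  obtains "[3, 4, 1, 2] \<preceq> \<sigma>" | j where "1 \<le> j" "j < length \<sigma>" "\<sigma> = one_double (length \<sigma>) j"
  using assms(1)
proof (cases rule: L2R_shape)
  case 2
  have "monotone_list \<sigma>"
    unfolding monotone_list_def using sorted_rev_upt[of 1 "length \<sigma> + 1", folded 2] by blast
  then show thesis using assms(2) by blast
qed (use that in blast)+

lemma first_double_not_in:
  assumes "3 \<le> s"
  shows "rev (one_double s 1) \<notin> W [1, -1]" "rev (one_double s 1) \<notin> class_inverse (W [1, -1])"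
  using one_double_up_down[of 1 s] one_double_inverse_down_up[of 1 s] assms
  by (auto simp: rev_in_W_iff rev_in_inverse_W_iff)

lemma first_double_not_in_down_down:
  assumes "4 \<le> s"
  shows "rev (one_double s 1) \<notin> W [-1, -1]" "rev (one_double s 1) \<notin> class_inverse (W [-1, -1])"
  using one_double_first_not_up_up[OF assms] by (simp_all add: rev_in_W_iff rev_in_inverse_W_iff)

text \<open>The permutation 2 1 3 ... s misses W(+1,-1) and its inverse class. If \<open>B\<close>
  contains 3412, then \<open>C\<close> has to lie in both; a single doubleton in \<open>B\<close>
  can settle one of them, and only from an end. The last two alternatives for 213 are instances of
  those for 2 1 3 ... s and are obtained there.\<close>

lemma listed_first_double:
  assumes p: "is_perm B" "is_perm C" and A: "A = rev (one_double s 1)" "3 \<le> s"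
    and B: "B \<in> L2R" "\<not> monotone_list B" "3 \<le> length B" and C: "\<not> monotone_list C" "3 \<le> length C"
    and meets: "meets_growth_classes {A, B, C}"
  shows "listed_up_to_symmetry A B C"
proof -
  have lA: "length A = s" using A by (simp add: length_one_double)
  have pA: "is_perm A" using A is_perm_L2R[OF one_double_L2R[of 1 s]] by simp
  have A': "A = [2, 1] @ [3..<length A+1]" using A(1) lA rev_one_double_first[of s] by simp
  have e: "(1::int) \<in> {1, -1}" "(-1::int) \<in> {1, -1}" by auto
  note hit = meets_growth_classesD[OF meets W_growth_classes(1)]
    meets_growth_classesD[OF meets W_growth_classes(2)]
  note notA = first_double_not_in[OF A(2), folded A(1)]
  from B(1,2) show ?thesis
  proof (cases rule: L2R_shape_not_monotone)
    case 1
    have ud: "C \<in> W [1, -1]" "C \<in> class_inverse (W [1, -1])"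
      using hit[OF e] notA not_W_3412[OF 1 e] by auto
    then obtain k where k: "k \<le> length C" "C = up_then_down (length C) k"
      using up_then_down_characterization by blast
    show ?thesis
    proof (cases "s = 3")
      case True
      then have "A = [2, 1, 3]" using A' lA by (simp add: upt_rec)
      then have "listed A B C" using listed_three_three[OF _ 1 B(1) k] by blast
      then show ?thesis by (rule listed_up_to_symmetryI)
    next
      case False
      then have "4 \<le> s" using A(2) by simp
      \<comment> \<open>From length 4 on \<open>A\<close> misses W(-1,-1) as well; this extra demand
        on \<open>C\<close> cuts \<open>k\<close> down to 1.\<close>
      then have "C \<in> W [-1, -1]"
        using hit(1)[OF e(2,2)] first_double_not_in_down_down(1)[of s, folded A(1)] not_W_3412[OF 1 e(2,2)] by auto
      then have "k \<le> 1" using up_then_down_in_down_down[of k "length C"] k C(2) by simp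
      moreover have "k \<noteq> 0"
      proof
        assume "k = 0"
        then have C_rev: "C = rev [1..<length C + 1]" using k(2) by (simp add: up_then_down_def)
        have "monotone_list C"
          unfolding monotone_list_def using sorted_rev_upt[of 1 "length C + 1", folded C_rev] by blast
        then show False using C(1) by blast
      qed
      ultimately have "k = 1" by simp
      then have "C = [1] @ rev [2..<length C + 1]" using k(2) by (simp only: up_then_down_first)
      then have "listed A B C" using listed_first_double_3412[OF A' 1 B(1)] by blast
      then show ?thesis by (rule listed_up_to_symmetryI)
    qed
  next
    case (2 j)
    note notB = one_double_up_down[OF 2(1,2), folded 2(3)] one_double_inverse_up_down[OF 2(1,2), folded 2(3)]
    \<comment> \<open>The doubleton of \<open>B\<close> cannot be at both ends, so \<open>B\<close>
      settles at most one of the two classes.\<close>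
    have j: "1 \<noteq> length B - 1" using B(3) by simp
    consider (both) "C \<in> W [1, -1]" "C \<in> class_inverse (W [1, -1])"
      | (first) "j = 1" "C \<in> W [1, -1]" | (last) "j = length B - 1" "C \<in> class_inverse (W [1, -1])"
      using hit[OF e] notA notB j by auto
    then show ?thesis
    proof cases
      case both
      then obtain k where k: "k \<le> length C" "C = up_then_down (length C) k"
        using up_then_down_characterization by blast
      have "listed A B C" by (rule listed_first_double_one_double[OF A' 2 k])
      then show ?thesis by (rule listed_up_to_symmetryI)
    next
      case first
      then have "B = rev [3..<length B+1] @ [1, 2]" using 2(3) one_double_first by simp
      then have "listed A B C" using listed_first_double_last[OF A' _ first(2)] by blast
      then show ?thesis by (rule listed_up_to_symmetryI)
    next
      case last
      let ?B = "perm_inverse B" and ?C = "perm_inverse C"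
      \<comment> \<open>Taking inverses fixes \<open>A\<close> and moves the doubleton of
        \<open>B\<close> from the front to the end, which reduces this case to the form of the
        previous one.\<close>
      have inv: "perm_inverse A = A"
        using A inverse_one_double[of 1 s] complement_one_double[of "s - 1" s] is_perm_L2R[OF one_double_L2R[of 1 s]]
        by (simp add: perm_inverse_rev)
      have "length B - j = 1" using last(1) 2(1,2) by linarith
      then have "?B = one_double (length ?B) 1"
        unfolding length_perm_inverse using inverse_one_double[OF 2(1,2), folded 2(3)] by metis
      then have B': "?B = rev [3..<length ?B+1] @ [1, 2]" by (simp only: one_double_first)
      have C': "?C \<in> W [1, -1]" using last(2) by (simp add: class_inverse_W_iff)
      have "listed (perm_inverse A) ?B ?C"
        unfolding inv by (rule listed_first_double_last[OF A' B' C'])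
      then have "listed_up_to_symmetry (perm_inverse A) ?B ?C" by (rule listed_up_to_symmetryI)
      then show ?thesis by (rule listed_up_to_symmetry_image[rotated]) simp
    qed
  qed
qed

text \<open>If the doubleton is at the other end, \<open>A\<close> is 1 2 ... (s-2) s (s-1). The
  half turn carries it to 2 1 3 ... s and keeps \<open>B\<close> in \<open>L2R\<close>.\<close>

lemma listed_end_double:
  assumes p: "is_perm A" "is_perm B" "is_perm C"
    and A: "rev A = one_double s 1 \<or> rev A = one_double s (s - 1)" "3 \<le> s"
    and B: "B \<in> L2R" "\<not> monotone_list B" "3 \<le> length B" and C: "\<not> monotone_list C" "3 \<le> length C"
    and meets: "meets_growth_classes {A, B, C}"
  shows "listed_up_to_symmetry A B C"
  using A(1)
proof
  assume "rev A = one_double s 1"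
  then have "A = rev (one_double s 1)" by (metis rev_rev_ident)
  then show ?thesis using listed_first_double[OF p(2,3) _ A(2) B C meets] by blast
next
  assume rA: "rev A = one_double s (s - 1)"
  let ?rc = "\<lambda>\<sigma>. perm_complement (rev \<sigma>)"
  have "?rc A = rev (one_double s 1)"
    using rA complement_one_double[of "s - 1" s] A(2) by simp
  moreover have "?rc B \<in> L2R" using rev_complement_L2R[OF B(1)] by (simp add: complement_rev)
  moreover have mono: "monotone_list (?rc \<sigma>) \<Longrightarrow> monotone_list \<sigma>" if "is_perm \<sigma>" for \<sigma>
  proof -
    have key: "perm_complement \<sigma> ! i < perm_complement \<sigma> ! j \<longleftrightarrow> \<sigma> ! j < \<sigma> ! i"
      if "i < length \<sigma>" "j < length \<sigma>" for i j
      using that is_perm_nth_bounds[OF \<open>is_perm \<sigma>\<close> that(1)] is_perm_nth_bounds[OF \<open>is_perm \<sigma>\<close> that(2)]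
      by (simp add: nth_perm_complement; linarith)
    have "sorted_wrt (>) \<sigma>" if "sorted_wrt (<) (perm_complement \<sigma>)"
      using that key unfolding sorted_wrt_iff_nth_less length_perm_complement by (meson less_trans)
    moreover have "sorted_wrt (<) \<sigma>" if "sorted_wrt (>) (perm_complement \<sigma>)"
      using that key unfolding sorted_wrt_iff_nth_less length_perm_complement by (meson less_trans)
    moreover assume "monotone_list (?rc \<sigma>)"
    ultimately show "monotone_list \<sigma>"
      unfolding complement_rev monotone_list_rev unfolding monotone_list_def by blast
  qed
  moreover have "meets_growth_classes {?rc A, ?rc B, ?rc C}"
  proof -
    have "meets_growth_classes (rev ` {A, B, C})"
      by (rule meets_growth_classes_image) (use p meets in auto)
    then have "meets_growth_classes (perm_complement ` rev ` {A, B, C})"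
      by (rule meets_growth_classes_image[rotated 2]) (use p in auto)
    then show ?thesis by simp
  qed
  ultimately have "listed_up_to_symmetry (?rc A) (?rc B) (?rc C)"
    using p A(2) B C is_perm_complement by (intro listed_first_double[of "?rc B" "?rc C" "?rc A" s]) auto
  then have "listed_up_to_symmetry (rev A) (rev B) (rev C)"
    by (rule listed_up_to_symmetry_image[rotated]) simp
  then show ?thesis by (rule listed_up_to_symmetry_image[rotated]) simp
qed

text \<open>An interior doubleton is an ascent between two descents, and 3412 has a descent between
  two ascents; neither fits into a single rise and a single fall, in either order.\<close>

lemma L2R_not_end_double:
  assumes "\<sigma> \<in> L2R" "\<not> monotone_list \<sigma>"
    and "\<sigma> \<noteq> one_double (length \<sigma>) 1" "\<sigma> \<noteq> one_double (length \<sigma>) (length \<sigma> - 1)"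
  shows "\<sigma> \<notin> W [1, -1]" "\<sigma> \<notin> W [-1, 1]"
proof -
  from assms(1,2) have "\<sigma> \<notin> W [1, -1] \<and> \<sigma> \<notin> W [-1, 1]"
  proof (cases rule: L2R_shape_not_monotone)
    case 1 then show ?thesis using not_W_3412(1)[OF 1] by simp
  next
    case (2 j)
    have "j \<noteq> 1" "j \<noteq> length \<sigma> - 1" using 2(3) assms(3,4) by metis+
    then show ?thesis
      using one_double_up_down[OF 2(1,2), folded 2(3)] one_double_down_up[OF 2(1,2), folded 2(3)] by blast
  qed
  then show "\<sigma> \<notin> W [1, -1]" "\<sigma> \<notin> W [-1, 1]" by auto
qed

text \<open>Either \<open>rev A\<close> or \<open>B\<close> must have its only doubleton at an end,
  since otherwise \<open>C\<close> would be monotone. If it is \<open>B\<close>, reversal exchanges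
  the two roles.\<close>

lemma listed_layered:
  assumes p: "is_perm A" "is_perm B" "is_perm C" and A: "rev A \<in> L2R" and B: "B \<in> L2R"
    and mono: "\<not> monotone_list A" "\<not> monotone_list B" "\<not> monotone_list C"
    and len: "3 \<le> length A" "3 \<le> length B" "3 \<le> length C"
    and meets: "meets_growth_classes {A, B, C}"
  shows "listed_up_to_symmetry A B C"
proof -
  let ?end = "\<lambda>\<sigma>. \<sigma> = one_double (length \<sigma>) 1 \<or> \<sigma> = one_double (length \<sigma>) (length \<sigma> - 1)"
  consider "?end (rev A)" | "?end B" | "\<not> ?end (rev A)" "\<not> ?end B" by blast
  then show ?thesis
  proof cases
    case 1
    then show ?thesis using listed_end_double[OF p _ len(1) B mono(2) len(2) mono(3) len(3) meets] by simp
  next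
    case 2
    have "meets_growth_classes (rev ` {A, B, C})"
      by (rule meets_growth_classes_image) (use p meets in auto)
    then have "meets_growth_classes {rev B, rev A, rev C}" by (simp add: insert_commute)
    then have "listed_up_to_symmetry (rev B) (rev A) (rev C)"
      using 2 p A mono len by (intro listed_end_double[of "rev B" "rev A" "rev C" "length B"]) auto
    then have "listed_up_to_symmetry B A C" by (rule listed_up_to_symmetry_image[rotated]) simp
    then show ?thesis by (rule listed_up_to_symmetry_permute) simp
  next
    case 3
    have "rev A \<notin> W [1, -1]" "rev A \<notin> W [-1, 1]" "B \<notin> W [1, -1]" "B \<notin> W [-1, 1]"
      using L2R_not_end_double[OF A] L2R_not_end_double[OF B] 3 mono by auto
    then have "A \<notin> W [1, -1]" "A \<notin> W [-1, 1]" by (simp_all add: rev_in_W_iff)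
    then have "C \<in> W [1, -1]" "C \<in> W [-1, 1]"
      using meets_growth_classesD[OF meets W_growth_classes(1)[of 1 "-1"]]
        meets_growth_classesD[OF meets W_growth_classes(1)[of "-1" 1]]
        \<open>B \<notin> W [1, -1]\<close> \<open>B \<notin> W [-1, 1]\<close> by auto
    then show ?thesis using up_down_up_monotone mono(3) unfolding monotone_list_def by blast
  qed
qed

text \<open>Positions 0 and 2 are not adjacent: one membership forces an inversion there and the
  other forbids it.\<close>

lemma L2R_rev_disjoint:
  assumes "\<sigma> \<in> L2R" "rev \<sigma> \<in> L2R" shows "length \<sigma> < 3"
proof (rule ccontr)
  assume "\<not> length \<sigma> < 3"
  then have n: "0 < length \<sigma>" "2 < length \<sigma>" "length \<sigma> - 3 < length \<sigma>" by auto
  have "\<not> \<sigma> ! 0 < \<sigma> ! 2" using noninv_adjacentD[OF L2R_noninv_adjacent[OF assms(1)], of 0 2] n by auto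
  moreover have "\<not> \<sigma> ! 2 < \<sigma> ! 0"
  proof -
    let ?i = "length \<sigma> - 3" and ?j = "length \<sigma> - 1"
    have "length \<sigma> - Suc ?i = 2" "length \<sigma> - Suc ?j = 0" using n by linarith+
    then have "rev \<sigma> ! ?i = \<sigma> ! 2" "rev \<sigma> ! ?j = \<sigma> ! 0" using n by (simp_all add: rev_nth)
    moreover have "?i < ?j" "?j < length (rev \<sigma>)" "?j \<noteq> ?i + 1" using n by auto
    ultimately show ?thesis using noninv_adjacentD[OF L2R_noninv_adjacent[OF assms(2)], of ?i ?j] by auto
  qed
  ultimately show False using is_perm_nth_eq_iff[OF is_perm_L2R[OF assms(1)] n(1,2)] by simp
qed

lemma meets_listed_up_to_symmetry:
  assumes p: "is_perm \<alpha>" "is_perm \<beta>" "is_perm \<gamma>"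
    and len: "3 \<le> length \<alpha>" "3 \<le> length \<beta>" "3 \<le> length \<gamma>"
    and meets: "meets_growth_classes {\<alpha>, \<beta>, \<gamma>}"
  shows "listed_up_to_symmetry \<alpha> \<beta> \<gamma>"
proof -
  let ?S = "{\<alpha>, \<beta>, \<gamma>}"
  obtain B where B: "B \<in> ?S" "B \<in> L2R" using meets_growth_classesD[OF meets L2R_growth_classes(1)] by blast
  obtain A where A: "A \<in> ?S" "A \<in> rev ` L2R" using meets_growth_classesD[OF meets L2R_growth_classes(2)] by blast
  then have rA: "rev A \<in> L2R" by auto
  have "3 \<le> length B" using B(1) len by auto
  \<comment> \<open>Being distinct, the two layered members leave exactly one further permutation
    \<open>C\<close>.\<close>
  then have "A \<noteq> B" using L2R_rev_disjoint[OF B(2)] rA by auto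
  then consider "A = \<alpha>" "B = \<beta>" | "A = \<alpha>" "B = \<gamma>" | "A = \<beta>" "B = \<alpha>" | "A = \<beta>" "B = \<gamma>"
    | "A = \<gamma>" "B = \<alpha>" | "A = \<gamma>" "B = \<beta>"
    using A(1) B(1) by blast
  then have "\<exists>C. mset [A, B, C] = mset [\<alpha>, \<beta>, \<gamma>]"
  proof cases
    case 1 then show ?thesis by (intro exI[of _ \<gamma>]) simp
  next
    case 2 then show ?thesis by (intro exI[of _ \<beta>]) simp
  next
    case 3 then show ?thesis by (intro exI[of _ \<gamma>]) simp
  next
    case 4 then show ?thesis by (intro exI[of _ \<alpha>]) simp
  next
    case 5 then show ?thesis by (intro exI[of _ \<beta>]) simp
  next
    case 6 then show ?thesis by (intro exI[of _ \<alpha>]) simp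
  qed
  then obtain C where C: "mset [A, B, C] = mset [\<alpha>, \<beta>, \<gamma>]" by blast
  then have S: "{A, B, C} = ?S" by (metis list.set set_mset_mset empty_set)
  have P: "is_perm \<sigma> \<and> 3 \<le> length \<sigma>" if "\<sigma> \<in> {A, B, C}" for \<sigma> using that p len unfolding S by auto
  have m: "meets_growth_classes {A, B, C}" using meets S by simp
  have "listed_up_to_symmetry A B C"
  proof (cases "monotone_list A \<or> monotone_list B \<or> monotone_list C")
    case True
    then consider "monotone_list A" | "monotone_list B" | "monotone_list C" by blast
    then show ?thesis
    proof cases
      case 1 then show ?thesis using listed_contains_monotone[of A B C] P m by simp
    next
      case 2
      then have "listed_up_to_symmetry B A C"
        using listed_contains_monotone[of B A C] P m by (simp add: insert_commute)
      then show ?thesis by (rule listed_up_to_symmetry_permute) simp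
    next
      case 3
      then have "listed_up_to_symmetry C A B"
        using listed_contains_monotone[of C A B] P m by (simp add: insert_commute)
      then show ?thesis by (rule listed_up_to_symmetry_permute) simp
    qed
  next
    case False
    then show ?thesis using listed_layered[of A B C] rA B(2) P m by simp
  qed
  then show ?thesis using C by (rule listed_up_to_symmetry_permute)
qed

lemma listed_up_to_symmetry_meets:
  assumes p: "is_perm \<alpha>" "is_perm \<beta>" "is_perm \<gamma>"
    and len: "3 \<le> length \<alpha>" "3 \<le> length \<beta>" "3 \<le> length \<gamma>"
    and "listed_up_to_symmetry \<alpha> \<beta> \<gamma>"
  shows "meets_growth_classes {\<alpha>, \<beta>, \<gamma>}"
proof -
  obtain f a b c where f: "f \<in> symmetries" and abc: "mset [a, b, c] = mset [f \<alpha>, f \<beta>, f \<gamma>]" "listed a b c"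
    using assms(7) unfolding listed_up_to_symmetry_def by blast
  have S: "{a, b, c} = f ` {\<alpha>, \<beta>, \<gamma>}"
    using arg_cong[OF abc(1), of set_mset] by simp
  have "is_perm \<sigma> \<and> 3 \<le> length \<sigma>" if \<sigma>: "\<sigma> \<in> {a, b, c}" for \<sigma>
  proof -
    obtain \<rho> where r: "\<rho> \<in> {\<alpha>, \<beta>, \<gamma>}" "\<sigma> = f \<rho>" using \<sigma> unfolding S by (rule imageE)
    then have "is_perm \<rho>" "3 \<le> length \<rho>" using p len by auto
    then show ?thesis using symmetries_perm[OF f] r(2) by simp
  qed
  then have "meets_growth_classes {a, b, c}" using listed_meets[OF _ _ _ _ _ _ abc(2)] by blast
  then show ?thesis
    using meets_growth_classes_symmetry[OF f, of "{\<alpha>, \<beta>, \<gamma>}"] p unfolding S by blast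
qed

theorem theorem3p2:
  fixes \<alpha> \<beta> \<gamma> :: "nat list"
  assumes "is_perm \<alpha>" "is_perm \<beta>" "is_perm \<gamma>"
    and "length \<alpha> \<ge> 3" "length \<beta> \<ge> 3" "length \<gamma> \<ge> 3"
  shows "polynomial_growth (Av {\<alpha>, \<beta>, \<gamma>}) \<longleftrightarrow>
    (\<exists>f\<in>symmetries. \<exists>a b c s m n.
      mset [a, b, c] = mset [f \<alpha>, f \<beta>, f \<gamma>] \<and>
      s = length a \<and> m = length b \<and> n = length c \<and>
      ((a = [2, 1, 3] \<and>
         (([3, 4, 1, 2] \<preceq> b \<and> b \<in> L2R \<and>
             (\<exists>k\<le>n. c = [1..<k+1] @ rev [k+1..<n+1])) \<or>
          ((\<exists>j. 1 \<le> j \<and> j < m \<and> b = rev [j+2..<m+1] @ [j, j+1] @ rev [1..<j]) \<and>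
             (\<exists>k\<le>n. c = [1..<k+1] @ rev [k+1..<n+1])) \<or>
          (b = rev [3..<m+1] @ [1, 2] \<and> c \<in> W [1, -1])))
       \<or>
       (sorted_wrt (<) a \<and>
         (([3, 4, 1, 2] \<preceq> b \<and> b \<in> L2R \<and>
             c \<in> W [-1, -1] \<inter> class_inverse (W [-1, -1])) \<or>
          polynomial_growth (Av {a, b})))
       \<or>
       (a = [2, 1] @ [3..<s+1] \<and>
         (([3, 4, 1, 2] \<preceq> b \<and> b \<in> L2R \<and> c = [1] @ rev [2..<n+1]) \<or>
          ((\<exists>j. 1 \<le> j \<and> j < m \<and> b = rev [j+2..<m+1] @ [j, j+1] @ rev [1..<j]) \<and>
             (\<exists>k\<le>n. c = [1..<k+1] @ rev [k+1..<n+1])) \<or>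
          (b = rev [3..<m+1] @ [1, 2] \<and> c \<in> W [1, -1])))))"
proof -
  have "polynomial_growth (Av {\<alpha>, \<beta>, \<gamma>}) \<longleftrightarrow> meets_growth_classes {\<alpha>, \<beta>, \<gamma>}"
    unfolding meets_growth_classes_def by (rule polynomial_growth_Av_iff) (use assms(1-3) in auto)
  also have "\<dots> \<longleftrightarrow> listed_up_to_symmetry \<alpha> \<beta> \<gamma>"
    using meets_listed_up_to_symmetry[OF assms] listed_up_to_symmetry_meets[OF assms] by blast
  \<comment> \<open>The quantified \<open>s\<close>, \<open>m\<close> and \<open>n\<close> are fixed
    by equations and are eliminated.\<close>
  finally show ?thesis unfolding listed_up_to_symmetry_def listed_def by simp
qed

end
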